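(* The commutator subgroup $[T_B,T_B]$ of the group $T_B$ of dyadic rearrangements of the basilica is simple.
   Context: Identify the unit circle $S^1$ with $\mathbb{R}/\mathbb{Z}$. An arc $\{a,b\}$ is a hyperbolic geodesic of the closed unit disk joining two distinct points $a,b\in S^1$. The primary arc of a closed interval $[a,b]$ of the circle is the arc joining $a+\tfrac14(b-a)$ and $b-\tfrac14(b-a)$ (so it cuts the interval into three pieces with length ratio $1:2:1$). Arc diagrams: start with the two arcs $\{1/3,2/3\}$ and $\{1/6,5/6\}$, whose endpoints divide the circle into the four intervals $[1/6,1/3]$, $[1/3,2/3]$, $[2/3,5/6]$, $[-1/6,1/6]$. Finitely many times (possibly zero), choose one of the current intervals and add its primary arc, which replaces that interval by three intervals. Any finite collection of arcs obtained this way is an arc diagram. It is regarded as a 2-complex on the closed disk: the vertices are the arc endpoints, the edges are the arcs and the circle intervals between consecutive endpoints, and the faces are the complementary regions. Two arc diagrams are isomorphic if there is an orientation-preserving isomorphism of these 2-complexes (so circle intervals go to circle intervals and arcs to arcs). Given an isomorphism $\varphi\colon\mathcal{D}\to\mathcal{R}$ of arc diagrams, let $f\colon S^1\to S^1$ be the orientation-preserving piecewise-linear homeomorphism sending each interval of $\mathcal{D}$ linearly onto the corresponding interval of $\mathcal{R}$. Such an $f$ is called a dyadic rearrangement of the basilica, and $T_B$ is the set of all of them; it is a group under composition. *)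

theory Defs
  imports Complex_Main "HOL-Algebra.Generated_Groups"
begin

section \<open>The circle as reals modulo integers\<close>

definition same_mod_Z :: "real \<Rightarrow> real \<Rightarrow> bool" where
  "same_mod_Z x y \<longleftrightarrow> x - y \<in> \<int>"

lemma same_mod_Z_frac_iff: "same_mod_Z x y \<longleftrightarrow> frac x = frac y"
proof
  assume "same_mod_Z x y"
  then obtain n where "x = y + of_int n"
    unfolding same_mod_Z_def by (metis Ints_cases add_diff_cancel_left' diff_add_cancel add.commute)
  then show "frac x = frac y" by (simp add: frac_def)
next
  assume "frac x = frac y"
  then have "x - y = of_int (\<lfloor>x\<rfloor> - \<lfloor>y\<rfloor>)" by (simp add: frac_def)
  then show "same_mod_Z x y" unfolding same_mod_Z_def by (metis Ints_of_int)
qed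

quotient_type circle = real / same_mod_Z
  by (rule equivpI) (auto simp: reflp_def symp_def transp_def same_mod_Z_frac_iff)

lift_definition pt :: "real \<Rightarrow> circle" is "\<lambda>x. x" .

lift_definition shift :: "circle \<Rightarrow> real \<Rightarrow> circle" is "\<lambda>x t. x + t"
  by (simp add: same_mod_Z_def)

text \<open>The number \<open>b - a\<close>, that is, the length of the positively oriented interval from \<open>a\<close>
  to \<open>b\<close>. It lies in \<open>[0, 1)\<close>, and it is 0 for \<open>a = b\<close>.\<close>
lift_definition len :: "circle \<Rightarrow> circle \<Rightarrow> real" is "\<lambda>x y. frac (y - x)"
proof -
  fix x x' y y' :: real
  assume "same_mod_Z x x'" "same_mod_Z y y'"
  then have "(y - y') - (x - x') \<in> \<int>" unfolding same_mod_Z_def by (rule Ints_diff[rotated])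
  then have "same_mod_Z (y - x) (y' - x')" unfolding same_mod_Z_def by (simp add: algebra_simps)
  then show "frac (y - x) = frac (y' - x')" by (simp add: same_mod_Z_frac_iff)
qed

text \<open>The closed interval \<open>[a, b]\<close> of the circle, for \<open>a \<noteq> b\<close>, as a set of points.\<close>
definition ivl :: "circle \<Rightarrow> circle \<Rightarrow> circle set" where
  "ivl a b = {shift a t | t. 0 \<le> t \<and> t \<le> len a b}"


section \<open>Arc diagrams\<close>

text \<open>A hyperbolic geodesic of the closed disk is determined by its two endpoints, so an arc is
  encoded as the set of its endpoints, and a collection of arcs as a set of such sets.\<close>
type_synonym arc = "circle set"

definition primary_arc :: "circle \<Rightarrow> circle \<Rightarrow> arc" where
  "primary_arc a b = {shift a (len a b / 4), shift b (- (len a b / 4))}"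

definition vertices :: "arc set \<Rightarrow> circle set" where
  "vertices D = \<Union> D"

text \<open>The circle intervals between consecutive arc endpoints, each encoded as the ordered pair of
  its initial and final point with respect to the positive orientation.\<close>
definition intervals :: "arc set \<Rightarrow> (circle \<times> circle) set" where
  "intervals D = {(a, b). a \<in> vertices D \<and> b \<in> vertices D \<and> a \<noteq> b \<and> ivl a b \<inter> vertices D = {a, b}}"

inductive arc_diagram :: "arc set \<Rightarrow> bool" where
  base: "arc_diagram {{pt (1/3), pt (2/3)}, {pt (1/6), pt (5/6)}}"
| add_arc: "arc_diagram D \<Longrightarrow> (a, b) \<in> intervals D \<Longrightarrow> arc_diagram (insert (primary_arc a b) D)"


section \<open>Isomorphisms of arc diagrams\<close>

text \<open>Two circle intervals border the same complementary region iff no arc \<open>{p, q}\<close> separates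
  them. Both orders of \<open>p\<close> and \<open>q\<close> are covered by the quantifiers, hence both sides of the arc.\<close>
definition same_region :: "arc set \<Rightarrow> ((circle \<times> circle) \<times> (circle \<times> circle)) set" where
  "same_region D = {((a, b), (c, d)). (a, b) \<in> intervals D \<and> (c, d) \<in> intervals D \<and>
     (\<forall>p q. {p, q} \<in> D \<longrightarrow> (ivl a b \<subseteq> ivl p q \<longleftrightarrow> ivl c d \<subseteq> ivl p q))}"

text \<open>A face is encoded as the set of circle intervals on its boundary. In an arc diagram every
  complementary region has such an interval: this holds for the initial diagram, and adding a
  primary arc leaves intervals on both of its sides.\<close>
definition faces :: "arc set \<Rightarrow> (circle \<times> circle) set set" where
  "faces D = intervals D // same_region D"

text \<open>An orientation-preserving isomorphism of the 2-complexes, given by its action on vertices.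
  This determines the action on all cells: circle intervals go to circle intervals with their
  positive orientation, arcs to arcs, and faces to faces. Arcs and circle intervals
  have to be treated separately since they may have the same endpoints.\<close>
definition diagram_iso :: "(circle \<Rightarrow> circle) \<Rightarrow> arc set \<Rightarrow> arc set \<Rightarrow> bool" where
  "diagram_iso \<phi> D R \<longleftrightarrow>
     bij_betw \<phi> (vertices D) (vertices R) \<and>
     map_prod \<phi> \<phi> ` intervals D = intervals R \<and>
     (\<lambda>c. \<phi> ` c) ` D = R \<and>
     (\<lambda>F. map_prod \<phi> \<phi> ` F) ` faces D = faces R"


section \<open>The group of dyadic rearrangements of the basilica\<close>

text \<open>\<open>f\<close> maps each interval of \<open>D\<close> linearly onto the interval corresponding to it under \<open>\<phi>\<close>.
  As the intervals cover the circle, this determines \<open>f\<close>; for an isomorphism \<open>\<phi>\<close> of arc diagrams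
  the resulting \<open>f\<close> is an orientation-preserving piecewise-linear homeomorphism.\<close>
definition induced_map :: "arc set \<Rightarrow> (circle \<Rightarrow> circle) \<Rightarrow> (circle \<Rightarrow> circle) \<Rightarrow> bool" where
  "induced_map D \<phi> f \<longleftrightarrow>
     (\<forall>(a, b) \<in> intervals D. \<forall>t \<in> {0..1}.
        f (shift a (t * len a b)) = shift (\<phi> a) (t * len (\<phi> a) (\<phi> b)))"

definition rearrangements :: "(circle \<Rightarrow> circle) set" where
  "rearrangements = {f. \<exists>D R \<phi>. arc_diagram D \<and> arc_diagram R \<and> diagram_iso \<phi> D R \<and> induced_map D \<phi> f}"

definition T_B :: "(circle \<Rightarrow> circle) monoid" where
  "T_B = \<lparr>carrier = rearrangements, mult = (\<circ>), one = id\<rparr>"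


section \<open>Simple groups\<close>

text \<open>The library locale \<open>simple_group\<close> requires \<open>order G > 1\<close>, where \<open>order\<close> is the cardinality
  as a natural number and hence 0 for infinite groups. It therefore excludes infinite groups.\<close>
definition is_simple :: "('a, 'b) monoid_scheme \<Rightarrow> bool" where
  "is_simple G \<longleftrightarrow> group G \<and> carrier G \<noteq> {\<one>\<^bsub>G\<^esub>} \<and>
     (\<forall>N. N \<lhd> G \<longrightarrow> N = {\<one>\<^bsub>G\<^esub>} \<or> N = carrier G)"

end

theory Submission
  imports Defs "HOL-Library.Sublist"
begin

text \<open>
  The arc \<open>{1/6, 5/6}\<close> cuts the circle into \<open>[-1/6, 1/6]\<close> and \<open>[1/6, 5/6]\<close>, and \<open>{1/3, 2/3}\<close> is just
  the primary arc of the second interval. So the circle consists of two \<open>root intervals\<close>, both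
  subdivided in the same self-similar way into left, middle and right parts. Every interval of an arc
  diagram has an address, a root with a word in three letters; arc diagrams are pairs of finite ternary
  trees; and the arcs that ever occur form one lamination, in which distinct arcs have no common
  endpoint. In these terms a rearrangement is a bijection of the circle that permutes the
  lamination and maps every sufficiently small address interval affinely onto an address interval
  (\<open>rearrangements_eq\<close>). This form makes composition and inverses easy, and relations between
  rearrangements can be checked by rewriting prefixes of addresses.

  Three kinds of rearrangements suffice. The rotation \<open>rot J\<close> is supported in the interval \<open>J\<close> and is
  the standard generator of Thompson's group \<open>F\<close> acting on the intervals of \<open>J\<close> that are not under
  an arc of \<open>J\<close>; the half turn \<open>t \<mapsto> t + 1/2\<close> exchanges the two arcs of the initial diagram; and \<open>flip\<close>
  exchanges the two root intervals. Colour the regions in two colours so that neighbours differ. Then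
  \<open>flip\<close> exchanges the colours, whereas the rotations, the half turn and its conjugate by \<open>flip\<close>
  preserve them. The latter generate a subgroup \<open>even_rearr\<close>, which turns out to be the
  commutator subgroup.

  The argument has four ingredients.
  \<^item> Generation (\<open>even_or_odd\<close>): \<open>even_rearr\<close> has index at most two. It takes any interval under an arc
    to a root (\<open>linked_root\<close>), so a rearrangement can be adjusted until it fixes one root
    interval pointwise; what is left is a change of subdivision of the other root interval, which is a
    product of rotations (\<open>straightens_tree\<close>). Hence all commutators lie in \<open>even_rearr\<close>.
  \<^item> Relations: the pentagon relation for rotations (\<open>rot_pentagon\<close>) shows that one rotation deep inside
    \<open>J\<close> is conjugate to a commutator of \<open>rot J\<close> with another rotation (\<open>rot_commutator\<close>), and that each
    rotation is a product of conjugates of rotations at its left and right parts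
    (\<open>rot_from_sides\<close>). The half turn is a product of conjugates of rotations (\<open>half_turns_mem\<close>).
  \<^item> Transitivity (\<open>linked_colour\<close>): under \<open>even_rearr\<close>, the intervals that end in a left or right
    part form at most two orbits, told apart by the colour of the adjacent region.
  \<^item> Higman's double commutator (\<open>double_commutator\<close>): a nontrivial normal subgroup has an element \<open>n\<close>
    that moves some interval \<open>U\<close> off itself, so it contains every commutator of two even
    rearrangements supported in \<open>U\<close>. By the relations it contains rotations
    inside \<open>U\<close>, in regions of both colours; by transitivity it contains all rotations,
    hence the half turns, hence everything.
  The same relations, applied with conjugation by all rearrangements, put \<open>even_rearr\<close> inside the
  commutator subgroup.
\<close>

section \<open>Addresses of the subdivision intervals\<close>

lemma pt_eq_iff: "pt x = pt y \<longleftrightarrow> x - y \<in> \<int>"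
  by transfer (simp add: same_mod_Z_def)

lemma shift_pt [simp]: "shift (pt x) t = pt (x + t)"
  by transfer (simp add: same_mod_Z_def)

lemma len_pt: "len (pt x) (pt y) = frac (y - x)"
  by transfer simp

lemma pt_cases: obtains x where "y = pt x"
  by (metis Quotient_abs_rep[OF Quotient_circle] pt.abs_eq)

lemma Ints_small_zero: "x \<in> \<int> \<Longrightarrow> \<bar>x\<bar> < 1 \<Longrightarrow> x = (0::real)"
  using Ints_nonzero_abs_less1 by blast

datatype letter = Lt | Md | Rt

text \<open>The root \<open>False\<close> is \<open>[-1/6, 1/6]\<close> and the root \<open>True\<close> is \<open>[1/6, 5/6]\<close>. The word is read from the root
downwards, so prefixes correspond to larger intervals.\<close>
type_synonym addr = "bool \<times> letter list"

fun loff :: "letter \<Rightarrow> real" where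
  "loff Lt = 0" | "loff Md = 1/4" | "loff Rt = 3/4"

fun lsc :: "letter \<Rightarrow> real" where
  "lsc Lt = 1/4" | "lsc Md = 1/2" | "lsc Rt = 1/4"

text \<open>Inside the unit interval, the word \<open>w\<close> stands for the interval from \<open>off w\<close> to \<open>off w + sc w\<close>.\<close>
fun off :: "letter list \<Rightarrow> real" where
  "off [] = 0" | "off (c # w) = loff c + lsc c * off w"

fun sc :: "letter list \<Rightarrow> real" where
  "sc [] = 1" | "sc (c # w) = lsc c * sc w"

lemma lsc_pos: "0 < lsc c" by (cases c) auto
lemma loff_nonneg: "0 \<le> loff c" by (cases c) auto
lemma loff_lsc_le: "loff c + lsc c \<le> 1" by (cases c) auto
lemma lsc_le: "lsc c \<le> 1/2" by (cases c) auto

lemma sc_pos [simp]: "0 < sc w" by (induction w) (auto simp: lsc_pos)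

lemma sc_le_1: "sc w \<le> 1"
proof (induction w)
  case (Cons c w)
  have "lsc c * sc w \<le> 1/2 * 1"
    by (rule mult_mono) (use Cons lsc_le[of c] sc_pos[of w] in \<open>auto simp del: sc_pos\<close>)
  then show ?case by simp
qed simp

lemma sc_lt_1:
  assumes "w \<noteq> []" shows "sc w < 1"
proof -
  obtain c v where w: "w = c # v" using assms by (cases w) auto
  have "lsc c * sc v \<le> 1/2 * 1"
    by (rule mult_mono) (use sc_le_1[of v] lsc_le[of c] sc_pos[of v] in \<open>auto simp del: sc_pos\<close>)
  then show ?thesis by (simp add: w)
qed

lemma off_nonneg: "0 \<le> off w"
  by (induction w) (auto simp: lsc_pos loff_nonneg less_imp_le)

lemma off_sc_le_1: "off w + sc w \<le> 1"
proof (induction w)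
  case (Cons c w)
  have "lsc c * (off w + sc w) \<le> lsc c" using Cons lsc_pos[of c] by simp
  then show ?case using loff_lsc_le[of c] by (simp add: algebra_simps)
qed simp

lemma off_append: "off (u @ v) = off u + sc u * off v"
  by (induction u) (auto simp: algebra_simps)

lemma sc_append: "sc (u @ v) = sc u * sc v"
  by (induction u) auto

lemma unit_bounds:
  assumes "0 \<le> t" "t \<le> 1"
  shows "0 \<le> off w + sc w * t" "off w + sc w * t \<le> 1"
proof -
  have "0 \<le> sc w * t" "sc w * t \<le> sc w"
    using assms sc_pos[of w] by (auto simp: mult_left_le less_imp_le)
  then show "0 \<le> off w + sc w * t" "off w + sc w * t \<le> 1"
    using off_nonneg[of w] off_sc_le_1[of w] by linarith+
qed

lemma unit_bounds_strict:
  "0 \<le> t \<Longrightarrow> t < 1 \<Longrightarrow> off w + sc w * t < 1"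
  "0 < t \<Longrightarrow> 0 < off w + sc w * t"
proof -
  assume "0 \<le> t" "t < 1"
  then have "sc w * t < sc w" by simp
  then show "off w + sc w * t < 1" using off_sc_le_1[of w] by linarith
next
  assume "0 < t"
  then show "0 < off w + sc w * t" using off_nonneg[of w] by (simp add: add_nonneg_pos)
qed

text \<open>At the first letter where the two words differ, their intervals separate into different parts of
the subdivision \<open>1 : 2 : 1\<close>.\<close>
lemma off_separated:
  assumes "\<not> prefix u v" "\<not> prefix v u"
  shows "off u + sc u \<le> off v \<or> off v + sc v \<le> off u"
proof -
  obtain p a b x y where *: "u = p @ a # x" "v = p @ b # y" "a \<noteq> b"
    using parallel_decomp[of u v] assms by (auto simp: parallel_def)
  have step: "loff a + lsc a * (off x + sc x) \<le> loff b + lsc b * off y"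
    if "loff a + lsc a \<le> loff b" for a b x y
  proof -
    have "lsc a * (off x + sc x) \<le> lsc a * 1" "0 \<le> lsc b * off y"
      using off_sc_le_1[of x] off_nonneg[of y] lsc_pos[of a] lsc_pos[of b] by auto
    then show ?thesis using that by linarith
  qed
  have "loff a + lsc a \<le> loff b \<or> loff b + lsc b \<le> loff a"
    using \<open>a \<noteq> b\<close> by (cases a; cases b) auto
  then have "loff a + lsc a * (off x + sc x) \<le> loff b + lsc b * off y
     \<or> loff b + lsc b * (off y + sc y) \<le> loff a + lsc a * off x"
    using step by blast
  then have "sc p * (loff a + lsc a * (off x + sc x)) \<le> sc p * (loff b + lsc b * off y)
     \<or> sc p * (loff b + lsc b * (off y + sc y)) \<le> sc p * (loff a + lsc a * off x)"
    by simp
  then show ?thesis unfolding * by (simp add: off_append sc_append algebra_simps)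
qed

fun root_off :: "bool \<Rightarrow> real" where
  "root_off False = -1/6" | "root_off True = 1/6"

fun root_len :: "bool \<Rightarrow> real" where
  "root_len False = 1/3" | "root_len True = 2/3"

text \<open>The affine parametrisation of the interval with address \<open>J\<close> by the unit interval.\<close>
definition gam :: "addr \<Rightarrow> real \<Rightarrow> circle" where
  "gam J t = pt (root_off (fst J) + root_len (fst J) * (off (snd J) + sc (snd J) * t))"

definition ext :: "addr \<Rightarrow> letter list \<Rightarrow> addr" (infixl "\<odot>" 70) where
  "J \<odot> v = (fst J, snd J @ v)"

abbreviation lft :: "addr \<Rightarrow> circle" where "lft J \<equiv> gam J 0"
abbreviation rgt :: "addr \<Rightarrow> circle" where "rgt J \<equiv> gam J 1"
abbreviation depth :: "addr \<Rightarrow> nat" where "depth J \<equiv> length (snd J)"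

text \<open>Supports of rearrangements are measured by open parts. The half-open parts of the intervals
of a diagram tile the circle without overlap, which gives disjointness in the cleanest form.\<close>
definition closed_part :: "addr \<Rightarrow> circle set" where "closed_part J = gam J ` {0..1}"
definition open_part :: "addr \<Rightarrow> circle set" where "open_part J = gam J ` {0<..<1}"
definition half_part :: "addr \<Rightarrow> circle set" where "half_part J = gam J ` {0..<1}"

lemma ext_simps [simp]: "(r, w) \<odot> v = (r, w @ v)" "fst (J \<odot> v) = fst J" "snd (J \<odot> v) = snd J @ v"
  by (simp_all add: ext_def)

lemma ext_Nil [simp]: "J \<odot> [] = J" by (simp add: ext_def)
lemma ext_assoc [simp]: "J \<odot> u \<odot> v = J \<odot> (u @ v)" by (simp add: ext_def)
lemma ext_inject [simp]: "J \<odot> u = J \<odot> v \<longleftrightarrow> u = v" by (simp add: ext_def)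
lemma ext_eq_self [simp]: "J \<odot> u = J \<longleftrightarrow> u = []" by (cases J) (simp add: ext_def)

lemma gam_ext: "gam (J \<odot> v) t = gam J (off v + sc v * t)"
  by (simp add: gam_def off_append sc_append algebra_simps)

lemma gam_root: "gam (r, w) t = gam (r, []) (off w + sc w * t)"
  using gam_ext[of "(r, [])" w t] by simp

text \<open>The root intervals have lengths \<open>1/3\<close> and \<open>2/3\<close>, so two parameters describe the same point modulo the
integers only at the two points where the root intervals meet.\<close>
lemma gam_root_eq_iff:
  assumes "gam (r, []) s = gam (r', []) t" "0 \<le> s" "s \<le> 1" "0 \<le> t" "t \<le> 1"
  shows "(r = r' \<and> s = t) \<or> (r \<noteq> r' \<and> (s, t) \<in> {(0, 1), (1, 0)})"
proof -
  have *: "root_off r + root_len r * s - (root_off r' + root_len r' * t) \<in> \<int>" (is "?d \<in> _")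
    using assms(1) by (simp add: gam_def pt_eq_iff)
  show ?thesis
  proof (cases "r = r'")
    case True
    then have "?d = root_len r * (s - t)" by (simp add: algebra_simps)
    moreover have "\<bar>root_len r * (s - t)\<bar> < 1"
      using assms by (cases r) (auto simp: abs_if)
    ultimately have "root_len r * (s - t) = 0" using * Ints_small_zero by metis
    then show ?thesis using True by (cases r) auto
  next
    case False
    obtain k where k: "?d = of_int k" using * Ints_cases by blast
    consider "r" "\<not> r'" | "\<not> r" "r'" using False by blast
    then show ?thesis
    proof cases
      case 1
      then have d: "of_int k = 1/3 + 2/3 * s - 1/3 * t" using k by simp
      have "0 \<le> real_of_int k" "real_of_int k \<le> 1" using d assms by linarith+
      then have "k = 0 \<or> k = 1" by auto
      then show ?thesis using d assms 1 by auto
    next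
      case 2
      then have d: "of_int k = 1/3 * s - 1/3 - 2/3 * t" using k by simp
      have "-1 \<le> real_of_int k" "real_of_int k \<le> 0" using d assms by linarith+
      then have "k = 0 \<or> k = -1" by linarith
      then show ?thesis using d assms 2 by auto
    qed
  qed
qed

lemma gam_inj:
  assumes "gam J s = gam J t" "0 \<le> s" "s \<le> 1" "0 \<le> t" "t \<le> 1"
  shows "s = t"
proof -
  obtain r w where J: "J = (r, w)" by (cases J)
  have "off w + sc w * s = off w + sc w * t"
    using gam_root_eq_iff[OF assms(1)[unfolded J gam_root[of r w]] unit_bounds[OF assms(2,3)]
        unit_bounds[OF assms(4,5)]] by auto
  then show ?thesis using sc_pos[of w] by (metis add_left_cancel less_irrefl mult_left_cancel)
qed

lemma root_rgt: "gam (r, []) 1 = gam (\<not> r, []) 0"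
  by (cases r) (auto simp: gam_def pt_eq_iff)

lemma circle_cover: obtains r t where "y = gam (r, []) t" "0 \<le> t" "t < 1"
proof -
  obtain x where x: "y = pt x" by (rule pt_cases)
  define z where "z = frac (x + 1/6) - 1/6"
  have z: "-1/6 \<le> z" "z < 5/6" "y = pt z"
    using frac_ge_0[of "x + 1/6"] frac_lt_1[of "x + 1/6"]
    by (simp_all add: z_def x pt_eq_iff) (simp add: frac_def)
  show ?thesis
  proof (cases "z < 1/6")
    case True
    show ?thesis
      by (rule that[of False "3 * (z + 1/6)"]) (use z True in \<open>auto simp: gam_def field_simps\<close>)
  next
    case False
    show ?thesis
      by (rule that[of True "3/2 * (z - 1/6)"]) (use z False in \<open>auto simp: gam_def field_simps\<close>)
  qed
qed

text \<open>Address intervals are nested if their addresses are comparable, and otherwise they do not overlap.\<close>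
definition comparable :: "addr \<Rightarrow> addr \<Rightarrow> bool" where
  "comparable J K \<longleftrightarrow> (\<exists>v. K = J \<odot> v) \<or> (\<exists>v. J = K \<odot> v)"

lemma comparable_sym: "comparable J K \<longleftrightarrow> comparable K J"
  by (auto simp: comparable_def)

lemma comparable_ext [simp]: "comparable J (J \<odot> v)" "comparable (J \<odot> v) J"
  by (auto simp: comparable_def)

lemma comparable_extD: "comparable (J \<odot> v) K \<Longrightarrow> comparable J K"
  by (cases J; cases K) (auto simp: comparable_def append_eq_append_conv2)

lemma comparable_ext_cancel [simp]: "comparable (J \<odot> u) (J \<odot> v) \<longleftrightarrow> prefix u v \<or> prefix v u"
  by (auto simp: comparable_def prefix_def)

lemma incomparable_param:
  assumes "\<not> comparable (r, u) (r, v)"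
  shows "off u + sc u \<le> off v \<or> off v + sc v \<le> off u"
  using off_separated[of u v] assms by (auto simp: comparable_def prefix_def)

lemma half_part_disjoint:
  assumes "\<not> comparable J K" shows "half_part J \<inter> half_part K = {}"
proof (rule ccontr)
  assume "half_part J \<inter> half_part K \<noteq> {}"
  then obtain s t where st: "gam J s = gam K t" "0 \<le> s" "s < 1" "0 \<le> t" "t < 1"
    by (auto simp: half_part_def)
  obtain r u r' v where JK: "J = (r, u)" "K = (r', v)" by (cases J; cases K)
  have *: "r = r'" "off u + sc u * s = off v + sc v * t"
    using gam_root_eq_iff[OF st(1)[unfolded JK gam_root[of _ u] gam_root[of _ v]]]
      unit_bounds[of s u] unit_bounds[of t v] unit_bounds_strict(1)[of s u]
      unit_bounds_strict(1)[of t v] st by auto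
  have "off u + sc u \<le> off v \<or> off v + sc v \<le> off u"
    using incomparable_param assms * JK by blast
  moreover have "sc u * s < sc u" "sc v * t < sc v" "0 \<le> sc u * s" "0 \<le> sc v * t"
    using st by (auto simp: less_imp_le)
  ultimately show False using *(2) by linarith
qed

lemma open_closed_disjoint:
  assumes "\<not> comparable J K" shows "open_part J \<inter> closed_part K = {}"
proof (rule ccontr)
  assume "open_part J \<inter> closed_part K \<noteq> {}"
  then obtain s t where st: "gam J s = gam K t" "0 < s" "s < 1" "0 \<le> t" "t \<le> 1"
    by (auto simp: open_part_def closed_part_def)
  obtain r u r' v where JK: "J = (r, u)" "K = (r', v)" by (cases J; cases K)
  have *: "r = r'" "off u + sc u * s = off v + sc v * t"
    using gam_root_eq_iff[OF st(1)[unfolded JK gam_root[of _ u] gam_root[of _ v]]]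
      unit_bounds[of s u] unit_bounds[of t v] unit_bounds_strict(1)[of s u]
      unit_bounds_strict(2)[of s u] st by auto
  have "off u + sc u \<le> off v \<or> off v + sc v \<le> off u"
    using incomparable_param assms * JK by blast
  moreover have "sc u * s < sc u" "0 < sc u * s" "sc v * t \<le> sc v" "0 \<le> sc v * t"
    using st by (auto simp: less_imp_le)
  ultimately show False using *(2) by linarith
qed

lemma closed_part_ext: "closed_part (J \<odot> v) \<subseteq> closed_part J"
  unfolding closed_part_def using unit_bounds[of _ v] by (auto simp: gam_ext)

lemma half_part_ext: "half_part (J \<odot> v) \<subseteq> half_part J"
  unfolding half_part_def using unit_bounds[of _ v] unit_bounds_strict(1)[of _ v]
  by (auto simp: gam_ext)

lemma open_part_ext: "open_part (J \<odot> v) \<subseteq> open_part J"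
  unfolding open_part_def using unit_bounds_strict[of _ v]
  by (auto simp: gam_ext intro!: imageI)

lemma parts_incl: "open_part J \<subseteq> half_part J" "half_part J \<subseteq> closed_part J" "open_part J \<subseteq> closed_part J"
  by (auto simp: open_part_def closed_part_def half_part_def)

lemma gam_mem:
  "0 \<le> t \<Longrightarrow> t \<le> 1 \<Longrightarrow> gam J t \<in> closed_part J"
  "0 \<le> t \<Longrightarrow> t < 1 \<Longrightarrow> gam J t \<in> half_part J"
  "0 < t \<Longrightarrow> t < 1 \<Longrightarrow> gam J t \<in> open_part J"
  by (auto simp: open_part_def closed_part_def half_part_def)

lemma ends_not_open: "lft J \<notin> open_part J" "rgt J \<notin> open_part J"
  using gam_inj[of J 0] gam_inj[of J 1] by (force simp: open_part_def)+

lemma lft_ne_rgt: "lft J \<noteq> rgt J" using gam_inj[of J 0 1] by auto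

text \<open>Equal left ends make the addresses comparable, and then equal right ends leave no room for a proper
extension, since extensions have smaller length.\<close>
lemma gam_determines:
  assumes "lft J = lft K" "rgt J = rgt K" shows "J = K"
proof -
  have "comparable J K"
    using half_part_disjoint[of J K] assms gam_mem(2)[of 0 J] gam_mem(2)[of 0 K] by auto
  moreover have descend: "v = []" if "lft L = lft (L \<odot> v)" "rgt L = rgt (L \<odot> v)" for L v
  proof -
    have "gam L 0 = gam L (off v + sc v * 0)" "gam L 1 = gam L (off v + sc v * 1)"
      by (simp_all only: that gam_ext[symmetric])
    then have "0 = off v + sc v * 0" "1 = off v + sc v * 1"
      by (meson gam_inj order_refl unit_bounds zero_le_one)+
    then have "\<not> sc v < 1" by linarith
    then show "v = []" using sc_lt_1[of v] by blast
  qed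
  ultimately show ?thesis
    unfolding comparable_def
  proof (elim disjE exE)
    fix v assume K: "K = J \<odot> v"
    have "v = []" by (rule descend[of J]) (simp_all only: assms K[symmetric])
    then show ?thesis using K by simp
  next
    fix v assume K: "J = K \<odot> v"
    have "v = []" by (rule descend[of K]) (simp_all only: assms K[symmetric])
    then show ?thesis using K by simp
  qed
qed


section \<open>The lamination and linear pieces\<close>

definition arc_at :: "addr \<Rightarrow> arc" where "arc_at J = {gam J (1/4), gam J (3/4)}"

abbreviation inverse_map :: "(circle \<Rightarrow> circle) \<Rightarrow> circle \<Rightarrow> circle" where
  "inverse_map f \<equiv> inv_into UNIV f"

definition root_arc :: arc where "root_arc = {lft (True, []), rgt (True, [])}"

text \<open>All arcs that occur in arc diagrams: the arc between the two root intervals and the primary arcs of all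
address intervals.\<close>
definition lamination :: "arc set" where "lamination = insert root_arc (range arc_at)"

definition lin :: "(circle \<Rightarrow> circle) \<Rightarrow> addr \<Rightarrow> addr \<Rightarrow> bool" where
  "lin f I K \<longleftrightarrow> (\<forall>t\<in>{0..1}. f (gam I t) = gam K t)"

lemma linD: "lin f I K \<Longrightarrow> 0 \<le> t \<Longrightarrow> t \<le> 1 \<Longrightarrow> f (gam I t) = gam K t"
  by (auto simp: lin_def)

lemma lin_ext: "lin f I K \<Longrightarrow> lin f (I \<odot> v) (K \<odot> v)"
  using unit_bounds[of _ v] by (auto simp: lin_def gam_ext)

lemma lin_comp: "lin f I J \<Longrightarrow> lin g J K \<Longrightarrow> lin (g \<circ> f) I K"
  by (auto simp: lin_def)

lemma lin_id: "lin id I I" by (simp add: lin_def)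

lemma lin_arc: "lin f I K \<Longrightarrow> f ` arc_at I = arc_at K"
  by (auto simp: lin_def arc_at_def)

lemma lin_parts:
  assumes "lin f I K"
  shows "f ` closed_part I = closed_part K" "f ` half_part I = half_part K" "f ` open_part I = open_part K"
  using assms by (force simp: lin_def closed_part_def half_part_def open_part_def image_image intro!: image_cong)+

lemma lin_inv: "bij f \<Longrightarrow> lin f I K \<Longrightarrow> lin (inverse_map f) K I"
  unfolding lin_def by (metis bij_inv_eq_iff)

lemma lin_unique: "lin f I K \<Longrightarrow> lin f I L \<Longrightarrow> K = L"
  by (rule gam_determines) (auto simp: lin_def dest: bspec[of _ _ 0] bspec[of _ _ 1])

lemma arc_in_lamination [simp]: "arc_at J \<in> lamination" "root_arc \<in> lamination"
  by (auto simp: lamination_def)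

lemma arc_at_ne: "gam J (1/4) \<noteq> gam J (3/4)"
  using gam_inj[of J "1/4" "3/4"] by auto

lemma arc_at_ends: "arc_at J = {rgt (J \<odot> [Lt]), lft (J \<odot> [Rt])}"
  "arc_at J = {lft (J \<odot> [Md]), rgt (J \<odot> [Md])}"
  by (auto simp: arc_at_def gam_ext)

lemma arc_at_open: "arc_at J \<subseteq> open_part J"
  using gam_mem(3)[of _ J] by (auto simp: arc_at_def)

lemma root_arc_ends: "root_arc = {lft (r, []), rgt (r, [])}"
  using root_rgt[of True] root_rgt[of False] by (cases r) (auto simp: root_arc_def)

text \<open>The endpoints of the primary arc are exactly the interior points where an interval is subdivided.\<close>
lemma arc_at_not_in_child: "arc_at J \<inter> open_part (J \<odot> (c # v)) = {}"
proof -
  have "gam J s \<notin> open_part (J \<odot> [c])" if "s \<in> {1/4, 3/4}" for s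
  proof
    assume "gam J s \<in> open_part (J \<odot> [c])"
    then obtain t where t: "gam J s = gam J (off [c] + sc [c] * t)" "0 < t" "t < 1"
      by (auto simp: open_part_def gam_ext)
    have "s = off [c] + sc [c] * t"
      by (rule gam_inj[OF t(1)]) (use that t unit_bounds[of t "[c]"] in auto)
    then show False using that t by (cases c) auto
  qed
  then have "arc_at J \<inter> open_part (J \<odot> [c]) = {}" by (auto simp: arc_at_def)
  then show ?thesis using open_part_ext[of "J \<odot> [c]" v] by auto
qed

lemma arc_at_child_disjoint: "arc_at J \<inter> arc_at (J \<odot> (c # v)) = {}"
  using arc_at_open[of "J \<odot> (c # v)"] arc_at_not_in_child by blast

lemma arc_at_disjoint:
  assumes "I \<noteq> J" shows "arc_at I \<inter> arc_at J = {}"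
proof (cases "comparable I J")
  case True
  have *: "arc_at I \<inter> arc_at (I \<odot> v) = {}" if "v \<noteq> []" for I v
    using that arc_at_child_disjoint by (cases v) auto
  from True obtain v where "J = I \<odot> v \<or> I = J \<odot> v" unfolding comparable_def by blast
  then show ?thesis
  proof
    assume "J = I \<odot> v" then show ?thesis using *[of v I] assms by (cases "v = []") auto
  next
    assume "I = J \<odot> v" then show ?thesis using *[of v J] assms by (cases "v = []") auto
  qed
next
  case False
  then show ?thesis
    using open_closed_disjoint[OF False] arc_at_open[of I] arc_at_open[of J] parts_incl(3)[of J] by blast
qed

lemma root_arc_not_open: "root_arc \<inter> open_part J = {}"
proof -
  have "open_part J \<subseteq> open_part (fst J, [])"
    using open_part_ext[of "(fst J, [])" "snd J"] by simp
  then show ?thesis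
    unfolding root_arc_ends[of "fst J"] using ends_not_open[of "(fst J, [])"] by blast
qed

lemma root_arc_disjoint: "root_arc \<inter> arc_at J = {}"
  using arc_at_open[of J] root_arc_not_open[of J] by blast

text \<open>A map that permutes the lamination and fixes one end of an arc must therefore fix the other end too.\<close>
lemma lamination_disjoint:
  assumes "c \<in> lamination" "d \<in> lamination" "p \<in> c" "p \<in> d" shows "c = d"
proof (rule ccontr)
  assume "c \<noteq> d"
  then have "c \<inter> d = {}"
    using assms(1,2) arc_at_disjoint root_arc_disjoint unfolding lamination_def
    by (elim insertE imageE; simp add: Int_commute; metis)
  then show False using assms(3,4) by blast
qed

section \<open>Arc diagrams as forests\<close>

datatype tree = Leaf | Node tree tree tree

fun leaves :: "tree \<Rightarrow> letter list set" where
  "leaves Leaf = {[]}"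
| "leaves (Node a b c) = (#) Lt ` leaves a \<union> (#) Md ` leaves b \<union> (#) Rt ` leaves c"

fun nodes :: "tree \<Rightarrow> letter list set" where
  "nodes Leaf = {}"
| "nodes (Node a b c) = insert [] ((#) Lt ` nodes a \<union> (#) Md ` nodes b \<union> (#) Rt ` nodes c)"

lemma finite_leaves: "finite (leaves t)" by (induction t) auto
lemma finite_nodes: "finite (nodes t)" by (induction t) auto

lemma node_or_below_leaf: "w \<in> nodes t \<or> (\<exists>u\<in>leaves t. prefix u w)"
proof (induction t arbitrary: w)
  case (Node a b c)
  show ?case
  proof (cases w)
    case (Cons x v)
    let ?s = "case x of Lt \<Rightarrow> a | Md \<Rightarrow> b | Rt \<Rightarrow> c"
    have "v \<in> nodes ?s \<or> (\<exists>u\<in>leaves ?s. prefix u v)"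
      by (cases x; simp only: letter.case; rule Node.IH)
    then show ?thesis
    proof (elim disjE bexE)
      assume "v \<in> nodes ?s" then show ?thesis using Cons by (cases x) auto
    next
      fix u assume "u \<in> leaves ?s" "prefix u v"
      then show ?thesis using Cons
        by (intro disjI2 bexI[of _ "x # u"]) (cases x; simp)+
    qed
  qed simp
qed simp

lemma leaf_prefix_unique: "u \<in> leaves t \<Longrightarrow> v \<in> leaves t \<Longrightarrow> prefix u v \<Longrightarrow> u = v"
  by (induction t arbitrary: u v) auto

lemma leaf_cover:
  assumes "0 \<le> s" "s < 1"
  shows "\<exists>w\<in>leaves t. \<exists>s'. 0 \<le> s' \<and> s' < 1 \<and> s = off w + sc w * s'"
  using assms
proof (induction t arbitrary: s)
  case (Node a b c)
  consider "s < 1/4" | "1/4 \<le> s" "s < 3/4" | "3/4 \<le> s" by linarith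
  then show ?case
  proof cases
    case 1
    then obtain w s' where "w \<in> leaves a" "0 \<le> s'" "s' < 1" "4 * s = off w + sc w * s'"
      using Node.IH(1)[of "4 * s"] Node.prems by auto
    then show ?thesis by (intro bexI[of _ "Lt # w"] exI[of _ s']) auto
  next
    case 2
    then obtain w s' where "w \<in> leaves b" "0 \<le> s'" "s' < 1" "2 * s - 1/2 = off w + sc w * s'"
      using Node.IH(2)[of "2 * s - 1/2"] Node.prems by auto
    then show ?thesis by (intro bexI[of _ "Md # w"] exI[of _ s']) auto
  next
    case 3
    then obtain w s' where "w \<in> leaves c" "0 \<le> s'" "s' < 1" "4 * s - 3 = off w + sc w * s'"
      using Node.IH(3)[of "4 * s - 3"] Node.prems by auto
    then show ?thesis by (intro bexI[of _ "Rt # w"] exI[of _ s']) auto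
  qed
qed auto

text \<open>The subdivision points in the interior of the unit interval.\<close>
definition inner :: "tree \<Rightarrow> real set" where
  "inner t = (\<Union>w\<in>nodes t. {off w + sc w * (1/4), off w + sc w * (3/4)})"

lemma inner_Node:
  "inner (Node a b c) = {1/4, 3/4} \<union> (\<lambda>s. s / 4) ` inner a \<union> (\<lambda>s. 1/4 + s / 2) ` inner b
     \<union> (\<lambda>s. 3/4 + s / 4) ` inner c"
  unfolding inner_def by (simp add: image_UN UN_Un insert_commute Un_assoc image_Un algebra_simps add_divide_distrib)

lemma leaf_starts: "off ` leaves t = insert 0 (inner t)"
proof (induction t)
  case (Node a b c)
  have "off ` leaves (Node a b c) = (\<lambda>s. s / 4) ` off ` leaves a \<union> (\<lambda>s. 1/4 + s / 2) ` off ` leaves b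
     \<union> (\<lambda>s. 3/4 + s / 4) ` off ` leaves c"
    by (simp add: image_Un image_image)
  then show ?case unfolding Node inner_Node by auto
qed (simp add: inner_def)

lemma leaf_stops: "(\<lambda>w. off w + sc w) ` leaves t = insert 1 (inner t)"
proof (induction t)
  case (Node a b c)
  let ?e = "\<lambda>w. off w + sc w"
  have "?e ` leaves (Node a b c) = (\<lambda>s. s / 4) ` ?e ` leaves a \<union> (\<lambda>s. 1/4 + s / 2) ` ?e ` leaves b
     \<union> (\<lambda>s. 3/4 + s / 4) ` ?e ` leaves c"
    by (simp add: image_Un image_image algebra_simps add_divide_distrib)
  then show ?case unfolding Node inner_Node by auto
qed (simp add: inner_def)

lemma split_leaf:
  "w \<in> leaves t \<Longrightarrow> \<exists>t'. t' \<noteq> Leaf \<and> nodes t' = insert w (nodes t)"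
proof (induction t arbitrary: w)
  case Leaf
  then show ?case by (intro exI[of _ "Node Leaf Leaf Leaf"]) simp
next
  case (Node a b c)
  then obtain x v where w: "w = x # v" "v \<in> leaves (case x of Lt \<Rightarrow> a | Md \<Rightarrow> b | Rt \<Rightarrow> c)"
    by auto
  then obtain s where s: "nodes s = insert v (nodes (case x of Lt \<Rightarrow> a | Md \<Rightarrow> b | Rt \<Rightarrow> c))"
    using Node.IH by (cases x) fastforce+
  show ?case
    by (rule exI[of _ "case x of Lt \<Rightarrow> Node s b c | Md \<Rightarrow> Node a s c | Rt \<Rightarrow> Node a b s"])
      (use w s in \<open>cases x; auto\<close>)
qed

text \<open>A deepest inner node has three leaves as children, so it can be turned back into a leaf. This is
the last subdivision step undone, and it reaches every forest by induction.\<close>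
lemma prune_node:
  "w \<in> nodes t \<Longrightarrow> (\<And>x. w @ [x] \<notin> nodes t) \<Longrightarrow> \<exists>t'. nodes t' = nodes t - {w} \<and> w \<in> leaves t'"
proof (induction t arbitrary: w)
  case Leaf
  then show ?case by simp
next
  case (Node a b c)
  show ?case
  proof (cases w)
    case Nil
    have "s = Leaf" if "[] \<notin> nodes s" for s using that by (cases s) auto
    moreover have "[] \<notin> nodes a" "[] \<notin> nodes b" "[] \<notin> nodes c"
      using Node.prems(2)[of Lt] Node.prems(2)[of Md] Node.prems(2)[of Rt] Nil by auto
    ultimately have "a = Leaf" "b = Leaf" "c = Leaf" by blast+
    then show ?thesis using Nil by (intro exI[of _ Leaf]) simp
  next
    case (Cons x v)
    let ?s = "case x of Lt \<Rightarrow> a | Md \<Rightarrow> b | Rt \<Rightarrow> c"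
    have v: "v \<in> nodes ?s" "\<And>y. v @ [y] \<notin> nodes ?s"
      using Node.prems Cons by (cases x; auto)+
    have "\<exists>s. nodes s = nodes ?s - {v} \<and> v \<in> leaves s"
      by (cases x; simp only: letter.case; rule Node.IH) (use v in simp_all)
    then obtain s where s: "nodes s = nodes ?s - {v}" "v \<in> leaves s" by blast
    show ?thesis
      by (rule exI[of _ "case x of Lt \<Rightarrow> Node s b c | Md \<Rightarrow> Node a s c | Rt \<Rightarrow> Node a b s"])
        (use Cons s in \<open>cases x; auto\<close>)
  qed
qed

text \<open>An arc diagram is recorded by the subdivision trees of the two root intervals. The leaves are the
circle intervals of the diagram and the inner nodes are its arcs, except for \<open>root_arc\<close>, which belongs to
every diagram.\<close>
type_synonym forest = "bool \<Rightarrow> tree"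

definition forest_leaves :: "forest \<Rightarrow> addr set" where
  "forest_leaves F = {J. snd J \<in> leaves (F (fst J))}"

definition forest_nodes :: "forest \<Rightarrow> addr set" where
  "forest_nodes F = {J. snd J \<in> nodes (F (fst J))}"

definition diagram :: "forest \<Rightarrow> arc set" where
  "diagram F = insert root_arc (arc_at ` forest_nodes F)"

lemma forest_leaves_Sigma: "forest_leaves F = (SIGMA r:UNIV. leaves (F r))"
  by (auto simp: forest_leaves_def)

lemma forest_nodes_Sigma: "forest_nodes F = (SIGMA r:UNIV. nodes (F r))"
  by (auto simp: forest_nodes_def)

lemma mem_forest_nodes_upd:
  "K \<in> forest_nodes (F(r := t)) \<longleftrightarrow> (if fst K = r then snd K \<in> nodes t else K \<in> forest_nodes F)"
  by (simp add: forest_nodes_def)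

lemma finite_forest: "finite (forest_leaves F)" "finite (forest_nodes F)"
  by (simp_all add: forest_leaves_Sigma forest_nodes_Sigma finite_leaves finite_nodes)

lemma forest_leaf_comparable:
  assumes "J \<in> forest_leaves F" "K \<in> forest_leaves F" "comparable J K" shows "J = K"
  using assms leaf_prefix_unique[of "snd J" "F (fst J)" "snd K"] leaf_prefix_unique[of "snd K" "F (fst J)" "snd J"]
  unfolding comparable_def forest_leaves_def by (cases J; cases K) (auto simp: prefix_def)

lemma forest_cover: obtains J t where "J \<in> forest_leaves F" "0 \<le> t" "t < 1" "y = gam J t"
proof -
  obtain r s where s: "y = gam (r, []) s" "0 \<le> s" "s < 1" by (rule circle_cover)
  obtain w t where "w \<in> leaves (F r)" "0 \<le> t" "t < 1" "s = off w + sc w * t"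
    using leaf_cover[OF s(2,3)] by blast
  then show thesis using that[of "(r, w)" t] s gam_root[of r w t] by (simp add: forest_leaves_def)
qed

lemma arcs_as_inner:
  "\<Union> (arc_at ` forest_nodes F) = (\<Union>r. gam (r, []) ` inner (F r))"
proof -
  have a: "arc_at (r, w) = gam (r, []) ` {off w + sc w * (1/4), off w + sc w * (3/4)}" for r w
    by (simp add: arc_at_def gam_root[of r w])
  have "\<Union> (arc_at ` forest_nodes F) = (\<Union>r. \<Union>w\<in>nodes (F r). arc_at (r, w))"
    by (auto simp: forest_nodes_Sigma)
  also have "\<dots> = (\<Union>r. \<Union>w\<in>nodes (F r). gam (r, []) ` {off w + sc w * (1/4), off w + sc w * (3/4)})"
    unfolding a ..
  also have "\<dots> = (\<Union>r. gam (r, []) ` inner (F r))"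
    by (simp add: inner_def image_UN)
  finally show ?thesis .
qed

lemma vertices_diagram_inner:
  "vertices (diagram F) = (\<Union>r. insert (gam (r, []) 0) (gam (r, []) ` inner (F r)))"
proof -
  have "root_arc = (\<Union>r. {gam (r, []) 0})"
    using root_rgt[of True] by (auto simp: root_arc_def UNIV_bool)
  then show ?thesis
    unfolding vertices_def diagram_def using arcs_as_inner[of F] by (simp add: UNIV_bool) blast
qed

lemma vertices_diagram: "vertices (diagram F) = lft ` forest_leaves F"
proof -
  have "lft ` forest_leaves F = (\<Union>r. (\<lambda>w. lft (r, w)) ` leaves (F r))"
    by (auto simp: forest_leaves_Sigma)
  also have "\<dots> = (\<Union>r. (\<lambda>w. gam (r, []) (off w)) ` leaves (F r))"
    using gam_root[of _ _ 0] by (simp only: mult_zero_right add_0_right)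
  also have "\<dots> = (\<Union>r. gam (r, []) ` off ` leaves (F r))" by (simp only: image_image)
  finally show ?thesis by (simp add: leaf_starts vertices_diagram_inner)
qed

lemma vertices_diagram_rgt: "vertices (diagram F) = rgt ` forest_leaves F"
proof -
  have "rgt ` forest_leaves F = (\<Union>r. (\<lambda>w. rgt (r, w)) ` leaves (F r))"
    by (auto simp: forest_leaves_Sigma)
  also have "\<dots> = (\<Union>r. (\<lambda>w. gam (r, []) (off w + sc w)) ` leaves (F r))"
    using gam_root[of _ _ 1] by (simp only: mult_1_right)
  also have "\<dots> = (\<Union>r. gam (r, []) ` (\<lambda>w. off w + sc w) ` leaves (F r))" by (simp only: image_image)
  also have "\<dots> = (\<Union>r. insert (gam (r, []) 1) (gam (r, []) ` inner (F r)))"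
    by (simp add: leaf_stops)
  also have "\<dots> = vertices (diagram F)"
    unfolding vertices_diagram_inner using root_rgt[of True] root_rgt[of False]
    by (simp add: UNIV_bool) blast
  finally show ?thesis by simp
qed

lemma shift_len: "shift a (len a b) = b"
proof -
  obtain x y where "a = pt x" "b = pt y" by (metis pt_cases)
  then show ?thesis by (simp add: len_pt pt_eq_iff frac_def)
qed

lemma len_nonneg: "0 \<le> len a b"
  by transfer simp

lemma mem_ivl: "len a c \<le> len a b \<Longrightarrow> c \<in> ivl a b"
  unfolding ivl_def using shift_len[of a c] len_nonneg[of a c]
  by (intro CollectI exI[of _ "len a c"]) auto

lemma len_address: "len (lft J) (rgt J) = root_len (fst J) * sc (snd J)"
proof -
  have "root_len (fst J) * sc (snd J) < 1 * 1"
    by (rule mult_less_le_imp_less) (use sc_le_1[of "snd J"] in \<open>cases "fst J"; auto\<close>)+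
  moreover have "0 \<le> root_len (fst J) * sc (snd J)"
    by (cases "fst J") (simp_all add: less_imp_le)
  ultimately show ?thesis by (simp add: gam_def len_pt frac_eq algebra_simps)
qed

lemma shift_address: "shift (lft J) (t * len (lft J) (rgt J)) = gam J t"
  unfolding len_address by (simp add: gam_def algebra_simps)

lemma ivl_address: "ivl (lft J) (rgt J) = closed_part J"
proof
  let ?l = "len (lft J) (rgt J)"
  have l: "0 < ?l" unfolding len_address by (cases "fst J") auto
  show "ivl (lft J) (rgt J) \<subseteq> closed_part J"
  proof
    fix y assume "y \<in> ivl (lft J) (rgt J)"
    then obtain s where s: "y = shift (lft J) s" "0 \<le> s" "s \<le> ?l" unfolding ivl_def by blast
    then have "y = gam J (s / ?l)" using shift_address[of J "s / ?l"] l by simp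
    then show "y \<in> closed_part J" using s l by (auto intro!: gam_mem)
  qed
  show "closed_part J \<subseteq> ivl (lft J) (rgt J)"
  proof
    fix y assume "y \<in> closed_part J"
    then obtain t where t: "y = gam J t" "0 \<le> t" "t \<le> 1" unfolding closed_part_def by auto
    have "t * ?l \<le> 1 * ?l" using t l by (intro mult_right_mono) auto
    then show "y \<in> ivl (lft J) (rgt J)"
      unfolding ivl_def using t l shift_address[of J t]
      by (intro CollectI exI[of _ "t * ?l"]) auto
  qed
qed

lemma primary_arc_address: "primary_arc (lft J) (rgt J) = arc_at J"
  unfolding primary_arc_def len_address arc_at_def by (simp add: gam_def algebra_simps)

text \<open>Every vertex is the left end of a leaf, and half-open leaves are disjoint, so an interval between
consecutive vertices cannot be anything but a leaf.\<close>
lemma intervals_diagram: "intervals (diagram F) = (\<lambda>J. (lft J, rgt J)) ` forest_leaves F"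
proof -
  let ?V = "vertices (diagram F)"
  have mem: "closed_part J \<inter> ?V = {lft J, rgt J}" if J: "J \<in> forest_leaves F" for J
  proof
    show "closed_part J \<inter> ?V \<subseteq> {lft J, rgt J}"
    proof
      fix y assume y: "y \<in> closed_part J \<inter> ?V"
      then obtain K t where K: "K \<in> forest_leaves F" "y = lft K" "y = gam J t" "0 \<le> t" "t \<le> 1"
        unfolding vertices_diagram closed_part_def by auto
      show "y \<in> {lft J, rgt J}"
      proof (cases "t = 1")
        case False
        then have "y \<in> half_part J" "y \<in> half_part K"
          using K gam_mem(2)[of t J] gam_mem(2)[of 0 K] by auto
        then have "comparable J K" using half_part_disjoint by blast
        then show ?thesis using forest_leaf_comparable J K by blast
      qed (use K in simp)
    qed
    show "{lft J, rgt J} \<subseteq> closed_part J \<inter> ?V"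
      using J vertices_diagram[of F] vertices_diagram_rgt[of F] gam_mem(1)[of 0 J] gam_mem(1)[of 1 J] by auto
  qed
  show ?thesis
  proof
    show "(\<lambda>J. (lft J, rgt J)) ` forest_leaves F \<subseteq> intervals (diagram F)"
      using mem lft_ne_rgt by (auto simp: intervals_def ivl_address) blast+
    show "intervals (diagram F) \<subseteq> (\<lambda>J. (lft J, rgt J)) ` forest_leaves F"
    proof
      fix x assume "x \<in> intervals (diagram F)"
      then obtain a b where x: "x = (a, b)" "a \<in> ?V" "b \<in> ?V" "a \<noteq> b" "ivl a b \<inter> ?V = {a, b}"
        unfolding intervals_def by blast
      then obtain J where J: "J \<in> forest_leaves F" "a = lft J" unfolding vertices_diagram by blast
      have "b = rgt J"
      proof (cases "len a (rgt J) \<le> len a b")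
        case True
        then have "rgt J \<in> ivl a b" by (rule mem_ivl)
        moreover have "rgt J \<in> ?V" using mem[OF J(1)] by blast
        ultimately have "rgt J \<in> {a, b}" using x(5) by blast
        then show ?thesis using J(2) lft_ne_rgt[of J] by auto
      next
        case False
        then have "b \<in> ivl a (rgt J)" by (intro mem_ivl) simp
        then have "b \<in> closed_part J \<inter> ?V" using x(3) J(2) by (simp add: ivl_address)
        then show ?thesis using mem[OF J(1)] x(4) J(2) by auto
      qed
      then show "x \<in> (\<lambda>J. (lft J, rgt J)) ` forest_leaves F" using x J by blast
    qed
  qed
qed

lemma forest_root_node: "(r, []) \<in> forest_nodes F \<longleftrightarrow> F r \<noteq> Leaf"
  by (cases "F r") (auto simp: forest_nodes_def)

lemma base_diagram:
  assumes "forest_nodes F = {(True, [])}"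
  shows "diagram F = {{pt (1/3), pt (2/3)}, {pt (1/6), pt (5/6)}}"
  unfolding diagram_def assms by (simp add: root_arc_def arc_at_def gam_def insert_commute)

text \<open>The initial diagram subdivides the root \<open>True\<close> once; adding a primary arc splits a leaf.\<close>
lemma arc_diagram_is_forest:
  "arc_diagram D \<Longrightarrow> \<exists>F. F True \<noteq> Leaf \<and> D = diagram F"
proof (induction rule: arc_diagram.induct)
  case base
  let ?F = "\<lambda>r. if r then Node Leaf Leaf Leaf else Leaf"
  have "forest_nodes ?F = {(True, [])}" by (auto simp: forest_nodes_def split: if_splits)
  then show ?case using base_diagram[of ?F] by (intro exI[of _ ?F]) simp
next
  case (add_arc D a b)
  then obtain F J where F: "F True \<noteq> Leaf" "D = diagram F" "J \<in> forest_leaves F" "a = lft J" "b = rgt J"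
    using intervals_diagram by blast
  obtain t where t: "t \<noteq> Leaf" "nodes t = insert (snd J) (nodes (F (fst J)))"
    using split_leaf F(3) unfolding forest_leaves_def by blast
  let ?F = "F(fst J := t)"
  have "forest_nodes ?F = insert J (forest_nodes F)"
    by (rule Set.set_eqI) (simp add: mem_forest_nodes_upd t(2), auto simp: forest_nodes_def prod_eq_iff)
  then have "diagram ?F = insert (primary_arc a b) D"
    by (simp add: F diagram_def primary_arc_address insert_commute)
  moreover have "?F True \<noteq> Leaf" using t(1) F(1) by simp
  ultimately show ?case by metis
qed

lemma forest_is_arc_diagram: "F True \<noteq> Leaf \<Longrightarrow> arc_diagram (diagram F)"
proof (induction "card (forest_nodes F)" arbitrary: F rule: less_induct)
  case less
  let ?S = "forest_nodes F - {(True, [])}"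
  show ?case
  proof (cases "?S = {}")
    case True
    then have "forest_nodes F = {(True, [])}" using forest_root_node[of True F] less.prems by blast
    then show ?thesis using base_diagram arc_diagram.base by simp
  next
    case False
    have "finite ?S" using finite_forest by simp
    then have "finite (depth ` ?S)" by (rule finite_imageI)
    then have "Max (depth ` ?S) \<in> depth ` ?S" "\<forall>K\<in>?S. depth K \<le> Max (depth ` ?S)"
      using False by (auto intro!: Max_in simp del: Max_less_iff) 
    then obtain J where J: "J \<in> ?S" "\<And>K. K \<in> ?S \<Longrightarrow> depth K \<le> depth J" by force
    have "snd J @ [x] \<notin> nodes (F (fst J))" for x
      using J(2)[of "J \<odot> [x]"] by (auto simp: forest_nodes_def ext_def)
    then obtain t where t: "nodes t = nodes (F (fst J)) - {snd J}" "snd J \<in> leaves t"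
      using prune_node[of "snd J" "F (fst J)"] J(1) by (auto simp: forest_nodes_def)
    let ?F = "F(fst J := t)"
    have nodes: "forest_nodes ?F = forest_nodes F - {J}"
      by (rule Set.set_eqI) (simp add: mem_forest_nodes_upd t(1), auto simp: forest_nodes_def prod_eq_iff)
    have leaf: "J \<in> forest_leaves ?F" using t(2) by (simp add: forest_leaves_def)
    have "(True, []) \<in> forest_nodes ?F"
      unfolding nodes using J(1) less.prems by (auto simp: forest_root_node)
    then have "?F True \<noteq> Leaf" by (simp only: forest_root_node not_False_eq_True)
    moreover have "card (forest_nodes ?F) < card (forest_nodes F)"
      unfolding nodes using J(1) finite_forest(2)[of F] by (intro card_Diff1_less) auto
    ultimately have "arc_diagram (diagram ?F)" using less.hyps by blast
    moreover have "(lft J, rgt J) \<in> intervals (diagram ?F)"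
      using leaf intervals_diagram by blast
    ultimately have "arc_diagram (insert (primary_arc (lft J) (rgt J)) (diagram ?F))"
      by (rule arc_diagram.add_arc)
    moreover have "insert (primary_arc (lft J) (rgt J)) (diagram ?F) = diagram F"
      unfolding primary_arc_address diagram_def nodes using J(1) by auto
    ultimately show ?thesis by simp
  qed
qed

lemma below_forest_leaf:
  "J \<in> forest_nodes F \<or> (\<exists>I\<in>forest_leaves F. \<exists>v. J = I \<odot> v)"
proof (cases J)
  case (Pair r w)
  consider "w \<in> nodes (F r)" | u v where "u \<in> leaves (F r)" "w = u @ v"
    using node_or_below_leaf[of w "F r"] by (auto simp: prefix_def)
  then show ?thesis
  proof cases
    case 2
    then show ?thesis using Pair by (intro disjI2 bexI[of _ "(r, u)"] exI[of _ v]) (auto simp: forest_leaves_def)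
  qed (simp add: Pair forest_nodes_def)
qed

lemma lamination_split:
  "lamination = diagram F \<union> {arc_at (I \<odot> v) | I v. I \<in> forest_leaves F}"
proof
  show "lamination \<subseteq> diagram F \<union> {arc_at (I \<odot> v) | I v. I \<in> forest_leaves F}"
    using below_forest_leaf[of _ F] by (fastforce simp: lamination_def diagram_def)
qed (auto simp: lamination_def diagram_def)

text \<open>A diagram is determined by its set of vertices. So a bijection that permutes the
lamination carries arcs of a diagram to arcs of the other as soon as it carries vertices to vertices.\<close>
lemma diagram_from_vertices: "diagram F = {c \<in> lamination. c \<subseteq> vertices (diagram F)}"
proof
  show "diagram F \<subseteq> {c \<in> lamination. c \<subseteq> vertices (diagram F)}"
    by (auto simp: lamination_split[of F] vertices_def)
  show "{c \<in> lamination. c \<subseteq> vertices (diagram F)} \<subseteq> diagram F"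
  proof (rule ccontr)
    assume "\<not> ?thesis"
    then obtain I v where I: "I \<in> forest_leaves F" "arc_at (I \<odot> v) \<subseteq> vertices (diagram F)"
      unfolding lamination_split[of F] by blast
    obtain K where K: "K \<in> forest_leaves F" "gam (I \<odot> v) (1/4) = lft K"
      using I(2) by (auto simp: arc_at_def vertices_diagram)
    have o: "lft K \<in> open_part I"
      using gam_mem(3)[of "1/4" "I \<odot> v"] open_part_ext[of I v] K by auto
    then have "lft K \<in> half_part I" "lft K \<in> half_part K"
      using parts_incl(1)[of I] gam_mem(2)[of 0 K] by (blast, simp)
    then have "I = K" using half_part_disjoint[of I K] forest_leaf_comparable I K by blast
    then show False using o ends_not_open by blast
  qed
qed


section \<open>A symbolic description of the group\<close>

text \<open>The symbolic description of the rearrangements. Continuity and orientation are not mentioned: they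
follow, because \<open>lin\<close> speaks of closed intervals with their direction.\<close>
definition rearr :: "(circle \<Rightarrow> circle) set" where
  "rearr = {f. bij f \<and> (`) f ` lamination = lamination \<and> (\<exists>n. \<forall>J. n \<le> depth J \<longrightarrow> (\<exists>K. lin f J K))}"

lemma rearrI:
  "bij f \<Longrightarrow> (`) f ` lamination = lamination \<Longrightarrow> (\<And>J. n \<le> depth J \<Longrightarrow> \<exists>K. lin f J K) \<Longrightarrow> f \<in> rearr"
  unfolding rearr_def by blast

lemma rearr_bij: "f \<in> rearr \<Longrightarrow> bij f" by (simp add: rearr_def)

lemma rearr_arc: "f \<in> rearr \<Longrightarrow> f ` arc_at J \<in> lamination"
  using arc_in_lamination(1)[of J] unfolding rearr_def by blast

lemma rearr_id: "id \<in> rearr"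
  by (rule rearrI[where n = 0]) (auto intro: lin_id exI[where P = "lin id _"])

lemma split_address: assumes "n \<le> depth J" obtains I v where "J = I \<odot> v" "depth I = n"
  using assms that[of "(fst J, take n (snd J))" "drop n (snd J)"] by (cases J) auto

lemma rearr_comp: assumes "f \<in> rearr" "g \<in> rearr" shows "g \<circ> f \<in> rearr"
proof -
  obtain n where f: "bij f" "(`) f ` lamination = lamination" "\<And>J. n \<le> depth J \<Longrightarrow> \<exists>K. lin f J K"
    using assms(1) unfolding rearr_def by blast
  obtain m where g: "bij g" "(`) g ` lamination = lamination" "\<And>J. m \<le> depth J \<Longrightarrow> \<exists>K. lin g J K"
    using assms(2) unfolding rearr_def by blast
  show ?thesis
  proof (rule rearrI[where n = "n + m"])
    show "bij (g \<circ> f)" using f(1) g(1) by (rule bij_comp)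
    have "(`) (g \<circ> f) ` lamination = (`) g ` (`) f ` lamination" by (simp add: image_image image_comp)
    then show "(`) (g \<circ> f) ` lamination = lamination" by (simp only: f(2) g(2))
  next
    fix J :: addr assume J: "n + m \<le> depth J"
    then have "n \<le> depth J" by simp
    then obtain I v where I: "J = I \<odot> v" "depth I = n" by (rule split_address)
    obtain K where "lin f I K" using f(3)[of I] I(2) by auto
    then have fK: "lin f J (K \<odot> v)" unfolding I(1) by (rule lin_ext)
    moreover obtain L where "lin g (K \<odot> v) L" using g(3)[of "K \<odot> v"] J I by auto
    ultimately show "\<exists>K. lin (g \<circ> f) J K" using lin_comp by blast
  qed
qed

fun full :: "nat \<Rightarrow> tree" where
  "full 0 = Leaf" | "full (Suc n) = Node (full n) (full n) (full n)"

lemma leaves_full: "leaves (full n) = {w. length w = n}"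
proof (induction n)
  case (Suc n)
  have "w \<in> leaves (full (Suc n)) \<longleftrightarrow> length w = Suc n" for w
  proof (cases w)
    case (Cons c v) then show ?thesis using Suc by (cases c) auto
  qed auto
  then show ?case by blast
qed auto

declare full.simps [simp del]

lemma forest_leaves_full: "forest_leaves (\<lambda>_. full n) = {J. depth J = n}"
  by (auto simp: forest_leaves_def leaves_full)

lemma finite_depth: "finite {J :: addr. depth J = n}"
  using finite_forest(1)[of "\<lambda>_. full n"] by (simp add: forest_leaves_full)

lemma depth_cover: obtains J t where "depth J = n" "0 \<le> t" "t < 1" "y = gam J t"
  using forest_cover[of "\<lambda>_. full n" y] by (auto simp: forest_leaves_full)

text \<open>The finitely many images of the intervals of depth \<open>N\<close> cover the circle, so an address that is
deeper than all of them lies below one of them. This is what makes the inverse of \<open>f\<close> affine on small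
intervals, and what turns the images into the leaves of a forest.\<close>
lemma deep_addresses_covered:
  assumes "bij f" "\<And>J. n \<le> depth J \<Longrightarrow> \<exists>K. lin f J K" "n \<le> N"
  obtains M where "\<And>L. M \<le> depth L \<Longrightarrow> \<exists>J K v. depth J = N \<and> lin f J K \<and> L = K \<odot> v"
proof -
  have "\<forall>J. depth J = N \<longrightarrow> (\<exists>K. lin f J K)" using assms by auto
  then obtain k where k: "\<And>J. depth J = N \<Longrightarrow> lin f J (k J)" by metis
  define M where "M = Max (insert 0 ((\<lambda>J. depth (k J)) ` {J. depth J = N}))"
  have M: "depth (k J) \<le> M" if "depth J = N" for J
    unfolding M_def by (rule Max_ge) (use that finite_depth[of N] in auto)
  show thesis
  proof (rule that)
    fix L :: addr assume L: "M \<le> depth L"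
    obtain J t where J: "depth J = N" "0 \<le> t" "t < 1" "inverse_map f (gam L (1/2)) = gam J t"
      by (rule depth_cover)
    have "gam L (1/2) = f (gam J t)" using assms(1) J(4) by (metis bij_inv_eq_iff)
    also have "\<dots> = gam (k J) t" using linD[OF k[OF J(1)]] J by simp
    finally have "comparable (k J) L"
      using half_part_disjoint[of "k J" L] gam_mem(2)[of "1/2" L] gam_mem(2)[of t "k J"] J by auto
    then have "\<exists>v. L = k J \<odot> v"
      unfolding comparable_def
    proof
      assume "\<exists>v. k J = L \<odot> v"
      then obtain v where v: "k J = L \<odot> v" by blast
      then have "depth (k J) = depth L + length v" by simp
      then have "length v = 0" using M[OF J(1)] L by linarith
      then show ?thesis using v by (intro exI[of _ "[]"]) simp
    qed
    then show "\<exists>J K v. depth J = N \<and> lin f J K \<and> L = K \<odot> v" using k[OF J(1)] J(1) by blast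
  qed
qed

lemma rearr_inv: assumes "f \<in> rearr" shows "inverse_map f \<in> rearr"
proof -
  obtain n where f: "bij f" "(`) f ` lamination = lamination" "\<And>J. n \<le> depth J \<Longrightarrow> \<exists>K. lin f J K"
    using assms(1) unfolding rearr_def by blast
  obtain M where M: "\<And>L. M \<le> depth L \<Longrightarrow> \<exists>J K v. depth J = n \<and> lin f J K \<and> L = K \<odot> v"
    using deep_addresses_covered[OF f(1,3) order_refl] by blast
  show ?thesis
  proof (rule rearrI[where n = M])
    show "bij (inverse_map f)" using f(1) by (rule bij_imp_bij_inv)
    have "(`) (inverse_map f) ` (`) f ` lamination = lamination"
      using f(1) by (simp add: image_image bij_is_inj)
    then show "(`) (inverse_map f) ` lamination = lamination" by (simp only: f(2))
  next
    fix L :: addr assume "M \<le> depth L"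
    then obtain J K v where "lin f J K" "L = K \<odot> v" using M by blast
    then have "lin f (J \<odot> v) L" using lin_ext by blast
    then show "\<exists>K. lin (inverse_map f) L K" using lin_inv[OF f(1)] by blast
  qed
qed

section \<open>Orientation\<close>

lemma ivl_pt:
  assumes "0 \<le> a" "a < 1" shows "ivl (pt x) (pt (x + a)) = (\<lambda>t. pt (x + t)) ` {0..a}"
  using assms by (auto simp: ivl_def len_pt frac_eq)

lemma pt_offset: obtains a where "0 \<le> a" "a < 1" "q = pt (x + a)"
proof -
  obtain y where "q = pt y" by (rule pt_cases)
  moreover have "y - (x + frac (y - x)) = of_int \<lfloor>y - x\<rfloor>" by (simp add: frac_def)
  then have "pt y = pt (x + frac (y - x))" unfolding pt_eq_iff by (metis Ints_of_int)
  ultimately show thesis using that[of "frac (y - x)"] frac_lt_1[of "y - x"] frac_ge_0[of "y - x"] by blast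
qed

lemma pt_neq_offset: "0 < a \<Longrightarrow> a < 1 \<Longrightarrow> pt (x + a) \<noteq> pt x"
  using Ints_small_zero[of a] by (auto simp: pt_eq_iff)

lemma ivl_split:
  assumes "n \<in> ivl p q" "n \<noteq> p"
  shows "ivl p q = ivl p n \<union> ivl n q" "p \<notin> ivl n q"
proof -
  obtain x where p: "p = pt x" by (rule pt_cases)
  obtain a where a: "0 \<le> a" "a < 1" "q = pt (x + a)" by (rule pt_offset)
  obtain b where b: "n = pt (x + b)" "0 \<le> b" "b \<le> a" using assms(1) a by (auto simp: p ivl_pt)
  have "b \<noteq> 0" using assms(2) b p by auto
  have pn: "ivl p n = (\<lambda>t. pt (x + t)) ` {0..b}" unfolding p b(1) using a b by (intro ivl_pt) auto
  have "ivl n q = (\<lambda>t. pt (x + b + t)) ` {0..a - b}"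
    using ivl_pt[of "a - b" "x + b"] a b by simp
  also have "\<dots> = (\<lambda>t. pt (x + t)) ` (\<lambda>t. t + b) ` {0..a - b}"
    unfolding image_image by (intro image_cong refl) (simp add: algebra_simps)
  also have "(\<lambda>t. t + b) ` {0..a - b} = {b..a}" by simp
  finally have nq: "ivl n q = (\<lambda>t. pt (x + t)) ` {b..a}" .
  have "{0..a} = {0..b} \<union> {b..a}" using b by auto
  then show "ivl p q = ivl p n \<union> ivl n q" unfolding pn nq using ivl_pt[OF a(1,2), of x] p a(3) by (simp add: image_Un)
  show "p \<notin> ivl n q"
    unfolding nq p using pt_neq_offset[of _ x] a b \<open>b \<noteq> 0\<close> by (auto dest: sym)
qed

lemma ivl_join:
  assumes "p \<notin> ivl n q"
  shows "ivl p n \<union> ivl n q = ivl p q"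
proof -
  obtain x where n: "n = pt x" by (rule pt_cases)
  obtain a where a: "0 \<le> a" "a < 1" "q = pt (x + a)" by (rule pt_offset)
  obtain c where c: "0 \<le> c" "c < 1" "p = pt (x + c)" by (rule pt_offset)
  have "a < c" using assms a c by (auto simp: n ivl_pt not_less)
  have e: "n = pt (x + c + (1 - c))" "q = pt (x + c + (1 - c + a))"
    by (simp_all add: n a(3) pt_eq_iff)
  have pn: "ivl p n = (\<lambda>t. pt (x + c + t)) ` {0..1 - c}"
    unfolding c(3) e(1) using \<open>a < c\<close> a c by (intro ivl_pt) auto
  have pq: "ivl p q = (\<lambda>t. pt (x + c + t)) ` {0..1 - c + a}"
    unfolding c(3) e(2) using \<open>a < c\<close> a c by (intro ivl_pt) auto
  have "ivl n q = (\<lambda>t. pt (x + t)) ` {0..a}" unfolding n a(3) using a by (intro ivl_pt) auto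
  also have "\<dots> = (\<lambda>t. pt (x + c + t)) ` (\<lambda>t. t + (1 - c)) ` {0..a}"
    unfolding image_image by (intro image_cong refl) (simp add: pt_eq_iff)
  also have "(\<lambda>t. t + (1 - c)) ` {0..a} = {1 - c..1 - c + a}"
    using image_add_atLeastAtMost'[of "1 - c" 0 a] by (simp only: add_0 add.commute)
  finally have nq: "ivl n q = (\<lambda>t. pt (x + c + t)) ` {1 - c..1 - c + a}" .
  have "{0..1 - c + a} = {0..1 - c} \<union> {1 - c..1 - c + a}" using a c by auto
  then show ?thesis unfolding pn nq pq by (simp add: image_Un)
qed

lemma len_le_ivl: assumes "n \<in> ivl p q" shows "len p n \<le> len p q"
proof -
  obtain x where p: "p = pt x" by (rule pt_cases)
  obtain a where a: "0 \<le> a" "a < 1" "q = pt (x + a)" by (rule pt_offset)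
  obtain b where b: "n = pt (x + b)" "0 \<le> b" "b \<le> a" using assms(1) a by (auto simp: p ivl_pt)
  then show ?thesis using a by (simp add: p len_pt frac_eq)
qed

lemma ends_mem_ivl: "p \<in> ivl p q" "q \<in> ivl p q"
proof -
  have "len p p = 0" by transfer simp
  then show "p \<in> ivl p q" "q \<in> ivl p q" using len_nonneg[of p q] by (simp_all add: mem_ivl)
qed

text \<open>The interval from \<open>p\<close> to \<open>q\<close> is a chain of intervals between consecutive vertices; the images of the
members of the chain are joined end to end, and they cannot run around the circle more than once because \<open>f\<close>
is injective.\<close>
lemma image_ivl:
  assumes "finite V" "inj f"
    and adjacent: "\<And>a b. a \<in> V \<Longrightarrow> b \<in> V \<Longrightarrow> a \<noteq> b \<Longrightarrow> ivl a b \<inter> V = {a, b} \<Longrightarrow> f ` ivl a b = ivl (f a) (f b)"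
    and "p \<in> V" "q \<in> V" "p \<noteq> q"
  shows "f ` ivl p q = ivl (f p) (f q)"
  using assms(4-6)
proof (induction "card (ivl p q \<inter> V)" arbitrary: p rule: less_induct)
  case less
  \<comment> \<open>The next vertex after \<open>p\<close> in positive direction splits off the first member of the chain.\<close>
  let ?S = "ivl p q \<inter> V - {p}"
  have "finite ?S" "q \<in> ?S" using assms(1) less.prems ends_mem_ivl by auto
  then obtain n where n: "n \<in> ?S" "\<forall>x\<in>?S. len p n \<le> len p x"
    using ex_min_if_finite[of "len p ` ?S"] by (fastforce simp: not_less)
  note split = ivl_split[of n p q]
  have "ivl p n \<inter> V = {p, n}"
  proof
    show "ivl p n \<inter> V \<subseteq> {p, n}"
    proof
      fix x assume x: "x \<in> ivl p n \<inter> V"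
      show "x \<in> {p, n}"
      proof (cases "x = p")
        case False
        then have "x \<in> ?S" using x split n(1) by auto
        then have "len p n \<le> len p x" using n(2) by blast
        moreover have "len p x \<le> len p n" using x by (intro len_le_ivl) blast
        ultimately have "len p x = len p n" by simp
        then have "x = n" using shift_len[of p x] shift_len[of p n] by metis
        then show ?thesis by blast
      qed simp
    qed
    show "{p, n} \<subseteq> ivl p n \<inter> V"
      using less.prems(1) n(1) ends_mem_ivl by blast
  qed
  then have pn: "f ` ivl p n = ivl (f p) (f n)" using adjacent[of p n] less.prems n(1) by auto
  show ?case
  proof (cases "n = q")
    case False
    have sub: "ivl n q \<inter> V \<subset> ivl p q \<inter> V"
    proof -
      have "p \<in> ivl p q \<inter> V"
        using \<open>ivl p n \<inter> V = {p, n}\<close> split n(1) by blast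
      then show ?thesis using split n(1) by blast
    qed
    then have "card (ivl n q \<inter> V) < card (ivl p q \<inter> V)" using assms(1) by (intro psubset_card_mono) auto
    then have nq: "f ` ivl n q = ivl (f n) (f q)" using less.hyps[of n] n(1) less.prems False by blast
    have "f p \<notin> ivl (f n) (f q)"
      unfolding nq[symmetric] using split(2) n(1) assms(2) by (auto simp: inj_image_mem_iff)
    then have "ivl (f p) (f n) \<union> ivl (f n) (f q) = ivl (f p) (f q)" by (rule ivl_join)
    then show ?thesis using split(1) n(1) pn nq by (auto simp: image_Un)
  qed (use pn in simp)
qed

lemma image_ivl_vertices:
  assumes "inj f" "\<And>J. J \<in> forest_leaves F \<Longrightarrow> \<exists>K. lin f J K"
    and "p \<in> vertices (diagram F)" "q \<in> vertices (diagram F)" "p \<noteq> q"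
  shows "f ` ivl p q = ivl (f p) (f q)"
proof (rule image_ivl[OF _ assms(1) _ assms(3-5)])
  show "finite (vertices (diagram F))" by (simp add: vertices_diagram finite_forest)
  fix a b assume "a \<in> vertices (diagram F)" "b \<in> vertices (diagram F)" "a \<noteq> b"
    "ivl a b \<inter> vertices (diagram F) = {a, b}"
  then have "(a, b) \<in> intervals (diagram F)" by (simp add: intervals_def)
  then obtain J where J: "J \<in> forest_leaves F" "a = lft J" "b = rgt J" unfolding intervals_diagram by blast
  then obtain K where K: "lin f J K" using assms(2) by blast
  then show "f ` ivl a b = ivl (f a) (f b)"
    unfolding J using linD[OF K, of 0] linD[OF K, of 1] lin_parts(1)[OF K] by (simp add: ivl_address)
qed

lemma off_replicate: "off (replicate k Lt) = 0" "off (replicate k Rt) + sc (replicate k Rt) = 1"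
  by (induction k) (auto simp: algebra_simps)

lemma ends_are_vertices:
  assumes "depth J \<le> n"
  shows "lft J \<in> vertices (diagram (\<lambda>_. full n))" "rgt J \<in> vertices (diagram (\<lambda>_. full n))"
proof -
  let ?L = "J \<odot> replicate (n - depth J) Lt" and ?R = "J \<odot> replicate (n - depth J) Rt"
  have "lft J = lft ?L" "rgt J = rgt ?R"
    by (simp_all add: gam_ext off_replicate)
  moreover have "depth ?L = n" "depth ?R = n" using assms by auto
  ultimately show "lft J \<in> vertices (diagram (\<lambda>_. full n))"
    unfolding vertices_diagram forest_leaves_full by blast
  show "rgt J \<in> vertices (diagram (\<lambda>_. full n))"
    unfolding vertices_diagram_rgt forest_leaves_full
    using \<open>rgt J = rgt ?R\<close> \<open>depth ?R = n\<close> by blast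
qed

lemma rearr_closed_part:
  assumes "f \<in> rearr" shows "f ` closed_part J = ivl (f (lft J)) (f (rgt J))"
proof -
  obtain n where f: "bij f" "\<And>J. n \<le> depth J \<Longrightarrow> \<exists>K. lin f J K"
    using assms(1) unfolding rearr_def by blast
  show ?thesis
    unfolding ivl_address[symmetric]
    by (rule image_ivl_vertices[of f "\<lambda>_. full (max n (depth J))"])
      (use f(2) ends_are_vertices[of J] lft_ne_rgt in \<open>auto simp: forest_leaves_full bij_is_inj[OF f(1)]\<close>)
qed

section \<open>Rearrangements and the symbolic description\<close>

text \<open>The leaves of the two forests correspond to each other under the isomorphism, and the half-open leaves tile
the circle, so \<open>f\<close> is bijective. The lamination consists of the arcs of a diagram and the
arcs under its leaves: \<open>f\<close> maps the former as the isomorphism does and the latter by self-similarity.\<close>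
lemma rearrangements_subset: "rearrangements \<subseteq> rearr"
proof
  fix f assume "f \<in> rearrangements"
  then obtain D R \<phi> where D: "arc_diagram D" "arc_diagram R" and iso: "diagram_iso \<phi> D R" and ind: "induced_map D \<phi> f"
    unfolding rearrangements_def by blast
  obtain F where F: "D = diagram F" using arc_diagram_is_forest[OF D(1)] by blast
  obtain H where H: "R = diagram H" using arc_diagram_is_forest[OF D(2)] by blast
  let ?I = "\<lambda>J. (lft J, rgt J)"
  have lr: "map_prod \<phi> \<phi> ` ?I ` forest_leaves F = ?I ` forest_leaves H"
    using iso by (simp only: diagram_iso_def F H intervals_diagram)
  have lin_if: "lin f J K" if "J \<in> forest_leaves F" "\<phi> (lft J) = lft K" "\<phi> (rgt J) = rgt K" for J K
  proof -
    have "f (shift (lft J) (t * len (lft J) (rgt J))) = shift (lft K) (t * len (lft K) (rgt K))"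
      if t: "t \<in> {0..1}" for t
    proof -
      have "(lft J, rgt J) \<in> intervals D" unfolding F intervals_diagram using \<open>J \<in> forest_leaves F\<close> by blast
      then show ?thesis using ind t \<open>\<phi> (lft J) = lft K\<close> \<open>\<phi> (rgt J) = rgt K\<close> unfolding induced_map_def by fastforce
    qed
    then show ?thesis unfolding lin_def shift_address by blast
  qed
  have lr2: "(\<lambda>J. (\<phi> (lft J), \<phi> (rgt J))) ` forest_leaves F = ?I ` forest_leaves H"
    using lr by (simp only: image_image map_prod_simp)
  have fwd: "\<exists>K\<in>forest_leaves H. \<phi> (lft J) = lft K \<and> lin f J K" if J: "J \<in> forest_leaves F" for J
  proof -
    have "(\<phi> (lft J), \<phi> (rgt J)) \<in> ?I ` forest_leaves H"
      using imageI[OF J, of "\<lambda>J. (\<phi> (lft J), \<phi> (rgt J))"] unfolding lr2 .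
    then obtain K where K: "(\<phi> (lft J), \<phi> (rgt J)) = ?I K" "K \<in> forest_leaves H" by (rule imageE)
    then have "\<phi> (lft J) = lft K" "\<phi> (rgt J) = rgt K" by simp_all
    then show ?thesis using lin_if[OF J] K(2) by blast
  qed
  have bwd: "\<exists>J\<in>forest_leaves F. \<phi> (lft J) = lft K \<and> lin f J K" if K: "K \<in> forest_leaves H" for K
  proof -
    have "?I K \<in> (\<lambda>J. (\<phi> (lft J), \<phi> (rgt J))) ` forest_leaves F"
      using imageI[OF K, of ?I] unfolding lr2 .
    then obtain J where J: "?I K = (\<phi> (lft J), \<phi> (rgt J))" "J \<in> forest_leaves F" by (rule imageE)
    then have "\<phi> (lft J) = lft K" "\<phi> (rgt J) = rgt K" by simp_all
    then show ?thesis using lin_if J(2) by blast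
  qed
  have inj\<phi>: "inj_on \<phi> (lft ` forest_leaves F)"
    using iso by (simp only: diagram_iso_def F vertices_diagram bij_betw_def)
  have lft_inj: "J = K" if "J \<in> forest_leaves F" "K \<in> forest_leaves F" "lft J = lft K" for J K and F :: forest
  proof -
    have "comparable J K" using half_part_disjoint[of J K] gam_mem(2)[of 0 J] gam_mem(2)[of 0 K] that(3) by auto
    then show ?thesis using forest_leaf_comparable that by blast
  qed
  have "inj f"
  proof (rule injI)
    fix x y assume xy: "f x = f y"
    obtain I s where I: "I \<in> forest_leaves F" "0 \<le> s" "s < 1" "x = gam I s" by (rule forest_cover)
    obtain J t where J: "J \<in> forest_leaves F" "0 \<le> t" "t < 1" "y = gam J t" by (rule forest_cover)
    obtain K where K: "K \<in> forest_leaves H" "\<phi> (lft I) = lft K" "lin f I K" using fwd I(1) by blast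
    obtain L where L: "L \<in> forest_leaves H" "\<phi> (lft J) = lft L" "lin f J L" using fwd J(1) by blast
    have e: "gam K s = gam L t" using xy linD[OF K(3), of s] linD[OF L(3), of t] I J by auto
    then have "comparable K L" using half_part_disjoint[of K L] gam_mem(2)[of s K] gam_mem(2)[of t L] I J by auto
    then have KL: "K = L" using forest_leaf_comparable K L by blast
    then have "s = t" using e gam_inj[of K s t] I J by auto
    moreover have "lft I = lft J" using K(2) L(2) KL inj_onD[OF inj\<phi>] I(1) J(1) by auto
    then have "I = J" using lft_inj I(1) J(1) by blast
    ultimately show "x = y" using I J by simp
  qed
  moreover have "surj f"
  proof -
    have "\<exists>x. y = f x" for y
    proof -
      obtain K t where K: "K \<in> forest_leaves H" "0 \<le> t" "t < 1" "y = gam K t" by (rule forest_cover)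
      obtain J where "lin f J K" using bwd K(1) by blast
      then have "f (gam J t) = y" using linD[of f J K t] K by simp
      then show ?thesis by blast
    qed
    then show ?thesis unfolding surj_def by blast
  qed
  ultimately have "bij f" by (rule bijI)
  show "f \<in> rearr"
  proof (rule rearrI)
    show "bij f" by fact
    have DR: "(`) f ` D = R"
    proof -
      have "f ` c = \<phi> ` c" if "c \<in> D" for c
      proof (rule image_cong)
        fix x assume "x \<in> c"
        then have "x \<in> vertices (diagram F)" using that F unfolding vertices_def by blast
        then obtain J where J: "J \<in> forest_leaves F" "x = lft J" unfolding vertices_diagram by blast
        then obtain K where "\<phi> (lft J) = lft K" "lin f J K" using fwd by blast
        then show "f x = \<phi> x" using linD[of f J K 0] J by simp
      qed simp
      then have "(`) f ` D = (`) \<phi> ` D" by simp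
      then show ?thesis using iso unfolding diagram_iso_def by simp
    qed
    have below: "(`) f ` {arc_at (I \<odot> v) | I v. I \<in> forest_leaves F} = {arc_at (I \<odot> v) | I v. I \<in> forest_leaves H}"
    proof (intro equalityI subsetI)
      fix c assume "c \<in> (`) f ` {arc_at (I \<odot> v) | I v. I \<in> forest_leaves F}"
      then obtain I v where I: "I \<in> forest_leaves F" "c = f ` arc_at (I \<odot> v)" by blast
      then obtain K where "K \<in> forest_leaves H" "lin f I K" using fwd by blast
      then show "c \<in> {arc_at (I \<odot> v) | I v. I \<in> forest_leaves H}"
        using I lin_arc[OF lin_ext] by blast
    next
      fix c assume "c \<in> {arc_at (I \<odot> v) | I v. I \<in> forest_leaves H}"
      then obtain K v where K: "K \<in> forest_leaves H" "c = arc_at (K \<odot> v)" by blast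
      then obtain J where J: "J \<in> forest_leaves F" "lin f J K" using bwd by blast
      then have "c = f ` arc_at (J \<odot> v)" using K lin_arc[OF lin_ext] by blast
      then show "c \<in> (`) f ` {arc_at (I \<odot> v) | I v. I \<in> forest_leaves F}" using J(1) by blast
    qed
    have "(`) f ` lamination = (`) f ` D \<union> (`) f ` {arc_at (I \<odot> v) | I v. I \<in> forest_leaves F}"
      by (simp only: lamination_split[of F] F image_Un)
    also have "\<dots> = lamination" by (simp only: DR below H lamination_split[of H])
    finally show "(`) f ` lamination = lamination" .
  next
    fix J :: addr
    assume J: "Suc (Max (insert 0 (depth ` forest_nodes F))) \<le> depth J"
    have "J \<notin> forest_nodes F"
    proof
      assume "J \<in> forest_nodes F"
      then have "depth J \<le> Max (insert 0 (depth ` forest_nodes F))" using finite_forest(2)[of F] by (intro Max_ge) auto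
      then show False using J by simp
    qed
    then obtain I v where "I \<in> forest_leaves F" "J = I \<odot> v" using below_forest_leaf[of J F] by blast
    then show "\<exists>K. lin f J K" using fwd lin_ext by blast
  qed
qed

text \<open>A set of words that meets every long branch exactly once is the leaf set of a tree.\<close>
lemma tree_with_leaves:
  assumes "\<And>u v. u \<in> S \<Longrightarrow> v \<in> S \<Longrightarrow> prefix u v \<Longrightarrow> u = v"
    and "\<And>w. M \<le> length w \<Longrightarrow> \<exists>u\<in>S. prefix u w"
  shows "\<exists>t. leaves t = S"
  using assms
proof (induction M arbitrary: S)
  case 0
  have "[] \<in> S" using 0(2)[of "[]"] by auto
  then have "S = {[]}" using 0(1)[of "[]"] by auto
  then show ?case by (intro exI[of _ Leaf]) simp
next
  case (Suc M)
  show ?case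
  proof (cases "[] \<in> S")
    case True
    then have "S = {[]}" using Suc.prems(1)[of "[]"] by auto
    then show ?thesis by (intro exI[of _ Leaf]) simp
  next
    case False
    have "\<exists>t. leaves t = {w. c # w \<in> S}" for c
    proof (rule Suc.IH)
      fix w :: "letter list" assume "M \<le> length w"
      then obtain u where u: "u \<in> S" "prefix u (c # w)" using Suc.prems(2)[of "c # w"] by auto
      then show "\<exists>u\<in>{w. c # w \<in> S}. prefix u w" using False by (cases u) auto
    qed (use Suc.prems(1) in fastforce)
    then obtain t where t: "\<And>c. leaves (t c) = {w. c # w \<in> S}" by metis
    have "w \<in> leaves (Node (t Lt) (t Md) (t Rt)) \<longleftrightarrow> w \<in> S" for w
    proof (cases w)
      case (Cons c v) then show ?thesis using t by (cases c) auto
    qed (use False in auto)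
    then show ?thesis by blast
  qed
qed

lemma forest_with_leaves:
  assumes "\<And>J K. J \<in> Q \<Longrightarrow> K \<in> Q \<Longrightarrow> comparable J K \<Longrightarrow> J = K"
    and "\<And>L. M \<le> depth L \<Longrightarrow> \<exists>K\<in>Q. \<exists>v. L = K \<odot> v"
  obtains F where "forest_leaves F = Q"
proof -
  have "\<exists>t. leaves t = {w. (r, w) \<in> Q}" for r
  proof (rule tree_with_leaves)
    fix u v assume "u \<in> {w. (r, w) \<in> Q}" "v \<in> {w. (r, w) \<in> Q}" "prefix u v"
    then show "u = v" using assms(1)[of "(r, u)" "(r, v)"] by (auto simp: comparable_def prefix_def)
  next
    fix w :: "letter list" assume "M \<le> length w"
    then obtain K v where K: "K \<in> Q" "(r, w) = K \<odot> v" using assms(2)[of "(r, w)"] by auto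
    then show "\<exists>u\<in>{w. (r, w) \<in> Q}. prefix u w" by (intro bexI[of _ "snd K"]) (auto simp: ext_def)
  qed
  then obtain F where "\<And>r. leaves (F r) = {w. (r, w) \<in> Q}" by metis
  then show thesis by (intro that[of F]) (auto simp: forest_leaves_def)
qed

text \<open>For the source take the full subdivision of a large depth. The images of its intervals are the leaves
of a forest, and \<open>f\<close> itself, restricted to vertices, is the isomorphism. It preserves faces
because it maps the circle interval cut off by an arc onto the one cut off by the image arc.\<close>
lemma rearr_subset: "rearr \<subseteq> rearrangements"
proof
  fix f assume "f \<in> rearr"
  then obtain n where f: "bij f" "(`) f ` lamination = lamination" "\<And>J. n \<le> depth J \<Longrightarrow> \<exists>K. lin f J K"
    unfolding rearr_def by blast
  have inj: "inj f" using f(1) by (rule bij_is_inj)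
  \<comment> \<open>One more level than needed for affinity: then no image is a whole root interval, and the target
    forest subdivides the root \<open>True\<close>, as an arc diagram must.\<close>
  let ?N = "Suc n" let ?F = "\<lambda>_::bool. full ?N"
  define Q where "Q = {K. \<exists>J. depth J = ?N \<and> lin f J K}"
  have Q: "\<exists>K\<in>Q. lin f J K" if "J \<in> forest_leaves ?F" for J
  proof -
    have J: "depth J = ?N" using that by (simp add: forest_leaves_full)
    then obtain K where "lin f J K" using f(3)[of J] by auto
    then show ?thesis using J unfolding Q_def by blast
  qed
  have Qdeep: "K \<noteq> (r, [])" if "K \<in> Q" for K r
  proof -
    obtain J where J: "depth J = ?N" "lin f J K" using \<open>K \<in> Q\<close> unfolding Q_def by blast
    obtain I v where I: "J = I \<odot> v" "depth I = n" using split_address[of n J] J(1) by auto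
    obtain K' where "lin f I K'" using f(3)[of I] I by auto
    then have "K = K' \<odot> v" using J I lin_ext lin_unique by blast
    moreover have "v \<noteq> []" using J(1) I by auto
    ultimately show ?thesis by (auto simp: ext_def)
  qed
  have anti: "J' = K'" if "J' \<in> Q" "K' \<in> Q" "comparable J' K'" for J' K'
  proof -
    obtain J where J: "depth J = ?N" "lin f J J'" using \<open>J' \<in> Q\<close> unfolding Q_def by blast
    obtain K where K: "depth K = ?N" "lin f K K'" using \<open>K' \<in> Q\<close> unfolding Q_def by blast
    have "half_part J' \<inter> half_part K' \<noteq> {}"
    proof -
      have "lft (I \<odot> v) \<in> half_part I \<inter> half_part (I \<odot> v)" for I v
        using half_part_ext[of I v] gam_mem(2)[of 0 "I \<odot> v"] by auto
      then show ?thesis using that(3) unfolding comparable_def by blast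
    qed
    then have "f ` half_part J \<inter> f ` half_part K \<noteq> {}" using lin_parts(2) J(2) K(2) by simp
    then have "half_part J \<inter> half_part K \<noteq> {}" using inj by (auto dest: injD)
    then have "comparable J K" using half_part_disjoint by blast
    then have "J = K" using J(1) K(1) unfolding comparable_def by auto
    then show ?thesis using J K lin_unique by blast
  qed
  obtain M where "\<And>L. M \<le> depth L \<Longrightarrow> \<exists>J K v. depth J = ?N \<and> lin f J K \<and> L = K \<odot> v"
    using deep_addresses_covered[OF f(1,3) le_SucI[OF order_refl]] by blast
  then have "\<exists>K\<in>Q. \<exists>v. L = K \<odot> v" if "M \<le> depth L" for L using that unfolding Q_def by blast
  then obtain H where H: "forest_leaves H = Q" using forest_with_leaves[of Q M] anti by blast
  let ?D = "diagram ?F" and ?R = "diagram H"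
  have VR: "vertices ?R = f ` vertices ?D"
    unfolding vertices_diagram H forest_leaves_full Q_def
    using linD[of f _ _ 0] f(3) by (auto simp: image_iff) (metis le_Suc_eq linD order_refl zero_le_one)+
  have IR: "intervals ?R = map_prod f f ` intervals ?D"
  proof
    show "intervals ?R \<subseteq> map_prod f f ` intervals ?D"
    proof
      fix x assume "x \<in> intervals ?R"
      then obtain J K where "x = (lft K, rgt K)" "depth J = ?N" "lin f J K" unfolding intervals_diagram H Q_def by blast
      moreover then have "x = map_prod f f (lft J, rgt J)" using linD[of f J K 0] linD[of f J K 1] by simp
      ultimately show "x \<in> map_prod f f ` intervals ?D"
        unfolding intervals_diagram forest_leaves_full by blast
    qed
    show "map_prod f f ` intervals ?D \<subseteq> intervals ?R"
    proof
      fix x assume "x \<in> map_prod f f ` intervals ?D"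
      then obtain J where J: "J \<in> forest_leaves ?F" "x = (f (lft J), f (rgt J))" unfolding intervals_diagram by auto
      then obtain K where "K \<in> Q" "lin f J K" using Q by blast
      then show "x \<in> intervals ?R" unfolding intervals_diagram H using J linD[of f J K 0] linD[of f J K 1] by auto
    qed
  qed
  have DR: "?R = (`) f ` ?D"
  proof -
    have "?R = {c \<in> (`) f ` lamination. c \<subseteq> f ` vertices ?D}"
      using diagram_from_vertices[of H] unfolding VR f(2) .
    also have "\<dots> = (`) f ` {c \<in> lamination. c \<subseteq> vertices ?D}"
      using inj_image_subset_iff[OF inj] by auto
    also have "\<dots> = (`) f ` ?D" using diagram_from_vertices[of ?F] by simp
    finally show ?thesis .
  qed
  have ivl_f: "f ` ivl p q = ivl (f p) (f q)" if "p \<in> vertices ?D" "q \<in> vertices ?D" "p \<noteq> q" for p q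
    using image_ivl_vertices[OF inj _ that] Q by blast
  have two: "p \<noteq> q" if "{p, q} \<in> ?D" for p q
  proof -
    have "{p, q} \<in> lamination" using that diagram_from_vertices[of ?F] by blast
    then have "\<exists>a b. a \<noteq> b \<and> {p, q} = {a, b}"
      using lft_ne_rgt[of "(True, [])"] arc_at_ne unfolding lamination_def root_arc_def arc_at_def by blast
    then show ?thesis by (auto simp: doubleton_eq_iff)
  qed
  have region: "(x, y) \<in> same_region ?D \<longleftrightarrow> (map_prod f f x, map_prod f f y) \<in> same_region ?R"
    if xy: "x \<in> intervals ?D" "y \<in> intervals ?D" for x y
  proof -
    obtain a b c d where ab: "x = (a, b)" "y = (c, d)" by (metis surj_pair)
    have ival: "f ` ivl a b = ivl (f a) (f b)" "f ` ivl c d = ivl (f c) (f d)"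
      using xy ab ivl_f unfolding intervals_def by auto
    have "(\<forall>p q. {p, q} \<in> ?R \<longrightarrow> (ivl (f a) (f b) \<subseteq> ivl p q \<longleftrightarrow> ivl (f c) (f d) \<subseteq> ivl p q))
      \<longleftrightarrow> (\<forall>p q. {p, q} \<in> ?D \<longrightarrow> (ivl (f a) (f b) \<subseteq> ivl (f p) (f q) \<longleftrightarrow> ivl (f c) (f d) \<subseteq> ivl (f p) (f q)))"
    proof -
      have "{f p, f q} \<in> ?R \<longleftrightarrow> {p, q} \<in> ?D" for p q
      proof -
        have "inj ((`) f)" by (rule injI) (simp add: inj_image_eq_iff[OF inj])
        then have "f ` {p, q} \<in> (`) f ` ?D \<longleftrightarrow> {p, q} \<in> ?D" by (rule inj_image_mem_iff)
        then show ?thesis unfolding DR by simp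
      qed
      moreover have "\<exists>x. p = f x" for p using f(1) by (metis bij_pointE)
      ultimately show ?thesis by metis
    qed
    moreover have "ivl (f a) (f b) \<subseteq> ivl (f p) (f q) \<longleftrightarrow> ivl a b \<subseteq> ivl p q"
      "ivl (f c) (f d) \<subseteq> ivl (f p) (f q) \<longleftrightarrow> ivl c d \<subseteq> ivl p q" if "{p, q} \<in> ?D" for p q
    proof -
      have "p \<in> vertices ?D" "q \<in> vertices ?D" using that unfolding vertices_def by blast+
      then have "f ` ivl p q = ivl (f p) (f q)" using ivl_f two[OF that] by blast
      then show "ivl (f a) (f b) \<subseteq> ivl (f p) (f q) \<longleftrightarrow> ivl a b \<subseteq> ivl p q"
        "ivl (f c) (f d) \<subseteq> ivl (f p) (f q) \<longleftrightarrow> ivl c d \<subseteq> ivl p q"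
        using ival inj_image_subset_iff[OF inj] by metis+
    qed
    ultimately have "(\<forall>p q. {p, q} \<in> ?R \<longrightarrow> (ivl (f a) (f b) \<subseteq> ivl p q \<longleftrightarrow> ivl (f c) (f d) \<subseteq> ivl p q))
      \<longleftrightarrow> (\<forall>p q. {p, q} \<in> ?D \<longrightarrow> (ivl a b \<subseteq> ivl p q \<longleftrightarrow> ivl c d \<subseteq> ivl p q))"
      by metis
    moreover have "map_prod f f x \<in> intervals ?R" "map_prod f f y \<in> intervals ?R"
      unfolding IR using xy by blast+
    ultimately show ?thesis
      using xy unfolding same_region_def ab by (simp only: mem_Collect_eq map_prod_simp case_prod_conv simp_thms)
  qed
  have "diagram_iso f ?D ?R"
    unfolding diagram_iso_def
  proof (intro conjI)
    show "bij_betw f (vertices ?D) (vertices ?R)"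
      unfolding VR using inj by (intro inj_on_imp_bij_betw inj_on_subset[OF inj]) auto
    show "map_prod f f ` intervals ?D = intervals ?R" by (simp add: IR)
    show "(`) f ` ?D = ?R" by (simp add: DR)
    have cls: "same_region ?R `` {map_prod f f x} = map_prod f f ` (same_region ?D `` {x})" if x: "x \<in> intervals ?D" for x
    proof (intro equalityI subsetI)
      fix z assume z: "z \<in> same_region ?R `` {map_prod f f x}"
      then have "z \<in> intervals ?R" unfolding same_region_def by auto
      then have "z \<in> map_prod f f ` intervals ?D" by (simp only: IR)
      then obtain y where y: "z = map_prod f f y" "y \<in> intervals ?D" by (rule imageE)
      then show "z \<in> map_prod f f ` (same_region ?D `` {x})" using region[OF x y(2)] z by auto
    next
      fix z assume "z \<in> map_prod f f ` (same_region ?D `` {x})"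
      then obtain y where y: "z = map_prod f f y" "(x, y) \<in> same_region ?D" by auto
      then have "y \<in> intervals ?D" unfolding same_region_def by auto
      then show "z \<in> same_region ?R `` {map_prod f f x}" using region[OF x] y by auto
    qed
    have quot: "A // r = (\<lambda>x. r `` {x}) ` A" for A :: "'b set" and r by (auto simp: quotient_def)
    show "(\<lambda>F. map_prod f f ` F) ` faces ?D = faces ?R"
      unfolding faces_def IR quot image_image by (intro image_cong refl) (simp only: cls)
  qed
  moreover have "induced_map ?D f f"
    unfolding induced_map_def
  proof (clarify)
    fix a b t assume "(a, b) \<in> intervals ?D" and t: "t \<in> {0..1::real}"
    then obtain J where J: "J \<in> forest_leaves ?F" "a = lft J" "b = rgt J" unfolding intervals_diagram by blast
    then obtain K where K: "lin f J K" using Q by blast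
    then show "f (shift a (t * len a b)) = shift (f a) (t * len (f a) (f b))"
      unfolding J using linD[OF K, of 0] linD[OF K, of 1] linD[OF K, of t] t by (simp add: shift_address)
  qed
  moreover have "arc_diagram ?D" by (rule forest_is_arc_diagram) (simp add: full.simps)
  moreover have "arc_diagram ?R"
  proof (rule forest_is_arc_diagram)
    show "H True \<noteq> Leaf"
    proof
      assume "H True = Leaf"
      then have "(True, []) \<in> forest_leaves H" by (simp add: forest_leaves_def)
      then show False using H Qdeep by blast
    qed
  qed
  ultimately show "f \<in> rearrangements" unfolding rearrangements_def by blast
qed

theorem rearrangements_eq: "rearrangements = rearr"
  using rearrangements_subset rearr_subset by blast


section \<open>Rotations at an interval\<close>

lemma eq_by_forest:
  assumes "\<And>J. J \<in> forest_leaves F \<Longrightarrow> \<exists>K. lin f J K \<and> lin g J K" shows "f = g"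
proof
  fix y
  obtain J t where J: "J \<in> forest_leaves F" "0 \<le> t" "t < 1" "y = gam J t" by (rule forest_cover)
  then obtain K where "lin f J K" "lin g J K" using assms by blast
  then show "f y = g y" using linD[of f J K t] linD[of g J K t] J by simp
qed

lemma eq_by_tree:
  assumes "\<And>y. y \<notin> open_part J \<Longrightarrow> f y = g y"
    and "\<And>w. w \<in> leaves t \<Longrightarrow> \<exists>K. lin f (J \<odot> w) K \<and> lin g (J \<odot> w) K"
  shows "f = g"
proof
  fix y
  show "f y = g y"
  proof (cases "y \<in> open_part J")
    case True
    then obtain s where s: "y = gam J s" "0 \<le> s" "s < 1" by (auto simp: open_part_def)
    obtain w s' where w: "w \<in> leaves t" "0 \<le> s'" "s' < 1" "s = off w + sc w * s'"
      using leaf_cover[OF s(2,3)] by blast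
    then obtain K where K: "lin f (J \<odot> w) K" "lin g (J \<odot> w) K" using assms(2) by blast
    have "y = gam (J \<odot> w) s'" by (simp add: s(1) w(4) gam_ext)
    then show ?thesis using linD[OF K(1), of s'] linD[OF K(2), of s'] w by simp
  qed (use assms(1) in blast)
qed

definition pos :: "addr \<Rightarrow> circle \<Rightarrow> real" where
  "pos J y = (THE t. 0 \<le> t \<and> t \<le> 1 \<and> gam J t = y)"

lemma pos_gam: "0 \<le> t \<Longrightarrow> t \<le> 1 \<Longrightarrow> pos J (gam J t) = t"
  unfolding pos_def by (rule the_equality) (auto intro: gam_inj)

text \<open>The map of the interval \<open>J\<close> given by \<open>h\<close> in the affine parameter, extended by the identity. The
cases are split along the open part, since the endpoints are fixed anyway.\<close>
definition local_map :: "addr \<Rightarrow> (real \<Rightarrow> real) \<Rightarrow> circle \<Rightarrow> circle" where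
  "local_map J h y = (if y \<in> open_part J then gam J (h (pos J y)) else y)"

lemma local_map_outside: "y \<notin> open_part J \<Longrightarrow> local_map J h y = y"
  by (simp add: local_map_def)

lemma local_map_gam:
  assumes "h 0 = 0" "h 1 = 1" "0 \<le> t" "t \<le> 1" shows "local_map J h (gam J t) = gam J (h t)"
proof -
  consider "t = 0" | "t = 1" | "0 < t" "t < 1" using assms by linarith
  then show ?thesis
    by cases (auto simp: local_map_def assms ends_not_open gam_mem pos_gam)
qed

lemma local_map_inverse:
  assumes "\<And>t. 0 < t \<Longrightarrow> t < 1 \<Longrightarrow> 0 < h t \<and> h t < 1 \<and> k (h t) = t"
  shows "local_map J k \<circ> local_map J h = id"
proof
  fix y
  show "(local_map J k \<circ> local_map J h) y = id y"
  proof (cases "y \<in> open_part J")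
    case True
    then obtain t where "y = gam J t" "0 < t" "t < 1" by (auto simp: open_part_def)
    then show ?thesis using assms[of t] by (simp add: local_map_def gam_mem pos_gam)
  qed (simp add: local_map_outside)
qed

text \<open>The piecewise linear map with slopes \<open>4\<close>, \<open>1\<close>, \<open>1/4\<close> and breaks at \<open>3/16\<close> and \<open>1/4\<close>. Its slopes
decrease, so it is a minimum of linear maps, and its inverse is a maximum.\<close>
definition rot_unit :: "real \<Rightarrow> real" where
  "rot_unit t = min (4 * t) (min (t + 9/16) (t / 4 + 3/4))"

definition rot_unit_inv :: "real \<Rightarrow> real" where
  "rot_unit_inv t = max (t / 4) (max (t - 9/16) (4 * t - 3))"

definition rot :: "addr \<Rightarrow> circle \<Rightarrow> circle" where "rot J = local_map J rot_unit"

lemma rot_outside: "y \<notin> open_part J \<Longrightarrow> rot J y = y"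
  by (simp add: rot_def local_map_outside)

lemma rot_gam: "0 \<le> t \<Longrightarrow> t \<le> 1 \<Longrightarrow> rot J (gam J t) = gam J (rot_unit t)"
  unfolding rot_def by (rule local_map_gam) (auto simp: rot_unit_def)

lemma rot_bij: "bij (rot J)"
proof (rule o_bij)
  show "local_map J rot_unit_inv \<circ> rot J = id"
    unfolding rot_def by (rule local_map_inverse) (auto simp: rot_unit_def rot_unit_inv_def min_def max_def field_simps)
  show "rot J \<circ> local_map J rot_unit_inv = id"
    unfolding rot_def by (rule local_map_inverse) (auto simp: rot_unit_def rot_unit_inv_def min_def max_def field_simps)
qed

lemma rot_linI:
  assumes "\<And>s. 0 \<le> s \<Longrightarrow> s \<le> 1 \<Longrightarrow> rot_unit (off u + sc u * s) = off v + sc v * s"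
  shows "lin (rot J) (J \<odot> u) (J \<odot> v)"
  unfolding lin_def gam_ext using unit_bounds[of _ u] assms by (auto simp: rot_gam)

text \<open>The rotation moves the subdivision of the left part to the right part.\<close>
lemma rot_lin:
  "lin (rot J) (J \<odot> (Lt # Lt # v)) (J \<odot> (Lt # v))"
  "lin (rot J) (J \<odot> (Lt # Md # v)) (J \<odot> (Md # v))"
  "lin (rot J) (J \<odot> (Lt # Rt # v)) (J \<odot> (Rt # Lt # v))"
  "lin (rot J) (J \<odot> (Md # v)) (J \<odot> (Rt # Md # v))"
  "lin (rot J) (J \<odot> (Rt # v)) (J \<odot> (Rt # Rt # v))"
proof -
  have "lin (rot J) (J \<odot> [Lt, Lt]) (J \<odot> [Lt])" by (rule rot_linI) (auto simp: rot_unit_def min_def field_simps)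
  from lin_ext[OF this, of v] show "lin (rot J) (J \<odot> (Lt # Lt # v)) (J \<odot> (Lt # v))" by simp
  have "lin (rot J) (J \<odot> [Lt, Md]) (J \<odot> [Md])" by (rule rot_linI) (auto simp: rot_unit_def min_def field_simps)
  from lin_ext[OF this, of v] show "lin (rot J) (J \<odot> (Lt # Md # v)) (J \<odot> (Md # v))" by simp
  have "lin (rot J) (J \<odot> [Lt, Rt]) (J \<odot> [Rt, Lt])" by (rule rot_linI) (auto simp: rot_unit_def min_def field_simps)
  from lin_ext[OF this, of v] show "lin (rot J) (J \<odot> (Lt # Rt # v)) (J \<odot> (Rt # Lt # v))" by simp
  have "lin (rot J) (J \<odot> [Md]) (J \<odot> [Rt, Md])" by (rule rot_linI) (auto simp: rot_unit_def min_def field_simps)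
  from lin_ext[OF this, of v] show "lin (rot J) (J \<odot> (Md # v)) (J \<odot> (Rt # Md # v))" by simp
  have "lin (rot J) (J \<odot> [Rt]) (J \<odot> [Rt, Rt])" by (rule rot_linI) (auto simp: rot_unit_def min_def field_simps)
  from lin_ext[OF this, of v] show "lin (rot J) (J \<odot> (Rt # v)) (J \<odot> (Rt # Rt # v))" by simp
qed

lemma rot_fixes: "\<not> comparable J L \<Longrightarrow> lin (rot J) L L"
  using open_closed_disjoint[of J L] gam_mem(1)[of _ L] by (auto simp: lin_def intro!: rot_outside)

lemma rot_lin_ex:
  assumes "v \<noteq> []" "v \<noteq> [Lt]" shows "\<exists>v'. lin (rot J) (J \<odot> v) (J \<odot> v')"
proof -
  obtain c u where v: "v = c # u" using assms(1) by (cases v) auto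
  show ?thesis
  proof (cases c)
    case Lt
    then obtain d u' where u: "u = d # u'" using assms(2) v by (cases u) auto
    show ?thesis using rot_lin(1-3)[of J u'] Lt v u by (cases d) auto
  qed (use rot_lin(4,5) v in blast)+
qed

lemma arc_images:
  assumes "lin f (I \<odot> [Md]) (K \<odot> [Md])" shows "f ` arc_at I = arc_at K"
  unfolding arc_at_ends(2) using linD[OF assms, of 0] linD[OF assms, of 1] by simp

lemma rot_arc:
  "rot J ` arc_at J = arc_at (J \<odot> [Rt])"
  "rot J ` arc_at (J \<odot> [Lt]) = arc_at J"
  by (rule arc_images; use rot_lin(4)[of J "[]"] rot_lin(2)[of J "[]"] in simp)+

lemma rot_arc_outside: "c \<inter> open_part J = {} \<Longrightarrow> rot J ` c = c"
proof -
  assume "c \<inter> open_part J = {}"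
  then have "\<forall>x\<in>c. rot J x = x" using rot_outside by blast
  then show ?thesis by (simp cong: image_cong)
qed

lemma address_cases:
  obtains v where "L = J \<odot> v" | "\<not> comparable J L" | c v where "J = L \<odot> (c # v)"
  unfolding comparable_def by (metis ext_Nil neq_Nil_conv)

text \<open>Two arcs are not inside a piece on which the rotation is affine: the primary arcs of \<open>J\<close>
and of its left part. They go to the primary arcs of the right part and of \<open>J\<close>.\<close>
lemma rot_lamination: "(`) (rot J) ` lamination = lamination"
proof
  show "(`) (rot J) ` lamination \<subseteq> lamination"
  proof -
    have "rot J ` arc_at L \<in> lamination" for L
    proof (cases rule: address_cases[of L J])
      case (1 v)
      consider "v = []" | "v = [Lt]" | "v \<noteq> []" "v \<noteq> [Lt]" by blast
      then show ?thesis
      proof cases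
        case 3
        then obtain v' where "lin (rot J) L (J \<odot> v')" using rot_lin_ex 1 by blast
        then show ?thesis using lin_arc by simp
      qed (use 1 rot_arc in simp_all)
    next
      case 2
      then show ?thesis by (metis rot_fixes lin_arc arc_in_lamination(1))
    next
      case (3 c v)
      then show ?thesis using rot_arc_outside arc_at_not_in_child by simp
    qed
    moreover have "rot J ` root_arc \<in> lamination" using rot_arc_outside root_arc_not_open by simp
    ultimately show ?thesis unfolding lamination_def by auto
  qed
  show "lamination \<subseteq> (`) (rot J) ` lamination"
  proof -
    have img: "arc_at L \<in> (`) (rot J) ` lamination" if "rot J ` arc_at K = arc_at L" for K L
      using that by (metis arc_in_lamination(1) imageI)
    have "arc_at L \<in> (`) (rot J) ` lamination" for L
    proof (cases rule: address_cases[of L J])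
      case (1 v)
      have lins: "\<exists>K. lin (rot J) K L" if v': "v \<noteq> []" "v \<noteq> [Rt]"
      proof -
        obtain c u where v: "v = c # u" using \<open>v \<noteq> []\<close> by (cases v) auto
        show ?thesis
        proof (cases c)
          case Rt
          then obtain d u' where u: "u = d # u'" using v' v by (cases u) auto
          show ?thesis unfolding 1 v Rt u using rot_lin(3-5)[of J u'] by (cases d; simp only:; blast)
        qed (use rot_lin(1,2)[of J u] v 1 in blast)+
      qed
      consider "v = []" | "v = [Rt]" | "v \<noteq> []" "v \<noteq> [Rt]" by blast
      then show ?thesis
      proof cases
        case 1 then show ?thesis using img[OF rot_arc(2)] \<open>L = J \<odot> v\<close> by simp
      next
        case 2 then show ?thesis using img[OF rot_arc(1)] \<open>L = J \<odot> v\<close> by simp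
      next
        case 3
        then obtain K where "lin (rot J) K L" using lins by blast
        then show ?thesis using img lin_arc by blast
      qed
    next
      case 2
      then have "rot J ` arc_at L = arc_at L" by (intro lin_arc rot_fixes)
      then show ?thesis by (rule img)
    next
      case (3 c v)
      then have "rot J ` arc_at L = arc_at L" by (simp add: rot_arc_outside arc_at_not_in_child)
      then show ?thesis by (rule img)
    qed
    moreover have "root_arc \<in> (`) (rot J) ` lamination"
      using rot_arc_outside[OF root_arc_not_open] by (metis arc_in_lamination(2) imageI)
    ultimately show ?thesis unfolding lamination_def by auto
  qed
qed

lemma rot_rearr: "rot J \<in> rearr"
proof (rule rearrI[OF rot_bij rot_lamination, where n = "depth J + 2"])
  fix L :: addr assume L: "depth J + 2 \<le> depth L"
  show "\<exists>K. lin (rot J) L K"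
  proof (cases rule: address_cases[of L J])
    case (1 v)
    then have "v \<noteq> []" "v \<noteq> [Lt]" using L by auto
    then show ?thesis using rot_lin_ex 1 by blast
  next
    case 2 then show ?thesis using rot_fixes by blast
  next
    case (3 c v) then show ?thesis using L by simp
  qed
qed

lemma rot_ne_id: "rot J \<noteq> id"
proof
  assume "rot J = id"
  then have "lin (rot J) (J \<odot> [Md]) (J \<odot> [Md])" using lin_id by metis
  then have "J \<odot> [Md] = J \<odot> [Rt, Md]" using rot_lin(4)[of J "[]"] lin_unique by blast
  then show False by simp
qed

text \<open>A rotation is determined by the affine parametrisation of its interval.\<close>
lemma rot_conj: assumes "bij g" "lin g I K" shows "g \<circ> rot I = rot K \<circ> g"
proof
  fix y
  show "(g \<circ> rot I) y = (rot K \<circ> g) y"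
  proof (cases "y \<in> open_part I")
    case True
    then obtain t where t: "y = gam I t" "0 \<le> t" "t \<le> 1" by (auto simp: open_part_def)
    moreover then have "0 \<le> rot_unit t" "rot_unit t \<le> 1" by (auto simp: rot_unit_def)
    ultimately show ?thesis using linD[OF assms(2)] by (simp add: rot_gam)
  next
    case False
    then have "g y \<notin> open_part K"
      using lin_parts(3)[OF assms(2)] bij_is_inj[OF assms(1)] by (auto dest: injD)
    then show ?thesis using False by (simp add: rot_outside)
  qed
qed

text \<open>The pentagon relation of Thompson's group \<open>F\<close>. Both sides are affine on the seven leaves of the tree
that subdivides an interval, its left part and the left part of that.\<close>
lemma rot_pentagon: "rot J \<circ> rot J = rot (J \<odot> [Rt]) \<circ> rot J \<circ> rot (J \<odot> [Lt])"
proof (rule eq_by_tree[of J _ _ "Node (Node (Node Leaf Leaf Leaf) Leaf Leaf) Leaf Leaf"])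
  fix y assume "y \<notin> open_part J"
  moreover then have "y \<notin> open_part (J \<odot> [Lt])" "y \<notin> open_part (J \<odot> [Rt])" using open_part_ext by blast+
  ultimately show "(rot J \<circ> rot J) y = (rot (J \<odot> [Rt]) \<circ> rot J \<circ> rot (J \<odot> [Lt])) y"
    by (simp add: rot_outside)
next
  note J = rot_lin[of J]
  note L = rot_lin[of "J \<odot> [Lt]", simplified]
  note R = rot_lin[of "J \<odot> [Rt]", simplified]
  have fixL: "lin (rot (J \<odot> [Rt])) (J \<odot> (Lt # v)) (J \<odot> (Lt # v))" for v by (rule rot_fixes) simp
  have fixM: "lin (rot (J \<odot> [Lt])) (J \<odot> (Md # v)) (J \<odot> (Md # v))"
    "lin (rot (J \<odot> [Rt])) (J \<odot> (Md # v)) (J \<odot> (Md # v))" for v by (rule rot_fixes; simp)+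
  have fixR: "lin (rot (J \<odot> [Lt])) (J \<odot> (Rt # v)) (J \<odot> (Rt # v))" for v by (rule rot_fixes) simp
  fix w assume "w \<in> leaves (Node (Node (Node Leaf Leaf Leaf) Leaf Leaf) Leaf Leaf)"
  then consider "w = [Lt, Lt, Lt]" | "w = [Lt, Lt, Md]" | "w = [Lt, Lt, Rt]" | "w = [Lt, Md]"
    | "w = [Lt, Rt]" | "w = [Md]" | "w = [Rt]" by auto
  then show "\<exists>K. lin (rot J \<circ> rot J) (J \<odot> w) K \<and> lin (rot (J \<odot> [Rt]) \<circ> rot J \<circ> rot (J \<odot> [Lt])) (J \<odot> w) K"
  proof cases
    case 1
    show ?thesis unfolding 1
      by (intro exI conjI, rule lin_comp[OF J(1) J(1)]) (simp only: comp_assoc, rule lin_comp[OF lin_comp[OF L(1) J(1)] fixL, unfolded comp_assoc])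
  next
    case 2
    show ?thesis unfolding 2
      by (intro exI conjI, rule lin_comp[OF J(1) J(2)]) (simp only: comp_assoc, rule lin_comp[OF lin_comp[OF L(2) J(2)] fixM(2), unfolded comp_assoc])
  next
    case 3
    show ?thesis unfolding 3
      by (intro exI conjI, rule lin_comp[OF J(1) J(3)]) (simp only: comp_assoc, rule lin_comp[OF lin_comp[OF L(3) J(3)] R(1), unfolded comp_assoc])
  next
    case 4
    show ?thesis unfolding 4
      by (intro exI conjI, rule lin_comp[OF J(2) J(4)]) (simp only: comp_assoc, rule lin_comp[OF lin_comp[OF L(4) J(3)] R(2), unfolded comp_assoc])
  next
    case 5
    show ?thesis unfolding 5
      by (intro exI conjI, rule lin_comp[OF J(3) J(5)]) (simp only: comp_assoc, rule lin_comp[OF lin_comp[OF L(5) J(3)] R(3), unfolded comp_assoc])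
  next
    case 6
    show ?thesis unfolding 6
      by (intro exI conjI, rule lin_comp[OF J(4) J(5)]) (simp only: comp_assoc, rule lin_comp[OF lin_comp[OF fixM(1) J(4)] R(4), unfolded comp_assoc])
  next
    case 7
    show ?thesis unfolding 7
      by (intro exI conjI, rule lin_comp[OF J(5) J(5)]) (simp only: comp_assoc, rule lin_comp[OF lin_comp[OF fixR J(5)] R(5), unfolded comp_assoc])
  qed
qed

section \<open>Two involutions\<close>

lemma involution_lamination:
  assumes "f \<circ> f = id" "f ` root_arc \<in> lamination" "\<And>J. f ` arc_at J \<in> lamination"
  shows "(`) f ` lamination = lamination"
proof
  show sub: "(`) f ` lamination \<subseteq> lamination" using assms(2,3) unfolding lamination_def by blast
  show "lamination \<subseteq> (`) f ` lamination"
  proof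
    fix c assume "c \<in> lamination"
    then have "f ` (f ` c) = c" "f ` c \<in> lamination" using assms(1) sub by (auto simp: image_comp)
    then show "c \<in> (`) f ` lamination" by (metis imageI)
  qed
qed

text \<open>Exchange of the two root intervals by affine maps. It keeps \<open>root_arc\<close> and exchanges the regions on the two
sides of it.\<close>
definition flip :: "circle \<Rightarrow> circle" where
  "flip y = (if y \<in> half_part (False, []) then gam (True, []) (pos (False, []) y)
     else gam (False, []) (pos (True, []) y))"

lemma flip_root: "lin flip (r, []) (\<not> r, [])"
proof -
  have *: "flip (gam (r, []) t) = gam (\<not> r, []) t" if "0 \<le> t" "t < 1" for r t
  proof (cases r)
    case True
    have "\<not> comparable (False, []) (True, [])" by (simp add: comparable_def ext_def)
    then have "gam (True, []) t \<notin> half_part (False, [])"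
      using half_part_disjoint gam_mem(2)[OF that] by blast
    then show ?thesis using True that by (simp add: flip_def pos_gam)
  qed (use that in \<open>simp add: flip_def gam_mem pos_gam\<close>)
  have "flip (gam (r, []) 1) = gam (\<not> r, []) 1"
    using *[of 0 "\<not> r"] root_rgt[of r] root_rgt[of "\<not> r"] by simp
  then show ?thesis using * by (fastforce simp: lin_def)
qed

lemma flip_lin: "lin flip (r, w) (\<not> r, w)"
  using lin_ext[OF flip_root[of r], of w] by simp

lemma flip_flip: "flip \<circ> flip = id"
proof (rule eq_by_forest[where F = "\<lambda>_. Leaf"])
  fix J :: addr
  have "lin (flip \<circ> flip) J J"
    using lin_comp[OF flip_lin flip_lin, of "fst J" "snd J"] by simp
  then show "\<exists>K. lin (flip \<circ> flip) J K \<and> lin id J K" using lin_id by blast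
qed

lemma flip_rearr: "flip \<in> rearr"
proof (rule rearrI[where n = 0])
  show "bij flip" using flip_flip by (rule o_bij) (rule flip_flip)
  have "flip ` root_arc = {lft (False, []), rgt (False, [])}"
    unfolding root_arc_ends[of True]
    using linD[OF flip_root[of True], of 0] linD[OF flip_root[of True], of 1] by simp
  also have "\<dots> = root_arc" by (rule root_arc_ends[symmetric])
  finally have "flip ` root_arc = root_arc" .
  moreover have "flip ` arc_at J = arc_at (\<not> fst J, snd J)" for J
    using lin_arc[OF flip_lin[of "fst J" "snd J"]] by simp
  ultimately show "(`) flip ` lamination = lamination"
    by (intro involution_lamination[OF flip_flip]) simp_all
  show "\<exists>K. lin flip J K" for J using flip_lin[of "fst J" "snd J"] by auto
qed

definition half_turn :: "circle \<Rightarrow> circle" where "half_turn y = shift y (1/2)"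

lemma half_turn_half_turn: "half_turn \<circ> half_turn = id"
proof
  fix y
  obtain x where "y = pt x" by (rule pt_cases)
  then show "(half_turn \<circ> half_turn) y = id y" by (simp add: half_turn_def pt_eq_iff)
qed

text \<open>The half turn exchanges the root \<open>False\<close> with the middle part of the root \<open>True\<close>, and the left part of the
latter with its right part.\<close>
lemma half_turn_lin:
  "lin half_turn (False, v) (True, Md # v)"
  "lin half_turn (True, Md # v) (False, v)"
  "lin half_turn (True, Lt # v) (True, Rt # v)"
  "lin half_turn (True, Rt # v) (True, Lt # v)"
proof -
  have "lin half_turn (False, []) (True, [Md])" "lin half_turn (True, [Lt]) (True, [Rt])"
    by (auto simp: lin_def half_turn_def gam_def field_simps pt_eq_iff)
  moreover have "lin half_turn (True, [Md]) (False, [])" "lin half_turn (True, [Rt]) (True, [Lt])"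
    by (auto simp: lin_def half_turn_def gam_def field_simps pt_eq_iff)
  ultimately show "lin half_turn (False, v) (True, Md # v)"
    "lin half_turn (True, Md # v) (False, v)" "lin half_turn (True, Lt # v) (True, Rt # v)"
    "lin half_turn (True, Rt # v) (True, Lt # v)"
    using lin_ext[of half_turn _ _ v] by fastforce+
qed

lemma half_turn_rearr: "half_turn \<in> rearr"
proof (rule rearrI[where n = 1])
  show "bij half_turn" using half_turn_half_turn by (rule o_bij) (rule half_turn_half_turn)
  have ends: "half_turn ` {lft J, rgt J} = {lft K, rgt K}" if "lin half_turn J K" for J K
    using linD[OF that, of 0] linD[OF that, of 1] by simp
  have "half_turn ` root_arc = arc_at (True, [])"
    using ends[OF half_turn_lin(1)[of "[]"]] root_arc_ends[of False] arc_at_ends(2)[of "(True, [])"] by simp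
  moreover have "half_turn ` arc_at (True, []) = root_arc"
    using ends[OF half_turn_lin(2)[of "[]"]] root_arc_ends[of False] arc_at_ends(2)[of "(True, [])"] by simp
  moreover have lins: "\<exists>K. lin half_turn J K" if J: "J \<noteq> (True, [])" for J
  proof (cases J)
    case (Pair r w)
    show ?thesis
    proof (cases r)
      case True
      then obtain c v where "w = c # v" using J Pair by (cases w) auto
      then show ?thesis using half_turn_lin[of v] Pair True by (cases c) auto
    next
      case False
      then show ?thesis using half_turn_lin(1)[of w] Pair by auto
    qed
  qed
  have "half_turn ` arc_at J \<in> lamination" if J: "J \<noteq> (True, [])" for J
  proof -
    obtain K where "lin half_turn J K" using lins[OF J] by blast
    then show ?thesis using lin_arc[of half_turn J K] by simp
  qed
  ultimately show "(`) half_turn ` lamination = lamination"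
    by (intro involution_lamination[OF half_turn_half_turn]) (simp, metis arc_in_lamination(2))
  show "\<exists>K. lin half_turn J K" if "1 \<le> depth J" for J using that by (intro lins) auto
qed

text \<open>The product of the rotation at a root and the half turn has order three: it permutes two triples of
intervals cyclically. This is the relation \<open>C\<^sup>3 = 1\<close> of Thompson's group \<open>T\<close>.\<close>
lemma half_turn_rot:
  "(rot (True, []) \<circ> half_turn) \<circ> (rot (True, []) \<circ> half_turn) \<circ> (rot (True, []) \<circ> half_turn) = id"
proof -
  let ?f = "rot (True, []) \<circ> half_turn"
  note T = rot_lin[of "(True, [])" "[]", simplified]
  have f: "lin ?f (False, []) (True, [Rt, Md])" "lin ?f (True, [Rt, Md]) (True, [Md])"
    "lin ?f (True, [Md]) (False, [])" "lin ?f (True, [Lt]) (True, [Rt, Rt])"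
    "lin ?f (True, [Rt, Rt]) (True, [Rt, Lt])" "lin ?f (True, [Rt, Lt]) (True, [Lt])"
    using lin_comp[OF half_turn_lin(1) T(4)] lin_comp[OF half_turn_lin(4) T(2)]
      lin_comp[OF half_turn_lin(2) rot_fixes[of "(True, [])" "(False, [])"]]
      lin_comp[OF half_turn_lin(3) T(5)] lin_comp[OF half_turn_lin(4) T(3)]
      lin_comp[OF half_turn_lin(4) T(1)]
    by (simp_all add: comparable_def ext_def)
  show ?thesis
  proof (rule eq_by_forest[where F = "\<lambda>r. if r then Node Leaf Leaf (Node Leaf Leaf Leaf) else Leaf"])
    fix J assume "J \<in> forest_leaves (\<lambda>r. if r then Node Leaf Leaf (Node Leaf Leaf Leaf) else Leaf)"
    then consider "J = (False, [])" | "J = (True, [Rt, Md])" | "J = (True, [Md])" | "J = (True, [Lt])"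
      | "J = (True, [Rt, Rt])" | "J = (True, [Rt, Lt])"
      by (cases J) (auto simp: forest_leaves_def split: if_splits)
    then have "lin (?f \<circ> ?f \<circ> ?f) J J"
    proof cases
      case 1 show ?thesis unfolding 1 by (rule lin_comp[OF f(1) lin_comp[OF f(2) f(3)]])
    next
      case 2 show ?thesis unfolding 2 by (rule lin_comp[OF f(2) lin_comp[OF f(3) f(1)]])
    next
      case 3 show ?thesis unfolding 3 by (rule lin_comp[OF f(3) lin_comp[OF f(1) f(2)]])
    next
      case 4 show ?thesis unfolding 4 by (rule lin_comp[OF f(4) lin_comp[OF f(5) f(6)]])
    next
      case 5 show ?thesis unfolding 5 by (rule lin_comp[OF f(5) lin_comp[OF f(6) f(4)]])
    next
      case 6 show ?thesis unfolding 6 by (rule lin_comp[OF f(6) lin_comp[OF f(4) f(5)]])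
    qed
    then show "\<exists>K. lin (?f \<circ> ?f \<circ> ?f) J K \<and> lin id J K" using lin_id by blast
  qed
qed


section \<open>Transitivity on intervals\<close>

text \<open>Subgroups of the group of rearrangements, with functions instead of the group record.\<close>
definition comp_group :: "(circle \<Rightarrow> circle) set \<Rightarrow> bool" where
  "comp_group S \<longleftrightarrow> S \<subseteq> rearr \<and> id \<in> S \<and> (\<forall>f\<in>S. \<forall>g\<in>S. f \<circ> g \<in> S) \<and> (\<forall>f\<in>S. inverse_map f \<in> S)"

lemma comp_groupD:
  assumes "comp_group S"
  shows "S \<subseteq> rearr" "id \<in> S" "f \<in> S \<Longrightarrow> g \<in> S \<Longrightarrow> f \<circ> g \<in> S" "f \<in> S \<Longrightarrow> inverse_map f \<in> S"
    "f \<in> S \<Longrightarrow> bij f"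
  using assms rearr_bij unfolding comp_group_def by blast+

lemma comp_group_rearr: "comp_group rearr"
  by (simp add: comp_group_def rearr_id rearr_comp rearr_inv)

lemma inv_comp_cancel:
  assumes "bij f"
  shows "inverse_map f \<circ> f = id" "f \<circ> inverse_map f = id"
  using assms by (auto simp: fun_eq_iff bij_is_inj bij_is_surj surj_f_inv_f)

text \<open>If \<open>S\<close> is a group and \<open>I\<close>, \<open>K\<close> are linked by \<open>S\<close>, then \<open>rot I\<close> and \<open>rot K\<close> are conjugate by an element
of \<open>S\<close>.\<close>
definition linked :: "(circle \<Rightarrow> circle) set \<Rightarrow> addr \<Rightarrow> addr \<Rightarrow> bool" where
  "linked S I K \<longleftrightarrow> (\<exists>h\<in>S. lin h I K)"

lemma linked_refl: "comp_group S \<Longrightarrow> linked S I I"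
  unfolding linked_def using comp_groupD(2) lin_id by blast

lemma linked_trans: "comp_group S \<Longrightarrow> linked S I J \<Longrightarrow> linked S J K \<Longrightarrow> linked S I K"
  unfolding linked_def using comp_groupD(3) lin_comp by blast

lemma linked_sym: "comp_group S \<Longrightarrow> linked S I K \<Longrightarrow> linked S K I"
  unfolding linked_def using comp_groupD(4,5) lin_inv by blast

lemma linkedI: "h \<in> S \<Longrightarrow> lin h I K \<Longrightarrow> linked S I K"
  unfolding linked_def by blast

text \<open>Transitivity needs only a few elements, so it is proved for every group that contains them: it is
used both for all rearrangements and for \<open>even_rearr\<close>.\<close>
locale even_overgroup =
  fixes S :: "(circle \<Rightarrow> circle) set"
  assumes comp_group: "comp_group S"
    and rot_mem: "rot J \<in> S"
    and half_turn_mem: "half_turn \<in> S"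
    and flipped_half_turn_mem: "flip \<circ> half_turn \<circ> flip \<in> S"
begin

lemmas trans = linked_trans[OF comp_group]
lemmas sym = linked_sym[OF comp_group]

text \<open>As long as no arc is crossed, an address in left and right parts is a dyadic position in one
region, and the rotations act transitively on the arcs at these positions, as \<open>F\<close> does on
dyadic rationals.\<close>
lemma linked_under_arc:
  assumes "Md \<notin> set w" shows "linked S (J \<odot> (w @ Md # v)) (J \<odot> (Md # v))"
  using assms
proof (induction w arbitrary: J)
  case Nil
  then show ?case by (simp add: linked_refl[OF comp_group])
next
  case (Cons c w)
  have "linked S (J \<odot> [c] \<odot> (w @ Md # v)) (J \<odot> [c] \<odot> (Md # v))"
    by (rule Cons.IH) (use Cons.prems in simp)
  moreover have "linked S (J \<odot> (c # Md # v)) (J \<odot> (Md # v))"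
  proof (cases c)
    case Lt
    then show ?thesis using linkedI[OF rot_mem rot_lin(2)] by simp
  next
    case Rt
    then show ?thesis using sym[OF linkedI[OF rot_mem rot_lin(4)]] by simp
  qed (use Cons.prems in simp)
  ultimately show ?case using trans by simp
qed

text \<open>The interval under the primary arc of a root is taken to the other root by the half turn or by its
conjugate.\<close>
lemma linked_across_arc: "linked S (r, Md # v) (\<not> r, v)"
proof (cases r)
  case True
  then show ?thesis using linkedI[OF half_turn_mem half_turn_lin(2)] by simp
next
  case False
  have "lin (flip \<circ> half_turn \<circ> flip) (False, Md # v) (True, v)"
    using lin_comp[OF flip_lin[of False "Md # v"] lin_comp[OF half_turn_lin(2)[of v, folded not_False_eq_True] flip_lin[of False v]]]
    by (simp add: comp_assoc)
  then show ?thesis using False linkedI[OF flipped_half_turn_mem] by simp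
qed

lemma linked_first_arc: "Md \<notin> set u \<Longrightarrow> linked S (r, u @ Md # v) (\<not> r, v)"
  using linked_under_arc[of u "(r, [])" v] linked_across_arc[of r v] trans by simp

text \<open>An interval directly under an arc is taken to a root by removing the arcs above it one after the other.\<close>
lemma linked_root: "\<exists>r'. linked S (r, w @ [Md]) (r', [])"
proof (induction "length w" arbitrary: r w rule: less_induct)
  case less
  show ?case
  proof (cases "Md \<in> set w")
    case True
    then obtain u v where w: "w = u @ Md # v" "Md \<notin> set u" by (metis split_list_first)
    obtain r' where "linked S (\<not> r, v @ [Md]) (r', [])" using less[of v] w by auto
    moreover have "linked S (r, w @ [Md]) (\<not> r, v @ [Md])"
      using linked_first_arc[OF w(2), of r "v @ [Md]"] w(1) by simp
    ultimately show ?thesis using trans by blast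
  qed (use linked_first_arc in blast)
qed

lemma linked_swap_sides: "linked S (r, Lt # v) (r, Rt # v)"
proof (cases r)
  case True
  then show ?thesis using linkedI[OF half_turn_mem half_turn_lin(3)] by simp
next
  case False
  have "lin (flip \<circ> (half_turn \<circ> flip)) (False, Lt # v) (False, Rt # v)"
    using lin_comp[OF lin_comp[OF flip_lin[of False "Lt # v"]] flip_lin[of True "Rt # v"], of half_turn]
      half_turn_lin(3)[of v] by simp
  then show ?thesis using False linkedI[OF flipped_half_turn_mem] by (simp add: comp_assoc)
qed

text \<open>A half turn, conjugated by \<open>flip\<close> for the root \<open>False\<close>, replaces the first letter \<open>a\<close> by \<open>b\<close>, and a rotation shortens a repeated first letter.\<close>
lemma linked_drop: assumes "a \<noteq> Md" "b \<noteq> Md" shows "linked S (r, a # b # v) (r, b # v)"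
proof -
  have swap: "linked S (r, c # w) (r, d # w)" if "c \<noteq> Md" "d \<noteq> Md" for c d w
    using that linked_swap_sides sym linked_refl[OF comp_group] by (cases c; cases d) auto
  have "linked S (r, b # b # v) (r, b # v)"
  proof (cases b)
    case Lt
    then show ?thesis using linkedI[OF rot_mem rot_lin(1)[of "(r, [])" v]] by simp
  next
    case Rt
    then show ?thesis using sym[OF linkedI[OF rot_mem rot_lin(5)[of "(r, [])" v]]] by simp
  qed (use assms in simp)
  then show ?thesis using swap[OF assms, of "b # v"] trans by blast
qed

lemma linked_side: "Md \<notin> set w \<Longrightarrow> w \<noteq> [] \<Longrightarrow> linked S (r, w) (r, [Lt])"
proof (induction w)
  case (Cons a w)
  show ?case
  proof (cases w)
    case Nil
    then show ?thesis
      using Cons.prems linked_swap_sides sym linked_refl[OF comp_group] by (cases a) auto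
  next
    case (Cons b v)
    then show ?thesis using Cons.IH Cons.prems linked_drop[of a b r v] trans by auto
  qed
qed simp

text \<open>Each arc that is crossed on the way down from the root changes the colour of the region. Intervals
that end in a left or right part are classified by the colour of the region they border.\<close>
definition colour :: "bool \<Rightarrow> letter list \<Rightarrow> bool" where
  "colour r w = (if even (count_list w Md) then r else \<not> r)"

lemma linked_colour: "c \<noteq> Md \<Longrightarrow> linked S (r, w @ [c]) (colour r w, [Lt])"
proof (induction "length w" arbitrary: r w rule: less_induct)
  case less
  show ?case
  proof (cases "Md \<in> set w")
    case True
    then obtain u v where w: "w = u @ Md # v" "Md \<notin> set u" by (metis split_list_first)
    have "linked S (\<not> r, v @ [c]) (colour (\<not> r) v, [Lt])" using less w by auto
    moreover have first: "linked S (r, w @ [c]) (\<not> r, v @ [c])"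
      using linked_first_arc[OF w(2), of r "v @ [c]"] w(1) by simp
    moreover have "colour (\<not> r) v = colour r w"
      using w by (simp add: colour_def count_list_0_iff[THEN iffD2])
    ultimately show ?thesis using trans[OF first, of "(colour r w, [Lt])"] by simp
  next
    case False
    then show ?thesis using linked_side[of "w @ [c]" r] less.prems
      by (simp add: colour_def count_list_0_iff[THEN iffD2])
  qed
qed

end

section \<open>Rearrangements of a single interval\<close>

definition supported :: "(circle \<Rightarrow> circle) \<Rightarrow> addr \<Rightarrow> bool" where
  "supported h J \<longleftrightarrow> (\<forall>y. y \<notin> open_part J \<longrightarrow> h y = y)"

lemma supported_comp: "supported f J \<Longrightarrow> supported g J \<Longrightarrow> supported (f \<circ> g) J"
  by (simp add: supported_def)

lemma supported_inv: "bij f \<Longrightarrow> supported f J \<Longrightarrow> supported (inverse_map f) J"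
  unfolding supported_def by (metis bij_inv_eq_iff)

lemma supported_id: "supported id J" by (simp add: supported_def)

lemma supported_rot: "supported (rot J) J" by (simp add: supported_def rot_outside)

lemma supported_mono: "supported f (J \<odot> v) \<Longrightarrow> supported f J"
  unfolding supported_def using open_part_ext by blast

lemma supported_lin: "supported h J \<Longrightarrow> \<not> comparable J L \<Longrightarrow> lin h L L"
  using open_closed_disjoint[of J L] gam_mem(1)[of _ L] unfolding supported_def lin_def by auto

lemma supported_ends: "supported h J \<Longrightarrow> h (lft J) = lft J" "supported h J \<Longrightarrow> h (rgt J) = rgt J"
  using ends_not_open[of J] unfolding supported_def by blast+

lemma open_part_nonempty: "open_part J \<noteq> {}"
  using gam_mem(3)[of "1/2" J] by auto

lemma comparable_open: "comparable J K \<Longrightarrow> open_part J \<inter> open_part K \<noteq> {}"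
  unfolding comparable_def using open_part_ext open_part_nonempty by blast

text \<open>An address interval inside \<open>J\<close> has interior points in common with \<open>J\<close>.\<close>
lemma subset_comparable: "closed_part K \<subseteq> closed_part J \<Longrightarrow> comparable J K"
  using open_closed_disjoint[of K J] open_part_nonempty[of K] parts_incl(3)[of K] comparable_sym by blast

lemma off_eq_0: "off w = 0 \<Longrightarrow> w = replicate (length w) Lt"
proof (induction w)
  case (Cons c w)
  have "0 \<le> lsc c * off w" using lsc_pos[of c] off_nonneg[of w] by simp
  moreover have "loff c + lsc c * off w = 0" using Cons.prems by simp
  ultimately have "loff c = 0" "lsc c * off w = 0" using loff_nonneg[of c] by linarith+
  then have "loff c = 0" "off w = 0" using lsc_pos[of c] by auto
  then show ?case using Cons.IH by (cases c) auto
qed simp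

lemma lin_join: assumes "\<And>c. lin f (J \<odot> [c]) (J \<odot> [c])" shows "lin f J J"
  unfolding lin_def
proof
  fix t :: real assume "t \<in> {0..1}"
  then consider "0 \<le> t" "t \<le> 1/4" | "1/4 \<le> t" "t \<le> 3/4" | "3/4 \<le> t" "t \<le> 1" by fastforce
  then show "f (gam J t) = gam J t"
  proof cases
    case 1 then show ?thesis using linD[OF assms[of Lt], of "4 * t"] by (simp add: gam_ext)
  next
    case 2 then show ?thesis using linD[OF assms[of Md], of "2 * t - 1/2"] by (simp add: gam_ext algebra_simps)
  next
    case 3 then show ?thesis using linD[OF assms[of Rt], of "4 * t - 3"] by (simp add: gam_ext algebra_simps)
  qed
qed

lemma child_ends: "lft (J \<odot> [Lt]) = lft J" "rgt (J \<odot> [Rt]) = rgt J"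
  "rgt (J \<odot> [Lt]) = gam J (1/4)" "lft (J \<odot> [Md]) = gam J (1/4)"
  "rgt (J \<odot> [Md]) = gam J (3/4)" "lft (J \<odot> [Rt]) = gam J (3/4)"
  by (simp_all add: gam_ext)

lemma fixes_closed_part:
  assumes "g \<in> rearr" "g (lft J) = lft J" "g (rgt J) = rgt J" shows "g ` closed_part J = closed_part J"
  using rearr_closed_part[OF assms(1), of J] assms(2,3) by (simp add: ivl_address)

text \<open>Modulo \<open>S\<close>, the map \<open>g\<close> is the identity on \<open>J\<close>. Requiring the corrections to be supported in
\<open>J\<close> allows corrections in disjoint intervals to be combined.\<close>
definition straightens :: "(circle \<Rightarrow> circle) set \<Rightarrow> addr \<Rightarrow> (circle \<Rightarrow> circle) \<Rightarrow> bool" where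
  "straightens S J g \<longleftrightarrow> (\<exists>h\<in>S. \<exists>k\<in>S. supported h J \<and> supported k J \<and> lin (h \<circ> g \<circ> k) J J)"

context
  fixes S assumes S: "comp_group S" and rotS: "\<And>J. rot J \<in> S"
begin

lemma straightens_pre:
  assumes "straightens S J (g \<circ> f)" "f \<in> S" "supported f J" shows "straightens S J g"
proof -
  obtain h k where "h \<in> S" "k \<in> S" "supported h J" "supported k J" "lin (h \<circ> (g \<circ> f) \<circ> k) J J"
    using assms(1) unfolding straightens_def by blast
  then show ?thesis unfolding straightens_def
    using assms(2,3) comp_groupD(3)[OF S] supported_comp
    by (intro bexI[of _ h] bexI[of _ "f \<circ> k"]) (auto simp: comp_assoc)
qed

lemma straightens_post:
  assumes "straightens S J (f \<circ> g)" "f \<in> S" "supported f J" shows "straightens S J g"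
proof -
  obtain h k where "h \<in> S" "k \<in> S" "supported h J" "supported k J" "lin (h \<circ> (f \<circ> g) \<circ> k) J J"
    using assms(1) unfolding straightens_def by blast
  then show ?thesis unfolding straightens_def
    using assms(2,3) comp_groupD(3)[OF S] supported_comp
    by (intro bexI[of _ "h \<circ> f"] bexI[of _ k]) (auto simp: comp_assoc)
qed

text \<open>If \<open>g\<close> fixes the left part of \<open>J\<close>, it fixes one end of the primary arc, hence the other end.
So it maps the middle and the right part to themselves, and they can be straightened separately.\<close>
lemma straightens_children:
  assumes g: "g \<in> rearr" and L: "lin g (J \<odot> [Lt]) (J \<odot> [Lt])" and e: "g (rgt J) = rgt J"
    and m: "\<And>u. u \<in> leaves m \<Longrightarrow> \<exists>K. lin g (J \<odot> (Md # u)) K"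
    and r: "\<And>u. u \<in> leaves r \<Longrightarrow> \<exists>K. lin g (J \<odot> (Rt # u)) K"
    and IH: "\<And>I f t. t \<in> {m, r} \<Longrightarrow> f \<in> rearr \<Longrightarrow> f (lft I) = lft I \<Longrightarrow> f (rgt I) = rgt I
      \<Longrightarrow> (\<And>w. w \<in> leaves t \<Longrightarrow> \<exists>K. lin f (I \<odot> w) K) \<Longrightarrow> straightens S I f"
  shows "straightens S J g"
proof -
  let ?L = "J \<odot> [Lt]" and ?M = "J \<odot> [Md]" and ?R = "J \<odot> [Rt]"
  have inj: "inj g" using rearr_bij[OF g] by (rule bij_is_inj)
  \<comment> \<open>\<open>1/4\<close> and \<open>3/4\<close> are the two ends of the primary arc.\<close>
  have p: "g (gam J (1/4)) = gam J (1/4)" using linD[OF L, of 1] by (simp add: child_ends)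
  have "g ` arc_at J = arc_at J"
  proof (rule lamination_disjoint[OF rearr_arc[OF g] arc_in_lamination(1)])
    show mem: "gam J (1/4) \<in> arc_at J" by (simp add: arc_at_def)
    show "gam J (1/4) \<in> g ` arc_at J" using imageI[OF mem, of g] p by simp
  qed
  then have q: "g (gam J (3/4)) = gam J (3/4)"
    using p arc_at_ne[of J] injD[OF inj] unfolding arc_at_def by (auto simp: doubleton_eq_iff)
  have "straightens S ?M g"
    by (rule IH[of m]) (use g p q m in \<open>auto simp: child_ends\<close>)
  then obtain h k where h: "h \<in> S" "k \<in> S" "supported h ?M" "supported k ?M" "lin (h \<circ> g \<circ> k) ?M ?M"
    unfolding straightens_def by blast
  have fixM: "lin h L L" "lin k L L" if "\<not> comparable ?M L" for L
    using supported_lin that h by blast+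
  let ?g = "h \<circ> g \<circ> k"
  have g1: "?g \<in> rearr" using h(1,2) g comp_groupD(1)[OF S] rearr_comp by blast
  have MR: "\<not> comparable ?M ?R" "\<not> comparable ?M ?L" by simp_all
  have gR: "?g (lft ?R) = lft ?R" "?g (rgt ?R) = rgt ?R"
    using linD[OF fixM(1)[OF MR(1)], of 0] linD[OF fixM(2)[OF MR(1)], of 0]
      linD[OF fixM(1)[OF MR(1)], of 1] linD[OF fixM(2)[OF MR(1)], of 1] q e
    by (simp_all add: child_ends)
  have "straightens S ?R ?g"
  proof (rule IH[of r, OF _ g1 gR])
    fix u assume u: "u \<in> leaves r"
    then obtain K where K: "lin g (J \<odot> (Rt # u)) K" using r by blast
    have "g ` closed_part ?R = closed_part ?R" by (rule fixes_closed_part[OF g]) (use q e in \<open>simp_all add: child_ends\<close>)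
    moreover have "closed_part (J \<odot> (Rt # u)) \<subseteq> closed_part ?R" using closed_part_ext[of ?R u] by simp
    ultimately have "closed_part K \<subseteq> closed_part ?R" using lin_parts(1)[OF K] by blast
    then have "open_part ?M \<inter> open_part K = {}"
      using open_closed_disjoint[OF MR(1)] parts_incl(3)[of K] by blast
    then have "\<not> comparable ?M K" using comparable_open by blast
    then have "lin h K K" by (rule fixM(1))
    moreover have "lin k (J \<odot> (Rt # u)) (J \<odot> (Rt # u))" by (rule fixM(2)) simp
    ultimately have "lin ?g (J \<odot> (Rt # u)) K" using K lin_comp by blast
    then show "\<exists>K. lin ?g (?R \<odot> u) K" unfolding ext_assoc append.simps by blast
  qed simp
  then obtain h' k' where h': "h' \<in> S" "k' \<in> S" "supported h' ?R" "supported k' ?R" "lin (h' \<circ> ?g \<circ> k') ?R ?R"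
    unfolding straightens_def by blast
  have fixR: "lin h' L L" "lin k' L L" if "\<not> comparable ?R L" for L
    using supported_lin that h' by blast+
  have "lin (h' \<circ> ?g \<circ> k') (J \<odot> [c]) (J \<odot> [c])" for c
  proof (cases c)
    case Lt
    have "lin ?g ?L ?L" by (rule lin_comp[OF fixM(2)[OF MR(2)] lin_comp[OF L fixM(1)[OF MR(2)]]])
    from lin_comp[OF fixR(2) lin_comp[OF this fixR(1)]] show ?thesis unfolding Lt by simp
  next
    case Md
    from lin_comp[OF fixR(2) lin_comp[OF h(5) fixR(1)]] show ?thesis unfolding Md by simp
  next
    case Rt
    then show ?thesis using h'(5) by simp
  qed
  then have "lin (h' \<circ> ?g \<circ> k') J J" by (rule lin_join)
  then have "lin ((h' \<circ> h) \<circ> g \<circ> (k \<circ> k')) J J" by (simp add: comp_assoc)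
  moreover have "supported (h' \<circ> h) J" "supported (k \<circ> k') J"
    using h h' supported_mono supported_comp by blast+
  moreover have "h' \<circ> h \<in> S" "k \<circ> k' \<in> S" using h h' comp_groupD(3)[OF S] by blast+
  ultimately show ?thesis unfolding straightens_def by blast
qed

text \<open>The leftmost interval of the image of the subdivision is a repeated left part of \<open>J\<close>. Rotations at \<open>J\<close>
enlarge it until it is the left part itself. A rotation is affine on every proper part of \<open>J\<close> except the
left part, and that is not among the other image intervals, since it overlaps the leftmost one.\<close>
lemma straightens_left_comb:
  assumes g: "g \<in> rearr" "g (lft J) = lft J" "g (rgt J) = rgt J"
    and lv: "\<And>w. w \<in> leaves (Node Leaf m r) \<Longrightarrow> \<exists>K. lin g (J \<odot> w) K"
    and L: "lin g (J \<odot> [Lt]) (J \<odot> replicate (Suc k) Lt)"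
    and IH: "\<And>I f t. t \<in> {m, r} \<Longrightarrow> f \<in> rearr \<Longrightarrow> f (lft I) = lft I \<Longrightarrow> f (rgt I) = rgt I
      \<Longrightarrow> (\<And>w. w \<in> leaves t \<Longrightarrow> \<exists>K. lin f (I \<odot> w) K) \<Longrightarrow> straightens S I f"
  shows "straightens S J g"
  using g lv L
proof (induction k arbitrary: g)
  case 0
  show ?case
    by (rule straightens_children[of g J m r]) (use 0 IH in auto)
next
  case (Suc k)
  let ?K = "J \<odot> replicate (Suc (Suc k)) Lt"
  have inj: "inj g" using rearr_bij[OF Suc.prems(1)] by (rule bij_is_inj)
  have L': "lin (rot J \<circ> g) (J \<odot> [Lt]) (J \<odot> replicate (Suc k) Lt)"
    using lin_comp[OF Suc.prems(5)] rot_lin(1)[of J "replicate k Lt"] by simp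
  have "straightens S J (rot J \<circ> g)"
  proof (rule Suc.IH[OF _ _ _ _ L'])
    show "rot J \<circ> g \<in> rearr" using rot_rearr Suc.prems(1) rearr_comp by blast
    show "(rot J \<circ> g) (lft J) = lft J" "(rot J \<circ> g) (rgt J) = rgt J"
      using Suc.prems(2,3) supported_ends[OF supported_rot[of J]] by simp_all
    fix w assume w: "w \<in> leaves (Node Leaf m r)"
    show "\<exists>K. lin (rot J \<circ> g) (J \<odot> w) K"
    proof (cases "w = [Lt]")
      case True then show ?thesis using L' by blast
    next
      case False
      then have inc: "\<not> comparable (J \<odot> w) (J \<odot> [Lt])"
        using w leaf_prefix_unique[of "[Lt]" "Node Leaf m r" w] leaf_prefix_unique[of w "Node Leaf m r" "[Lt]"]
        unfolding comparable_ext_cancel by auto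
      obtain K where K: "lin g (J \<odot> w) K" using Suc.prems(4) w by blast
      have "g ` open_part (J \<odot> w) \<inter> g ` open_part (J \<odot> [Lt]) = {}"
        using open_closed_disjoint[OF inc] parts_incl(3) inj by (blast dest: injD)
      then have disj: "open_part K \<inter> open_part ?K = {}"
        using lin_parts(3)[OF K] lin_parts(3)[OF Suc.prems(5)] by simp
      have "closed_part K \<subseteq> closed_part J"
        using fixes_closed_part[OF Suc.prems(1-3)] lin_parts(1)[OF K] closed_part_ext[of J w] by blast
      then have "comparable J K" by (rule subset_comparable)
      then obtain v where v: "K = J \<odot> v \<or> J = K \<odot> v" unfolding comparable_def by blast
      have nc: "\<not> comparable K ?K" using disj comparable_open by blast
      have "K = J \<odot> v"
        using v nc comparable_ext(1)[of K] by (metis ext_assoc)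
      moreover have "v \<noteq> []" using \<open>K = J \<odot> v\<close> nc by auto
      moreover have "v \<noteq> [Lt]" using \<open>K = J \<odot> v\<close> nc by auto
      ultimately obtain v' where "lin (rot J) K (J \<odot> v')" using rot_lin_ex by blast
      then show ?thesis using K lin_comp by blast
    qed
  qed
  then show ?case using straightens_post rotS supported_rot by blast
qed

text \<open>If the left part of \<open>J\<close> is subdivided in \<open>t\<close>, then a rotation before \<open>g\<close> makes the left subtree smaller
and keeps the size of the whole tree. Otherwise the left part is a leaf, and the problem splits into the smaller
trees of the middle and the right part. This explains the lexicographic measure.\<close>
lemma straightens_tree:
  assumes "g \<in> rearr" "g (lft J) = lft J" "g (rgt J) = rgt J"
    and "\<And>w. w \<in> leaves t \<Longrightarrow> \<exists>K. lin g (J \<odot> w) K"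
  shows "straightens S J g"
  using assms
proof (induction t arbitrary: J g
    rule: wf_induct_rule[OF wf_measures[of "[size, \<lambda>t. case t of Leaf \<Rightarrow> 0 | Node a b c \<Rightarrow> size a]"]])
  case (1 t)
  note IH = 1(1) and g = 1(2-4) and lv = 1(5)
  consider "t = Leaf" | a b c d e where "t = Node (Node a b c) d e" | m r where "t = Node Leaf m r"
    by (metis tree.exhaust)
  then show ?case
  proof cases
    case 1
    then obtain K where K: "lin g J K" using lv[of "[]"] by auto
    then have "J = K" using linD[OF K, of 0] linD[OF K, of 1] g(2,3) by (intro gam_determines) auto
    then show ?thesis unfolding straightens_def
      using K comp_groupD(2)[OF S] supported_id by (intro bexI[of _ id]) auto
  next
    case 2
    let ?t = "Node a b (Node c d e)"
    let ?f = "inverse_map (rot J)"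
    have f: "?f \<in> S" "supported ?f J"
      using comp_groupD(4)[OF S rotS] supported_inv[OF rot_bij supported_rot] by blast+
    have "straightens S J (g \<circ> ?f)"
    proof (rule IH[of ?t])
      show "(?t, t) \<in> measures [size, \<lambda>t. case t of Leaf \<Rightarrow> 0 | Node a b c \<Rightarrow> size a]"
        by (simp add: 2)
      show "g \<circ> ?f \<in> rearr" using f(1) g(1) comp_groupD(1)[OF S] rearr_comp by blast
      show "(g \<circ> ?f) (lft J) = lft J" "(g \<circ> ?f) (rgt J) = rgt J"
        using supported_ends[OF f(2)] g(2,3) by simp_all
      fix w assume "w \<in> leaves ?t"
      then have "\<exists>u\<in>leaves t. lin (rot J) (J \<odot> u) (J \<odot> w)"
        unfolding 2 leaves.simps using rot_lin[of J]
        by (elim UnE imageE; simp only: ball_simps; blast)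
      then obtain u where u: "u \<in> leaves t" "lin (rot J) (J \<odot> u) (J \<odot> w)" by blast
      then obtain K where "lin g (J \<odot> u) K" using lv by blast
      then show "\<exists>K. lin (g \<circ> ?f) (J \<odot> w) K" using lin_comp[OF lin_inv[OF rot_bij u(2)]] by blast
    qed
    then show ?thesis using straightens_pre f by blast
  next
    case 3
    obtain K where K: "lin g (J \<odot> [Lt]) K" using lv[of "[Lt]"] 3 by auto
    have lft: "lft K = lft J" using linD[OF K, of 0] g(2) by (simp add: child_ends)
    have "comparable J K"
      using half_part_disjoint[of J K] gam_mem(2)[of 0 J] gam_mem(2)[of 0 K] lft by auto
    moreover have "\<not> (\<exists>v. J = K \<odot> v)"
    proof
      assume "\<exists>v. J = K \<odot> v"
      then have "closed_part J \<subseteq> g ` closed_part (J \<odot> [Lt])"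
        using closed_part_ext lin_parts(1)[OF K] by blast
      then have "g (rgt J) \<in> g ` closed_part (J \<odot> [Lt])" using g(3) gam_mem(1)[of 1 J] by auto
      then have "rgt J \<in> closed_part (J \<odot> [Lt])"
        using bij_is_inj[OF rearr_bij[OF g(1)]] by (simp add: inj_image_mem_iff)
      then obtain s where s: "gam J 1 = gam J (s / 4)" "0 \<le> s" "s \<le> 1"
        by (auto simp: closed_part_def gam_ext)
      then have "1 = s / 4" by (intro gam_inj[OF s(1)]) auto
      then show False using s by simp
    qed
    ultimately obtain w where w: "K = J \<odot> w" unfolding comparable_def by blast
    have "w \<noteq> []" using w \<open>\<not> (\<exists>v. J = K \<odot> v)\<close> by (metis ext_Nil)
    have e: "gam J (off w) = gam J 0" using lft unfolding w gam_ext by simp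
    have "off w = 0" by (rule gam_inj[OF e]) (use unit_bounds[of 0 w] in auto)
    then have "w = replicate (length w) Lt" by (rule off_eq_0)
    then have L: "lin g (J \<odot> [Lt]) (J \<odot> replicate (Suc (length w - 1)) Lt)"
      using K w \<open>w \<noteq> []\<close> by (metis Suc_diff_1 length_greater_0_conv)
    show ?thesis
    proof (rule straightens_left_comb[OF g _ L])
      fix w assume "w \<in> leaves (Node Leaf m r)"
      then show "\<exists>K. lin g (J \<odot> w) K" using lv 3 by blast
    next
      fix I f s assume s: "s \<in> {m, r}" "f \<in> rearr" "f (lft I) = lft I" "f (rgt I) = rgt I"
        "\<And>w. w \<in> leaves s \<Longrightarrow> \<exists>K. lin f (I \<odot> w) K"
      show "straightens S I f"
        by (rule IH[of s]) (use s 3 in auto)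
    qed
  qed
qed

text \<open>A rearrangement that fixes one root interval pointwise fixes the ends of the other one, and
straightening it there makes it the identity.\<close>
lemma stabilizer_subset:
  assumes "g \<in> rearr" "lin g (False, []) (False, [])" shows "g \<in> S"
proof -
  let ?B = "(True, []) :: addr"
  obtain n where n: "\<And>J. n \<le> depth J \<Longrightarrow> \<exists>K. lin g J K" using assms(1) unfolding rearr_def by blast
  have "straightens S ?B g"
  proof (rule straightens_tree[OF assms(1), where t = "full n"])
    show "g (lft ?B) = lft ?B" using linD[OF assms(2), of 1] root_rgt[of False] by simp
    show "g (rgt ?B) = rgt ?B" using linD[OF assms(2), of 0] root_rgt[of True] by simp
    fix w assume "w \<in> leaves (full n)"
    then show "\<exists>K. lin g (?B \<odot> w) K" by (intro n) (simp add: leaves_full)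
  qed
  then obtain h k where h: "h \<in> S" "k \<in> S" "supported h ?B" "supported k ?B" "lin (h \<circ> g \<circ> k) ?B ?B"
    unfolding straightens_def by blast
  have nc: "\<not> comparable ?B (False, [])" by (simp add: comparable_def ext_def)
  have A: "lin (h \<circ> g \<circ> k) (False, []) (False, [])"
    using lin_comp[OF supported_lin[OF h(4) nc] lin_comp[OF assms(2) supported_lin[OF h(3) nc]]] .
  have "h \<circ> g \<circ> k = id"
  proof (rule eq_by_forest[where F = "\<lambda>_. Leaf"])
    fix J assume "J \<in> forest_leaves (\<lambda>_. Leaf)"
    then have "J = ?B \<or> J = (False, [])" by (cases J) (auto simp: forest_leaves_def)
    then have "lin (h \<circ> g \<circ> k) J J" using A h(5) by blast
    then show "\<exists>K. lin (h \<circ> g \<circ> k) J K \<and> lin id J K" using lin_id by blast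
  qed
  then have "inverse_map h \<circ> (h \<circ> g \<circ> k) \<circ> inverse_map k = inverse_map h \<circ> inverse_map k" by simp
  moreover have "inverse_map h \<circ> (h \<circ> g \<circ> k) \<circ> inverse_map k
    = (inverse_map h \<circ> h) \<circ> g \<circ> (k \<circ> inverse_map k)" by (simp only: comp_assoc)
  ultimately have "g = inverse_map h \<circ> inverse_map k"
    using inv_comp_cancel[OF comp_groupD(5)[OF S h(1)]] inv_comp_cancel[OF comp_groupD(5)[OF S h(2)]] by simp
  then show ?thesis using h comp_groupD(3,4)[OF S] by blast
qed

end


section \<open>Normal subgroups\<close>

lemma inverse_map_simps [simp]:
  "bij f \<Longrightarrow> inverse_map f (f y) = y" "bij f \<Longrightarrow> f (inverse_map f y) = y"
  by (simp_all add: bij_is_inj bij_is_surj surj_f_inv_f)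

lemma inverse_map_involution: "f \<circ> f = id \<Longrightarrow> inverse_map f = f"
  by (metis inv_unique_comp)

lemma inverse_map_comp: "bij f \<Longrightarrow> bij g \<Longrightarrow> inverse_map (f \<circ> g) = inverse_map g \<circ> inverse_map f"
  by (rule o_inv_distrib)

definition normalized_by :: "(circle \<Rightarrow> circle) set \<Rightarrow> (circle \<Rightarrow> circle) set \<Rightarrow> bool" where
  "normalized_by N S \<longleftrightarrow> comp_group N \<and> (\<forall>s\<in>S. \<forall>n\<in>N. s \<circ> n \<circ> inverse_map s \<in> N)"

lemma rot_conj': assumes "bij g" "lin g I K" shows "rot K = g \<circ> rot I \<circ> inverse_map g"
  using rot_conj[OF assms] inv_comp_cancel(2)[OF assms(1)] by (metis comp_assoc comp_id)

text \<open>The pentagon relation, solved for one of the two factors on its left-hand side.\<close>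
lemma rot_from_sides:
  "rot J = rot (J \<odot> [Rt]) \<circ> (rot J \<circ> rot (J \<odot> [Lt]) \<circ> inverse_map (rot J))"
proof -
  have "rot J = rot J \<circ> rot J \<circ> inverse_map (rot J)" using rot_bij[of J] by (simp add: fun_eq_iff)
  then show ?thesis unfolding rot_pentagon[of J] by (simp only: comp_assoc)
qed

text \<open>The pentagon relation at the right part \<open>R\<close> of \<open>J\<close> expresses the rotation at the left part of \<open>R\<close>
by those at \<open>R\<close> and at the right part of \<open>R\<close>; the latter is conjugate to the rotation at \<open>R\<close> by \<open>rot J\<close>.\<close>
lemma rot_commutator:
  fixes J
  defines "a \<equiv> rot J" and "b \<equiv> inverse_map (rot (J \<odot> [Rt]))"
  shows "rot (J \<odot> [Rt, Lt]) = b \<circ> (a \<circ> b \<circ> inverse_map a \<circ> inverse_map b) \<circ> inverse_map b"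
proof
  fix y
  let ?R = "rot (J \<odot> [Rt])" and ?RR = "rot (J \<odot> [Rt, Rt])" and ?RL = "rot (J \<odot> [Rt, Lt])"
  have bb: "inverse_map b = ?R" unfolding b_def using rot_bij by (rule inv_inv_eq)
  have conj: "rot J (?R z) = ?RR (rot J z)" for z
    using rot_conj[OF rot_bij rot_lin(5)[of J "[]"]] by (simp add: fun_eq_iff)
  have pent: "?R (?R z) = ?RR (?R (?RL z))" for z
    using rot_pentagon[of "J \<odot> [Rt]"] by (simp add: fun_eq_iff)
  define u where "u = inverse_map (rot J) (?R (?RL y))"
  have u: "rot J u = ?R (?RL y)" unfolding u_def using rot_bij by simp
  have "?R (?R y) = rot J (?R u)" using pent[of y] conj[of u] u by simp
  then have "inverse_map (rot J) (?R (?R y)) = ?R u" using rot_bij by simp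
  then show "?RL y = (b \<circ> (a \<circ> b \<circ> inverse_map a \<circ> inverse_map b) \<circ> inverse_map b) y"
    unfolding bb unfolding a_def b_def using u rot_bij \<open>inverse_map (rot J) (?R (?R y)) = ?R u\<close> by simp
qed

context even_overgroup
begin

lemma normalized_linked:
  assumes N: "normalized_by N S" and l: "linked S I K" and "rot I \<in> N"
  shows "rot K \<in> N"
proof -
  obtain h where h: "h \<in> S" "lin h I K" using l unfolding linked_def by blast
  then show ?thesis
    using rot_conj'[OF comp_groupD(5)[OF comp_group h(1)] h(2)] N assms(3)
    unfolding normalized_by_def by simp
qed

text \<open>By transitivity \<open>N\<close> contains all rotations at left and right parts, and these produce the rotation
at any interval.\<close>
lemma all_rot_mem:
  assumes N: "normalized_by N S" and sides: "\<And>r. rot (r, [Lt]) \<in> N"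
  shows "rot J \<in> N"
proof -
  have *: "rot (J \<odot> [c]) \<in> N" if "c \<noteq> Md" for c
  proof -
    obtain r w where J: "J = (r, w)" by (cases J)
    have "linked S (colour r w, [Lt]) (J \<odot> [c])"
      using sym[OF linked_colour[OF that]] by (simp add: J)
    then show ?thesis using normalized_linked[OF N] sides by blast
  qed
  have "rot J \<circ> rot (J \<odot> [Lt]) \<circ> inverse_map (rot J) \<in> N"
    using N rot_mem *[of Lt] unfolding normalized_by_def by simp
  then have "rot (J \<odot> [Rt]) \<circ> (rot J \<circ> rot (J \<odot> [Lt]) \<circ> inverse_map (rot J)) \<in> N"
    using N *[of Rt] comp_groupD(3)[of N] unfolding normalized_by_def by blast
  then show ?thesis by (simp only: rot_from_sides[symmetric])
qed

text \<open>With \<open>b\<close> the rotation at the root \<open>True\<close> and \<open>h\<close> the half turn, \<open>(b h)\<^sup>3 = 1\<close> gives \<open>h = b (h b h) b\<close>,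
and the right-hand side consists of conjugates of rotations. Conjugation by \<open>flip\<close> gives the other
half turn.\<close>
lemma half_turns_mem:
  assumes N: "normalized_by N S" and rotN: "\<And>J. rot J \<in> N"
  shows "half_turn \<in> N" "flip \<circ> half_turn \<circ> flip \<in> N"
proof -
  have cl: "f \<circ> g \<in> N" if "f \<in> N" "g \<in> N" for f g
    using N comp_groupD(3) that unfolding normalized_by_def by blast
  have conj: "s \<circ> n \<circ> s \<in> N" if "s \<in> S" "n \<in> N" "s \<circ> s = id" for s n
    using N that inverse_map_involution[OF that(3)] unfolding normalized_by_def by metis
  let ?B = "rot (True, [])" and ?h = "flip \<circ> half_turn \<circ> flip"
  have hh: "half_turn (half_turn y) = y" "flip (flip y) = y" for y
    using half_turn_half_turn flip_flip by (simp_all add: fun_eq_iff)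
  have id3: "?B (half_turn (?B (half_turn (?B (half_turn y))))) = y" for y
    using half_turn_rot by (simp add: fun_eq_iff)
  have e: "half_turn = ?B \<circ> (half_turn \<circ> ?B \<circ> half_turn) \<circ> ?B"
  proof
    fix y show "half_turn y = (?B \<circ> (half_turn \<circ> ?B \<circ> half_turn) \<circ> ?B) y"
      using id3[of "half_turn y"] by (simp add: hh)
  qed
  have "?B \<circ> (half_turn \<circ> ?B \<circ> half_turn) \<circ> ?B \<in> N"
    by (intro cl rotN conj half_turn_mem half_turn_half_turn)
  then show "half_turn \<in> N" using e by simp
  have A: "?B y = flip (rot (False, []) (flip y))" for y
    using fun_cong[OF rot_conj[OF rearr_bij[OF flip_rearr] flip_lin[of True "[]"]], of y] hh(2)
    by (metis comp_apply not_True_eq_False)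
  have "?h = rot (False, []) \<circ> (?h \<circ> rot (False, []) \<circ> ?h) \<circ> rot (False, [])"
  proof
    fix y
    have "?h y = flip (?B (half_turn (?B (half_turn (?B (flip y))))))"
      using fun_cong[OF e, of "flip y"] by simp
    also have "\<dots> = (rot (False, []) \<circ> (?h \<circ> rot (False, []) \<circ> ?h) \<circ> rot (False, [])) y"
      by (simp add: A hh)
    finally show "?h y = (rot (False, []) \<circ> (?h \<circ> rot (False, []) \<circ> ?h) \<circ> rot (False, [])) y" .
  qed
  moreover have "?h \<circ> ?h = id" by (simp add: fun_eq_iff hh)
  then have "rot (False, []) \<circ> (?h \<circ> rot (False, []) \<circ> ?h) \<circ> rot (False, []) \<in> N"
    by (intro cl rotN conj flipped_half_turn_mem)
  ultimately show "?h \<in> N" by simp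
qed

end

text \<open>If the image of an interval is comparable but different, say \<open>J\<close> goes to \<open>J\<close> extended by a nonempty word, then a part of
\<open>J\<close> that this word does not enter is moved off itself.\<close>
lemma moves_some_interval:
  assumes "n \<in> rearr" "n \<noteq> id"
  obtains U U' where "lin n U U'" "\<not> comparable U U'"
proof (rule ccontr)
  assume "\<not> thesis"
  then have c: "comparable U U'" if "lin n U U'" for U U' using that that[THEN \<open>\<And>U U'. lin n U U' \<Longrightarrow> \<not> comparable U U' \<Longrightarrow> thesis\<close>] by blast
  obtain m where m: "\<And>J. m \<le> depth J \<Longrightarrow> \<exists>K. lin n J K" using assms(1) unfolding rearr_def by blast
  have other: "\<exists>d. d \<noteq> c" for c :: letter by (cases c) auto
  have "lin n J J" if J: "m \<le> depth J" for J
  proof -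
    obtain K where K: "lin n J K" using m J by blast
    have ext: "comparable (J \<odot> [d]) (K \<odot> [d])" for d using c lin_ext[OF K] by blast
    have "J = K"
      using c[OF K] unfolding comparable_def
    proof (elim disjE exE)
      fix v assume v: "K = J \<odot> v"
      show ?thesis
      proof (cases v)
        case (Cons x v')
        obtain d where "d \<noteq> x" using other by blast
        then show ?thesis using ext[of d] v Cons by simp
      qed (use v in simp)
    next
      fix v assume v: "J = K \<odot> v"
      show ?thesis
      proof (cases v)
        case (Cons x v')
        obtain d where "d \<noteq> x" using other by blast
        then show ?thesis using ext[of d] v Cons by simp
      qed (use v in simp)
    qed
    then show ?thesis using K by simp
  qed
  then have fixed: "lin n J J" if "m \<le> depth J" for J using that by blast
  have "n = id"
  proof (rule eq_by_forest[where F = "\<lambda>_. full m"])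
    fix J assume "J \<in> forest_leaves (\<lambda>_. full m)"
    then have "lin n J J" by (intro fixed) (simp add: forest_leaves_full)
    then show "\<exists>K. lin n J K \<and> lin id J K" using lin_id by blast
  qed
  then show False using assms(2) by blast
qed

context even_overgroup
begin

text \<open>Let \<open>a = rot J\<close> and let \<open>b\<close> be the inverse of the rotation at the right part of \<open>J\<close>. The commutator
\<open>c = a (n a\<inverse> n\<inverse>)\<close> is in \<open>N\<close>. Its second factor is supported in the image of \<open>J\<close> under \<open>n\<close>, so it
commutes with \<open>b\<close> and cancels in the commutator of \<open>c\<close> and \<open>b\<close>. Hence the commutator of \<open>a\<close> and \<open>b\<close> is
in \<open>N\<close>, and \<open>rot_commutator\<close> applies.\<close>
lemma double_commutator:
  assumes N: "normalized_by N S" and n: "n \<in> N" and nJ: "lin n J J'" and nc: "\<not> comparable J J'"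
  shows "rot (J \<odot> [Rt, Lt]) \<in> N"
proof -
  let ?a = "rot J" and ?b = "inverse_map (rot (J \<odot> [Rt]))" and ?a' = "rot J'"
  have Ng: "comp_group N" and Nn: "s \<circ> x \<circ> inverse_map s \<in> N" if "s \<in> S" "x \<in> N" for s x
    using N that unfolding normalized_by_def by blast+
  have Ng: "comp_group N" using N unfolding normalized_by_def by blast
  have bij: "bij n" using comp_groupD(5)[OF Ng n] .
  have S: "?a \<in> S" "?b \<in> S" "inverse_map ?b \<in> S"
    using rot_mem comp_groupD(4)[OF comp_group] by blast+
  have bb: "inverse_map ?b = rot (J \<odot> [Rt])" using rot_bij by (rule inv_inv_eq)
  let ?c = "?a \<circ> n \<circ> inverse_map ?a \<circ> inverse_map n"
  have c: "?c \<in> N" using Nn[OF S(1) n] comp_groupD(3,4)[OF Ng] n by blast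
  have a': "?a' y = n (?a (inverse_map n y))" for y
    using rot_conj'[OF bij nJ] by (simp add: fun_eq_iff)
  have c_inv: "inverse_map ?c = ?a' \<circ> inverse_map ?a"
    unfolding rot_conj'[OF bij nJ]
    using bij rot_bij[of J] by (simp add: inverse_map_comp bij_comp bij_imp_bij_inv inv_inv_eq comp_assoc)
  have "\<not> comparable (J \<odot> [Rt]) J'" using nc comparable_extD by blast
  then have "lin ?b J' J'" by (intro lin_inv rot_bij rot_fixes)
  then have comm: "?b (?a' y) = ?a' (?b y)" for y
    using rot_conj[of ?b J' J'] bij_imp_bij_inv[OF rot_bij] by (simp add: fun_eq_iff)
  have "?c (?b (inverse_map ?c (inverse_map ?b y))) = ?a (?b (inverse_map ?a (inverse_map ?b y)))" for y
  proof -
    have "inverse_map ?a (inverse_map n (?a' z)) = inverse_map n z" for z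
      using bij rot_bij[of J] by (simp add: a')
    then have "?c (?a' z) = ?a z" for z using bij by simp
    then show ?thesis unfolding c_inv by (simp add: comm)
  qed
  then have "?c \<circ> (?b \<circ> inverse_map ?c \<circ> inverse_map ?b) = ?a \<circ> ?b \<circ> inverse_map ?a \<circ> inverse_map ?b"
    by (simp add: fun_eq_iff)
  moreover have "?c \<circ> (?b \<circ> inverse_map ?c \<circ> inverse_map ?b) \<in> N"
    using c Nn[OF S(2)] comp_groupD(3,4)[OF Ng] by blast
  ultimately have "?a \<circ> ?b \<circ> inverse_map ?a \<circ> inverse_map ?b \<in> N" by simp
  from Nn[OF S(2) this] show ?thesis using rot_commutator[of J] by simp
qed

text \<open>The intervals inside \<open>U\<close> and inside its middle part border regions of different colours, so the
double commutators in both of them reach both orbits.\<close>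
lemma normalized_contains_generators:
  assumes N: "normalized_by N S" and "n \<in> N" "n \<noteq> id"
  shows "rot J \<in> N" "half_turn \<in> N" "flip \<circ> half_turn \<circ> flip \<in> N"
proof -
  have "n \<in> rearr" using assms comp_groupD(1) unfolding normalized_by_def by blast
  then obtain U U' where U: "lin n U U'" "\<not> comparable U U'" using moves_some_interval assms(3) by blast
  obtain r w where rw: "U = (r, w)" by (cases U)
  have "rot (U \<odot> [Rt, Lt]) \<in> N" by (rule double_commutator[OF N assms(2) U])
  then have 1: "rot (colour r (w @ [Rt]), [Lt]) \<in> N"
    using normalized_linked[OF N] linked_colour[of Lt r "w @ [Rt]"] by (simp add: rw)
  have "\<not> comparable (U \<odot> [Md]) (U' \<odot> [Md])" using U(2) comparable_extD comparable_sym by blast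
  then have "rot (U \<odot> [Md] \<odot> [Rt, Lt]) \<in> N" by (rule double_commutator[OF N assms(2) lin_ext[OF U(1)]])
  then have 2: "rot (colour r (w @ [Md, Rt]), [Lt]) \<in> N"
    using normalized_linked[OF N] linked_colour[of Lt r "w @ [Md, Rt]"] by (simp add: rw)
  have "colour r (w @ [Md, Rt]) = (\<not> colour r (w @ [Rt]))" by (simp add: colour_def)
  then have "rot (r', [Lt]) \<in> N" for r' using 1 2 by (cases "r' = colour r (w @ [Rt])") auto
  then have rotN: "rot J \<in> N" for J by (rule all_rot_mem[OF N])
  then show "rot J \<in> N" by blast
  show "half_turn \<in> N" "flip \<circ> half_turn \<circ> flip \<in> N" using half_turns_mem[OF N rotN] by blast+
qed

end

section \<open>The commutator subgroup and its simplicity\<close>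

lemma T_B_simps: "carrier T_B = rearr" "mult T_B f g = f \<circ> g" "one T_B = id"
  by (simp_all add: T_B_def rearrangements_eq)

lemma T_B_group: "group T_B"
proof (rule groupI)
  fix f assume "f \<in> carrier T_B"
  then show "\<exists>g\<in>carrier T_B. g \<otimes>\<^bsub>T_B\<^esub> f = \<one>\<^bsub>T_B\<^esub>"
    unfolding T_B_simps using rearr_inv rearr_bij inv_comp_cancel(1) by blast
qed (simp_all add: T_B_simps rearr_comp rearr_id comp_assoc)

lemma T_B_inv: "f \<in> rearr \<Longrightarrow> m_inv T_B f = inverse_map f"
  by (rule group.inv_equality[OF T_B_group]) (simp_all add: T_B_simps rearr_inv inv_comp_cancel rearr_bij)

lemma subgroup_comp_group: "subgroup H T_B \<Longrightarrow> comp_group H"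
proof -
  assume H: "subgroup H T_B"
  have sub: "H \<subseteq> rearr" using subgroup.subset[OF H] by (simp add: T_B_simps)
  then show "comp_group H"
    unfolding comp_group_def
    using subgroup.one_closed[OF H] subgroup.m_closed[OF H] subgroup.m_inv_closed[OF H] T_B_inv
    by (auto simp: T_B_simps) (metis subsetD)
qed

definition even_generators :: "(circle \<Rightarrow> circle) set" where
  "even_generators = insert half_turn (insert (flip \<circ> half_turn \<circ> flip) (range rot))"

definition even_rearr :: "(circle \<Rightarrow> circle) set" where
  "even_rearr = generate T_B even_generators"

lemma even_generators_rearr: "even_generators \<subseteq> rearr"
  unfolding even_generators_def using half_turn_rearr rot_rearr flip_rearr rearr_comp by blast

lemma even_subgroup: "subgroup even_rearr T_B"
  unfolding even_rearr_def
  by (rule group.generate_is_subgroup[OF T_B_group]) (simp add: T_B_simps even_generators_rearr)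

lemma even_minimal: "subgroup H T_B \<Longrightarrow> even_generators \<subseteq> H \<Longrightarrow> even_rearr \<subseteq> H"
  unfolding even_rearr_def by (rule group.generate_subgroup_incl[OF T_B_group])

lemma even_comp_group: "comp_group even_rearr"
  by (rule subgroup_comp_group[OF even_subgroup])

lemma even_overgroupI: "comp_group S \<Longrightarrow> even_generators \<subseteq> S \<Longrightarrow> even_overgroup S"
  by unfold_locales (auto simp: even_generators_def)

lemma even_even_overgroup: "even_overgroup even_rearr"
  by (rule even_overgroupI[OF even_comp_group]) (auto simp: even_rearr_def intro: generate.incl)

lemma flip_flip_apply: "flip (flip y) = y"
  using flip_flip by (simp add: fun_eq_iff)

text \<open>Conjugation by \<open>flip\<close> permutes the generators.\<close>
lemma flip_even_flip: "f \<in> even_rearr \<Longrightarrow> flip \<circ> f \<circ> flip \<in> even_rearr"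
  unfolding even_rearr_def
proof (induction rule: generate.induct)
  case one
  have "flip \<circ> id \<circ> flip = id" using flip_flip by simp
  then show ?case using generate.one[of T_B even_generators] by (simp only: T_B_simps)
next
  have gen: "flip \<circ> h \<circ> flip \<in> even_generators" if "h \<in> even_generators" for h
  proof -
    have "flip \<circ> rot J \<circ> flip \<in> range rot" for J
    proof -
      have "rot (\<not> fst J, snd J) = flip \<circ> rot J \<circ> inverse_map flip"
        using rot_conj'[OF rearr_bij[OF flip_rearr] flip_lin[of "fst J" "snd J"]] by simp
      then show ?thesis using inverse_map_involution[OF flip_flip] by (metis rangeI)
    qed
    moreover have "flip \<circ> (flip \<circ> half_turn \<circ> flip) \<circ> flip = half_turn"
      by (simp add: fun_eq_iff flip_flip_apply)
    ultimately show ?thesis using that unfolding even_generators_def by auto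
  qed
  {
    case (incl h)
    then show ?case using gen generate.incl by metis
  next
    case (inv h)
    have h: "h \<in> rearr" using inv even_generators_rearr by blast
    have "m_inv T_B (flip \<circ> h \<circ> flip) = flip \<circ> m_inv T_B h \<circ> flip"
      using h flip_rearr rearr_comp rearr_bij[OF h] rearr_bij[OF flip_rearr] inverse_map_involution[OF flip_flip]
      by (simp add: T_B_inv inverse_map_comp bij_comp comp_assoc)
    then show ?case using gen[OF inv] generate.inv by metis
  next
    case (eng h k)
    have "flip \<circ> (h \<circ> k) \<circ> flip = (flip \<circ> h \<circ> flip) \<circ> (flip \<circ> k \<circ> flip)"
      by (simp add: fun_eq_iff flip_flip_apply)
    moreover have "(flip \<circ> h \<circ> flip) \<circ> (flip \<circ> k \<circ> flip) \<in> generate T_B even_generators"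
      using generate.eng[OF eng.IH] by (simp only: T_B_simps)
    ultimately show ?case by (simp only: T_B_simps)
  }
qed

text \<open>Take a small interval under an arc on which \<open>g\<close> is affine. It and its image are taken to roots by even
elements. After composition with \<open>flip\<close> on either side if necessary, the resulting map fixes the root \<open>False\<close>
pointwise and is even by \<open>stabilizer_subset\<close>.\<close>
lemma even_or_odd:
  assumes "g \<in> rearr" shows "g \<in> even_rearr \<or> flip \<circ> g \<in> even_rearr"
proof -
  interpret even_overgroup even_rearr by (rule even_even_overgroup)
  note E = comp_groupD[OF even_comp_group]
  obtain n where n: "\<And>J. n \<le> depth J \<Longrightarrow> \<exists>K. lin g J K" using assms unfolding rearr_def by blast
  let ?J = "(True, replicate n Lt) :: addr"
  obtain K where K: "lin g (?J \<odot> [Md]) (K \<odot> [Md])" using n[of ?J] lin_ext by (metis le_refl length_replicate snd_conv)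
  obtain r where r: "linked even_rearr (?J \<odot> [Md]) (r, [])" using linked_root[of True "replicate n Lt"] by auto
  obtain r' where r': "linked even_rearr (K \<odot> [Md]) (r', [])" using linked_root[of "fst K" "snd K"] by (auto simp: ext_def)
  obtain k where k: "k \<in> even_rearr" "lin k (r, []) (?J \<odot> [Md])"
    using sym[OF r] unfolding linked_def by blast
  obtain h where h: "h \<in> even_rearr" "lin h (K \<odot> [Md]) (r', [])"
    using r' unfolding linked_def by blast
  let ?f = "h \<circ> g \<circ> k"
  have f: "lin ?f (r, []) (r', [])" using lin_comp[OF k(2) lin_comp[OF K h(2)]] by (simp add: comp_assoc)
  have fr: "?f \<in> rearr" using h(1) k(1) E(1) assms rearr_comp by blast
  have g: "g = inverse_map h \<circ> ?f \<circ> inverse_map k"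
    using E(5)[OF h(1)] E(5)[OF k(1)] by (simp add: fun_eq_iff)
  have stab: "s \<in> even_rearr" if "s \<in> rearr" "lin s (False, []) (False, [])" for s
    using stabilizer_subset[OF even_comp_group rot_mem that] .
  have fF: "lin flip (x, []) (\<not> x, [])" for x by (rule flip_lin)
  have evenf: "?f \<in> even_rearr \<Longrightarrow> g \<in> even_rearr"
    using g h(1) k(1) E(3,4) by metis
  have oddf: "flip \<circ> ?f \<in> even_rearr \<Longrightarrow> flip \<circ> g \<in> even_rearr"
  proof -
    assume o: "flip \<circ> ?f \<in> even_rearr"
    have "flip \<circ> g = (flip \<circ> inverse_map h \<circ> flip) \<circ> (flip \<circ> ?f) \<circ> inverse_map k"
      by (subst g) (simp add: fun_eq_iff flip_flip_apply)
    then show ?thesis using o flip_even_flip[OF E(4)[OF h(1)]] E(3) E(4)[OF k(1)] by metis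
  qed
  show ?thesis
  proof (cases r; cases r')
    assume "\<not> r" "\<not> r'"
    then show ?thesis using stab[OF fr] f evenf by simp
  next
    assume "\<not> r" "r'"
    then have "lin (flip \<circ> ?f) (False, []) (False, [])" using lin_comp[OF f fF[of r']] by simp
    then show ?thesis using stab rearr_comp[OF fr flip_rearr] oddf by blast
  next
    assume "r" "\<not> r'"
    then have "lin (?f \<circ> flip) (False, []) (False, [])" using lin_comp[OF fF[of False]] f by simp
    then have "?f \<circ> flip \<in> even_rearr" using stab rearr_comp[OF flip_rearr fr] by blast
    then have "flip \<circ> (?f \<circ> flip) \<circ> flip \<in> even_rearr" by (rule flip_even_flip)
    moreover have "flip \<circ> (?f \<circ> flip) \<circ> flip = flip \<circ> ?f" by (simp add: fun_eq_iff flip_flip_apply)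
    ultimately show ?thesis using oddf by simp
  next
    assume "r" "r'"
    then have "lin (flip \<circ> (?f \<circ> flip)) (False, []) (False, [])"
      using lin_comp[OF lin_comp[OF fF[of False]] fF[of True]] f by simp
    then have "flip \<circ> (?f \<circ> flip) \<in> even_rearr"
      using stab rearr_comp[OF rearr_comp[OF flip_rearr fr] flip_rearr] by blast
    then have "flip \<circ> (flip \<circ> (?f \<circ> flip)) \<circ> flip \<in> even_rearr" by (rule flip_even_flip)
    moreover have "flip \<circ> (flip \<circ> (?f \<circ> flip)) \<circ> flip = ?f" by (simp add: fun_eq_iff flip_flip_apply)
    ultimately show ?thesis using evenf by simp
  qed
qed

text \<open>In a commutator each factor occurs with its inverse, so the parities cancel.\<close>
lemma commutator_even:
  assumes "a \<in> rearr" "b \<in> rearr"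
  shows "a \<circ> b \<circ> inverse_map a \<circ> inverse_map b \<in> even_rearr"
proof -
  note E = comp_groupD[OF even_comp_group]
  define parity where "parity p f \<longleftrightarrow> (if p then flip \<circ> f else f) \<in> even_rearr" for p f
  have mult: "parity (p \<noteq> q) (f \<circ> g)" if "parity p f" "parity q g" for p q f g
  proof (cases p; cases q)
    assume pq: "p" "q"
    have "f \<circ> g = (flip \<circ> (flip \<circ> f) \<circ> flip) \<circ> (flip \<circ> g)" by (simp add: fun_eq_iff flip_flip_apply)
    then show ?thesis using pq that flip_even_flip E(3) unfolding parity_def by simp
  next
    assume pq: "\<not> p" "q"
    have "flip \<circ> (f \<circ> g) = (flip \<circ> f \<circ> flip) \<circ> (flip \<circ> g)" by (simp add: fun_eq_iff flip_flip_apply)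
    then show ?thesis using pq that flip_even_flip E(3) unfolding parity_def by simp
  next
    assume pq: "p" "\<not> q"
    then have "(flip \<circ> f) \<circ> g \<in> even_rearr" using that E(3) unfolding parity_def by simp
    then show ?thesis using pq unfolding parity_def by (simp add: comp_assoc)
  next
    assume "\<not> p" "\<not> q"
    then show ?thesis using that E(3) unfolding parity_def by simp
  qed
  have inv: "parity p (inverse_map f)" if f: "parity p f" "f \<in> rearr" for p f
  proof (cases p)
    case True
    have "inverse_map (flip \<circ> (flip \<circ> f) \<circ> flip) \<in> even_rearr"
      using f True flip_even_flip E(4) unfolding parity_def by simp
    moreover have "flip \<circ> (flip \<circ> f) \<circ> flip = f \<circ> flip" by (simp add: fun_eq_iff flip_flip_apply)
    moreover have "inverse_map (f \<circ> flip) = flip \<circ> inverse_map f"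
      using inverse_map_comp[OF rearr_bij[OF f(2)] rearr_bij[OF flip_rearr]] inverse_map_involution[OF flip_flip] by simp
    ultimately show ?thesis using True unfolding parity_def by simp
  qed (use f E(4) in \<open>simp add: parity_def\<close>)
  obtain p q where pq: "parity p a" "parity q b"
    using even_or_odd[OF assms(1)] even_or_odd[OF assms(2)] unfolding parity_def by metis
  have "parity (((p \<noteq> q) \<noteq> p) \<noteq> q) (a \<circ> b \<circ> inverse_map a \<circ> inverse_map b)"
    by (intro mult inv pq assms)
  then show ?thesis unfolding parity_def by (cases p; cases q; simp)
qed

lemma derived_subset_even: "derived T_B (carrier T_B) \<subseteq> even_rearr"
  unfolding derived_def
proof (rule group.generate_subgroup_incl[OF T_B_group _ even_subgroup])
  show "derived_set T_B (carrier T_B) \<subseteq> even_rearr"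
    using commutator_even by (auto simp: T_B_simps T_B_inv)
qed

lemma derived_normalized: "normalized_by (derived T_B (carrier T_B)) rearr"
proof -
  have n: "derived T_B (carrier T_B) \<lhd> T_B" by (rule group.derived_self_is_normal[OF T_B_group])
  show ?thesis
    unfolding normalized_by_def
    using subgroup_comp_group[OF normal_imp_subgroup[OF n]] normal.inv_op_closed2[OF n]
    by (auto simp: T_B_simps T_B_inv)
qed

text \<open>\<open>rot_commutator\<close> exhibits rotations in the commutator subgroup. The commutator subgroup is normalised by all
rearrangements, so the remaining generators follow from transitivity and the relations.\<close>
lemma even_subset_derived: "even_generators \<subseteq> derived T_B (carrier T_B)"
proof -
  interpret even_overgroup rearr by (rule even_overgroupI[OF comp_group_rearr even_generators_rearr])
  let ?D = "derived T_B (carrier T_B)"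
  note D = derived_normalized
  have comm: "a \<circ> b \<circ> inverse_map a \<circ> inverse_map b \<in> ?D" if "a \<in> rearr" "b \<in> rearr" for a b
  proof -
    have "a \<otimes>\<^bsub>T_B\<^esub> b \<otimes>\<^bsub>T_B\<^esub> m_inv T_B a \<otimes>\<^bsub>T_B\<^esub> m_inv T_B b \<in> ?D"
      unfolding derived_def by (rule generate.incl) (use that in \<open>auto simp: T_B_simps\<close>)
    then show ?thesis using that by (simp add: T_B_simps T_B_inv)
  qed
  have RL: "rot (J \<odot> [Rt, Lt]) \<in> ?D" for J
    unfolding rot_commutator[of J]
    using D comm[OF rot_mem rearr_inv[OF rot_mem]] rearr_inv[OF rot_mem] unfolding normalized_by_def by blast
  have "rot (r, [Lt]) \<in> ?D" for r
    using normalized_linked[OF D _ RL[of "(r, [])"]] linked_colour[of Lt r "[Rt]"] by (simp add: colour_def)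
  then have "rot J \<in> ?D" for J by (rule all_rot_mem[OF D])
  then show ?thesis unfolding even_generators_def using half_turns_mem[OF D] by blast
qed

theorem derived_eq_even: "derived T_B (carrier T_B) = even_rearr"
  using derived_subset_even even_minimal[OF _ even_subset_derived]
    group.derived_is_subgroup[OF T_B_group order_refl] by blast

theorem theorem8p4:
  shows "is_simple (T_B\<lparr>carrier := derived T_B (carrier T_B)\<rparr>)"
  unfolding derived_eq_even is_simple_def
proof (intro conjI allI impI)
  let ?G = "T_B\<lparr>carrier := even_rearr\<rparr>"
  interpret even_overgroup even_rearr by (rule even_even_overgroup)
  show G: "group ?G" by (rule group.subgroup_imp_group[OF T_B_group even_subgroup])
  show "carrier ?G \<noteq> {\<one>\<^bsub>?G\<^esub>}"
    using rot_mem[of "(True, [])"] rot_ne_id by (auto simp: T_B_simps)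
  fix N assume N: "N \<lhd> ?G"
  have sub: "subgroup N T_B"
    using group.incl_subgroup[OF T_B_group even_subgroup normal_imp_subgroup[OF N]] .
  have "normalized_by N even_rearr"
    unfolding normalized_by_def
  proof (intro conjI ballI)
    show "comp_group N" by (rule subgroup_comp_group[OF sub])
    fix s n assume s: "s \<in> even_rearr" "n \<in> N"
    have "m_inv ?G s = inverse_map s"
      using group.m_inv_consistent[OF T_B_group even_subgroup s(1)] T_B_inv s(1) comp_groupD(1)[OF even_comp_group] by auto
    then show "s \<circ> n \<circ> inverse_map s \<in> N"
      using normal.inv_op_closed2[OF N, of s n] s by (simp add: T_B_simps)
  qed
  note gens = normalized_contains_generators[OF this]
  show "N = {\<one>\<^bsub>?G\<^esub>} \<or> N = carrier ?G"
  proof (cases "\<exists>n\<in>N. n \<noteq> id")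
    case True
    then have "even_generators \<subseteq> N" using gens unfolding even_generators_def by blast
    then have "even_rearr \<subseteq> N" by (rule even_minimal[OF sub])
    then show ?thesis using subgroup.subset[OF normal_imp_subgroup[OF N]] by auto
  next
    case False
    then show ?thesis using subgroup.one_closed[OF sub] by (auto simp: T_B_simps)
  qed
qed

end
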